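(* Let $F$ be a planar graph and let $n$ be an integer with $n\geq \max\{2.67\times 9^{17},\frac{10}{9}|V(F)|\}$ such that $F$ is not contained in $K_{2,n-2}$ (as a subgraph). Suppose that $G$ is a connected graph belonging to $\mathrm{SPEX}_{\mathcal{P}}(n,F)$, and let $X=(x_v:v\in V(G))^T$ be the positive eigenvector of $A(G)$ corresponding to $\rho:=\rho(G)$ with $\max_{v\in V(G)}x_v=1$. Then the following two statements hold. (i) There exist two vertices $u',u''\in V(G)$ such that $R:=N_G(u')\cap N_G(u'')=V(G)\setminus\{u',u''\}$ and $x_{u'}=x_{u''}=1$. In particular, $G$ contains a copy of $K_{2,n-2}$. (ii) The subgraph $G[R]$ of $G$ induced by $R$ is a disjoint union of some paths and cycles. Moreover, if $G[R]$ contains a cycle then it is exactly a cycle, i.e., $G[R]\cong C_{n-2}$, and if $u'u''\in E(G)$ then $G[R]$ is a disjoint union of some paths.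
   Context: All graphs are finite, simple and undirected. $A(G)$ is the adjacency matrix of $G$ and the spectral radius $\rho(G)$ is its largest eigenvalue. $N_G(v)$ is the set of neighbours of $v$ in $G$. A graph is $F$-free if it has no (not necessarily induced) subgraph isomorphic to $F$. $\mathrm{SPEX}_{\mathcal{P}}(n,F)$ denotes the set of graphs (up to isomorphism) attaining the maximum spectral radius among all $F$-free planar graphs on $n$ vertices. $P_m$ and $C_m$ denote the path and the cycle on $m$ vertices; a single vertex $P_1=K_1$ counts as a path. *)

theory Defs
  imports "HOL-Analysis.Analysis" "Graph_Theory.Graph_Theory"
begin

text \<open>
  Finite simple undirected graphs are the graphs satisfying \<^locale>\<open>pair_graph\<close>: an undirected
  edge \<open>{u, v}\<close> is represented by the two arcs \<open>(u, v)\<close> and \<open>(v, u)\<close>.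
  The name \<open>connected\<close> is used both in topology and in graph theory; the graph-theoretic one is
  \<open>Digraph_Component.connected\<close>.
\<close>

section \<open>Planar graphs\<close>

text \<open>
  Arcs of the drawing are indexed by undirected edges. The last condition also covers edges
  without a common endpoint, whose arcs have to be disjoint.
\<close>

definition plane_drawing ::
    "'a pair_pre_digraph \<Rightarrow> ('a \<Rightarrow> complex) \<Rightarrow> ('a set \<Rightarrow> real \<Rightarrow> complex) \<Rightarrow> bool" where
  "plane_drawing G f \<gamma> \<longleftrightarrow>
     inj_on f (pverts G) \<and>
     (\<forall>(u, v) \<in> parcs G.
        arc (\<gamma> {u, v}) \<and>
        {pathstart (\<gamma> {u, v}), pathfinish (\<gamma> {u, v})} = {f u, f v} \<and>
        path_image (\<gamma> {u, v}) \<inter> f ` pverts G = {f u, f v}) \<and>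
     (\<forall>(u, v) \<in> parcs G. \<forall>(w, z) \<in> parcs G. {u, v} \<noteq> {w, z} \<longrightarrow>
        path_image (\<gamma> {u, v}) \<inter> path_image (\<gamma> {w, z}) = f ` ({u, v} \<inter> {w, z}))"

definition planar :: "'a pair_pre_digraph \<Rightarrow> bool" where
  "planar G \<longleftrightarrow> (\<exists>f \<gamma>. plane_drawing G f \<gamma>)"


section \<open>Neighbourhoods, subgraph containment, paths and cycles\<close>

definition nbhd :: "'a pair_pre_digraph \<Rightarrow> 'a \<Rightarrow> 'a set" where
  "nbhd G v = {u \<in> pverts G. (v, u) \<in> parcs G}"

definition contains_copy :: "('a, 'b) pre_digraph \<Rightarrow> ('c, 'd) pre_digraph \<Rightarrow> bool" where
  "contains_copy G F \<longleftrightarrow> (\<exists>S. subgraph S G \<and> digraph_iso F S)"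

definition path_graph :: "nat \<Rightarrow> nat pair_pre_digraph" where
  "path_graph m = \<lparr> pverts = {..<m}, parcs = {(i, j). i < m \<and> j < m \<and> (j = Suc i \<or> i = Suc j)} \<rparr>"

text \<open>The following is the cycle \<open>C\<^sub>m\<close> only for \<open>m \<ge> 3\<close>.\<close>

definition cycle_graph :: "nat \<Rightarrow> nat pair_pre_digraph" where
  "cycle_graph m = \<lparr> pverts = {..<m},
     parcs = {(i, j). i < m \<and> j < m \<and> (j = Suc i mod m \<or> i = Suc j mod m)} \<rparr>"

definition is_path :: "('a, 'b) pre_digraph \<Rightarrow> bool" where
  "is_path H \<longleftrightarrow> (\<exists>m \<ge> 1. digraph_iso H (path_graph m))"

definition is_cycle :: "('a, 'b) pre_digraph \<Rightarrow> bool" where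
  "is_cycle H \<longleftrightarrow> (\<exists>m \<ge> 3. digraph_iso H (cycle_graph m))"

text \<open>For symmetric digraphs, \<open>sccs\<close> is the set of connected components.\<close>

definition disjoint_union_of_paths :: "('a, 'b) pre_digraph \<Rightarrow> bool" where
  "disjoint_union_of_paths H \<longleftrightarrow> (\<forall>C \<in> pre_digraph.sccs H. is_path C)"

definition disjoint_union_of_paths_and_cycles :: "('a, 'b) pre_digraph \<Rightarrow> bool" where
  "disjoint_union_of_paths_and_cycles H \<longleftrightarrow> (\<forall>C \<in> pre_digraph.sccs H. is_path C \<or> is_cycle C)"


section \<open>Spectral radius\<close>

text \<open>
  Matrices and vectors are indexed by the vertices; only entries at vertices of \<open>G\<close> matter.
\<close>

definition adj_matrix :: "'a pair_pre_digraph \<Rightarrow> 'a \<Rightarrow> 'a \<Rightarrow> real" where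
  "adj_matrix G u v = (if (u, v) \<in> parcs G then 1 else 0)"

definition adj_eigenvector :: "'a pair_pre_digraph \<Rightarrow> ('a \<Rightarrow> real) \<Rightarrow> real \<Rightarrow> bool" where
  "adj_eigenvector G x l \<longleftrightarrow>
     (\<exists>v \<in> pverts G. x v \<noteq> 0) \<and>
     (\<forall>v \<in> pverts G. (\<Sum>u \<in> pverts G. adj_matrix G v u * x u) = l * x v)"

definition spec_radius :: "'a pair_pre_digraph \<Rightarrow> real" where
  "spec_radius G = Max {l. \<exists>x. adj_eigenvector G x l}"

text \<open>
  The competitors range over graphs with vertices in the same type \<open>'a\<close>. This loses nothing:
  if there is some graph on \<open>n\<close> vertices of type \<open>'a\<close>, then every graph on \<open>n\<close> vertices has an
  isomorphic copy with vertices in \<open>'a\<close>.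
\<close>

definition planar_free :: "nat \<Rightarrow> 'b pair_pre_digraph \<Rightarrow> 'a pair_pre_digraph \<Rightarrow> bool" where
  "planar_free n F G \<longleftrightarrow>
     pair_graph G \<and> card (pverts G) = n \<and> planar G \<and> \<not> contains_copy G F"

definition SPEX_planar :: "nat \<Rightarrow> 'b pair_pre_digraph \<Rightarrow> 'a pair_pre_digraph set" where
  "SPEX_planar n F =
     {G. planar_free n F G \<and>
         (\<forall>H :: 'a pair_pre_digraph. planar_free n F H \<longrightarrow> spec_radius H \<le> spec_radius G)}"

end

theory Submission
  imports Defs
begin

text \<open>
  Let \<open>\<rho>\<close> be the spectral radius of \<open>G\<close>. Since \<open>K\<^sub>2\<^sub>,\<^sub>n\<^sub>-\<^sub>2\<close> is itself a competitor, \<open>\<rho>\<^sup>2 \<ge> 2 n - 4\<close>, and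
  this is almost more than a planar graph can achieve. Indeed \<open>\<rho>\<^sup>2 x\<^sub>u\<close> is the sum of \<open>x\<close> over the ends
  of all walks of length two from \<open>u\<close>. Only \<open>O(n / \<rho>)\<close> vertices have an entry above \<open>1 / 1000\<close>, and
  because a planar bipartite graph on \<open>k\<close> vertices has at most \<open>2 k - 4\<close> edges, the neighbourhood of
  \<open>u\<close> sends little more than \<open>d(u)\<close> edges to those vertices. So \<open>2 n x\<^sub>u\<close> is, up to an error of less
  than one per cent of \<open>n\<close>, at most \<open>d(u) (x\<^sub>u + m)\<close>, where \<open>m\<close> bounds the entries at the other vertices
  (lemmas \<open>second_moment\<close> and \<open>degree_lower\<close>). Applied to a vertex with entry \<open>1\<close> this produces two
  hubs adjacent to nearly all vertices. As \<open>K\<^sub>3\<^sub>,\<^sub>3\<close> is not planar, any other vertex has few neighbours,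
  hence a small entry (\<open>two_hubs_exist\<close>).

  Let \<open>R\<close> be the set of common neighbours of the hubs and \<open>T\<close> the set of the remaining vertices. If
  \<open>T\<close> were not empty, one would delete all edges at \<open>T\<close> and join \<open>T\<close> to the hubs. An edge to a hub
  has large weight, while the deleted ones are few and join small entries, so the quadratic form
  at \<open>x\<close> increases. The new graph contains no copy of \<open>F\<close>, as a vertex of \<open>T\<close> in such a copy could be
  exchanged for an unused vertex of \<open>R\<close>; here \<open>\<bar>V(F)\<bar> \<le> 9 n / 10 \<le> \<bar>R\<bar>\<close> matters. It is planar if \<open>G[R]\<close>
  has no cycle: maximum degree two makes \<open>G[R]\<close> a union of paths, which can be laid out on a line with
  one hub on either side. If \<open>G[R]\<close> has a cycle, then that cycle fills \<open>R\<close>, since two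
  hubs joined to a cycle and to each other, possibly through one more vertex, are not planar. In that
  case either some vertex of \<open>T\<close> sees a hub, so that its entry pays for cutting the cycle at one
  edge, or none does, and then it is enough to hang all of \<open>T\<close> on one hub (\<open>T_empty\<close>).
  With \<open>T = {}\<close> the eigenvector equations at the two hubs force equal entries, and the structure of
  \<open>G[R]\<close> has already been described.

  Planarity is given by topological drawings. The edge bounds are obtained by counting faces, with
  the Jordan curve theorem showing that an edge closing a cycle creates a new face and with
  Janiszewski's theorem bounding the number of faces along an edge. The nonplanar graphs above are
  recognised by their number of edges alone. The rewired graphs are drawn explicitly
  (\<open>planar_two_hubs\<close>).
\<close>

section \<open>Counting the faces of a plane drawing\<close>


text \<open>
  The bare name refers to connectedness of graphs.
\<close>

abbreviation top_connected :: "'a::topological_space set \<Rightarrow> bool" where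
  "top_connected \<equiv> Topological_Spaces.connected"

definition reach :: "'a set set \<Rightarrow> 'a \<Rightarrow> 'a \<Rightarrow> bool" where
  "reach T = (\<lambda>a b. {a, b} \<in> T)\<^sup>*\<^sup>*"

lemma reach_mono: "reach T a b \<Longrightarrow> T \<subseteq> T' \<Longrightarrow> reach T' a b"
  unfolding reach_def by (rule rtranclp_mono[THEN predicate2D]) auto

lemma reach_sym: "reach T a b \<Longrightarrow> reach T b a"
  unfolding reach_def by (rule sympD[OF symp_rtranclp]) (auto simp: symp_def insert_commute)

lemma reach_trans: "reach T a b \<Longrightarrow> reach T b c \<Longrightarrow> reach T a c"
  unfolding reach_def by auto

lemma reach_edge: "{a, b} \<in> T \<Longrightarrow> reach T a b"
  unfolding reach_def by auto

lemma reach_refl: "reach T a a"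
  unfolding reach_def by auto

text \<open>
  The labels name the components of the forest \<open>T\<close>. An edge between two labels is added to \<open>T\<close>
  and the labels are merged, so every edge of \<open>T\<close> costs one label. This is the bound on the size of
  a forest without any mention of trees.
\<close>

lemma spanning_forest:
  assumes "finite E" "finite P" "\<And>e. e \<in> E \<Longrightarrow> \<exists>a b. a \<in> P \<and> b \<in> P \<and> e = {a, b}"
  shows "\<exists>T c. T \<subseteq> E \<and> (\<forall>v\<in>P. \<forall>w\<in>P. (c v :: 'a) = c w \<longrightarrow> reach T v w) \<and>
    (\<forall>e\<in>E. \<forall>v\<in>e. \<forall>w\<in>e. c v = c w) \<and> card T + card (c ` P) \<le> card (P :: 'a set)"
  using assms(1,3)
proof (induction E rule: finite_induct)
  case empty
  have "{} \<subseteq> ({} :: 'a set set) \<and> (\<forall>v\<in>P. \<forall>w\<in>P. id v = id w \<longrightarrow> reach {} v w) \<and>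
    (\<forall>e\<in>{}. \<forall>v\<in>e. \<forall>w\<in>e. id v = id w) \<and> card ({}::'a set set) + card (id ` P) \<le> card P"
    by (auto simp: reach_refl)
  then show ?case by (intro exI[of _ "{}"] exI[of _ id]) blast
next
  case (insert e E)
  have "\<exists>T c. T \<subseteq> E \<and> (\<forall>v\<in>P. \<forall>w\<in>P. (c v :: 'a) = c w \<longrightarrow> reach T v w) \<and>
    (\<forall>e\<in>E. \<forall>v\<in>e. \<forall>w\<in>e. c v = c w) \<and> card T + card (c ` P) \<le> card P"
    by (rule insert.IH) (use insert.prems in simp)
  then obtain T and c :: "'a \<Rightarrow> 'a" where T: "T \<subseteq> E"
    and c: "\<forall>v\<in>P. \<forall>w\<in>P. c v = c w \<longrightarrow> reach T v w"
    and cE: "\<forall>e\<in>E. \<forall>v\<in>e. \<forall>w\<in>e. c v = c w"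
    and card: "card T + card (c ` P) \<le> card P" by (elim exE conjE) (rule that)
  obtain a b where ab: "a \<in> P" "b \<in> P" "e = {a, b}" using insert.prems[of e] by auto
  show ?case
  proof (cases "c a = c b")
    case True
    have "c v = c w" if "f \<in> insert e E" "v \<in> f" "w \<in> f" for f v w
    proof (cases "f \<in> E")
      case True
      then show ?thesis by (rule bspec[OF bspec[OF bspec[OF cE] that(2)] that(3)])
    next
      case False
      then have "v \<in> {a, b}" "w \<in> {a, b}" using that ab(3) by auto
      then show ?thesis using True by (elim insertE emptyE) simp_all
    qed
    with T c card show ?thesis by (intro exI[of _ T] exI[of _ c] conjI ballI) (assumption | blast)+
  next
    case False
    define c' where "c' = (\<lambda>v. if c v = c a then c b else c v)"
    have img: "c' ` P \<subseteq> c ` P - {c a}" using ab False unfolding c'_def by auto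
    have "card (c' ` P) \<le> card (c ` P - {c a})"
      using img assms(2) by (intro card_mono) auto
    also have "\<dots> = card (c ` P) - 1" using ab assms(2) by simp
    finally have c1: "card (c' ` P) \<le> card (c ` P) - 1" .
    have "card (c ` P) > 0" using ab assms(2) by (auto simp: card_gt_0_iff)
    have finT: "finite T" using T insert.hyps(1) finite_subset by blast
    have "card (insert e T) \<le> Suc (card T)" by (simp add: card_insert_le_m1 finT card_insert_if)
    with c1 card \<open>card (c ` P) > 0\<close> have card': "card (insert e T) + card (c' ` P) \<le> card P" by linarith
    have r: "reach (insert e T) v w" if vw: "v \<in> P" "w \<in> P" "c' v = c' w" for v w
    proof -
      have R: "\<And>x y. x \<in> P \<Longrightarrow> y \<in> P \<Longrightarrow> c x = c y \<Longrightarrow> reach (insert e T) x y"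
        using c reach_mono[of T _ _ "insert e T"] by blast
      have E: "reach (insert e T) a b" "reach (insert e T) b a"
        using ab by (auto intro!: reach_edge simp: insert_commute)
      have "c v = c w \<or> (c v = c a \<and> c w = c b) \<or> (c v = c b \<and> c w = c a)"
        using vw(3) unfolding c'_def by (cases "c v = c a"; cases "c w = c a") simp_all
      then consider "c v = c w" | "c v = c a" "c w = c b" | "c v = c b" "c w = c a"
        by blast
      then show ?thesis
      proof cases
        case 1 then show ?thesis by (rule R[OF vw(1,2)])
      next
        case 2
        have "reach (insert e T) v a" "reach (insert e T) b w"
          using R[OF vw(1) ab(1) 2(1)] R[OF ab(2) vw(2) 2(2)[symmetric]] by auto
        then show ?thesis using E(1) reach_trans by metis
      next
        case 3
        have "reach (insert e T) v b" "reach (insert e T) a w"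
          using R[OF vw(1) ab(2) 3(1)] R[OF ab(1) vw(2) 3(2)[symmetric]] by auto
        then show ?thesis using E(2) reach_trans by metis
      qed
    qed
    have "c' v = c' w" if "f \<in> insert e E" "v \<in> f" "w \<in> f" for f v w
    proof (cases "f \<in> E")
      case True
      then have "c v = c w" by (rule bspec[OF bspec[OF bspec[OF cE] that(2)] that(3)])
      then show ?thesis unfolding c'_def by simp
    next
      case False
      then show ?thesis using that ab(3) unfolding c'_def by auto
    qed
    with T r card' show ?thesis by (intro exI[of _ "insert e T"] exI[of _ c'] conjI) blast+
  qed
qed

lemma Jordan_three_points:
  fixes c :: "real \<Rightarrow> complex"
  assumes "simple_path c" "pathfinish c = pathstart c" "p \<notin> path_image c" "q \<notin> path_image c" "r \<notin> path_image c"
  shows "connected_component (- path_image c) p q \<or> connected_component (- path_image c) p r \<or>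
         connected_component (- path_image c) q r"
proof -
  obtain i o' where io: "top_connected i" "top_connected o'" "i \<union> o' = - path_image c"
    using Jordan_curve[OF assms(1,2)] by metis
  have *: "connected_component (- path_image c) x y" if "x \<in> A" "y \<in> A" "A = i \<or> A = o'" for x y A
    using that io unfolding connected_component_def by blast
  have "p \<in> i \<or> p \<in> o'" "q \<in> i \<or> q \<in> o'" "r \<in> i \<or> r \<in> o'" using assms io(3) by blast+
  then show ?thesis using * by blast
qed

text \<open>
  Vertices are identified with their points and an edge with its pair of ends, so that
  incidence is membership.
\<close>

locale plane_graph =
  fixes P :: "complex set" and E :: "complex set set" and g :: "complex set \<Rightarrow> real \<Rightarrow> complex"
  assumes finP: "finite P"
   and edge: "\<And>e. e \<in> E \<Longrightarrow> \<exists>a b. a \<in> P \<and> b \<in> P \<and> a \<noteq> b \<and> e = {a, b} \<and> arc (g e) \<and> pathstart (g e) = a \<and> pathfinish (g e) = b"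
   and vert: "\<And>e. e \<in> E \<Longrightarrow> path_image (g e) \<inter> P = e"
   and cross: "\<And>e e'. e \<in> E \<Longrightarrow> e' \<in> E \<Longrightarrow> e \<noteq> e' \<Longrightarrow> path_image (g e) \<inter> path_image (g e') = e \<inter> e'"
begin

definition drawn :: "complex set set \<Rightarrow> complex set" where
  "drawn F = P \<union> (\<Union>e\<in>F. path_image (g e))"

abbreviation same_face :: "complex set set \<Rightarrow> complex \<Rightarrow> complex \<Rightarrow> bool" where
  "same_face F \<equiv> connected_component (- drawn F)"

lemma edge_sub: "e \<in> E \<Longrightarrow> e \<subseteq> P" using edge by blast
lemma finE: "finite E"
  using finP edge_sub by (meson Pow_iff finite_Pow_iff finite_subset subsetI)
lemma card_edge: "e \<in> E \<Longrightarrow> card e = 2" using edge[of e] by (auto simp: card_2_iff)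
lemma arc_g: "e \<in> E \<Longrightarrow> arc (g e)" using edge by blast
lemma compact_g: "e \<in> E \<Longrightarrow> compact (path_image (g e))" using arc_g compact_arc_image by blast

lemma compact_part: "B \<subseteq> P \<Longrightarrow> F \<subseteq> E \<Longrightarrow> compact (B \<union> (\<Union>e\<in>F. path_image (g e)))"
  using finite_subset[OF _ finP] finite_subset[OF _ finE] compact_g
  by (intro compact_Un compact_UN) (auto intro: finite_imp_compact)

lemma compact_drawn: "F \<subseteq> E \<Longrightarrow> compact (drawn F)"
  unfolding drawn_def by (rule compact_part) auto

lemma open_compl_drawn: "F \<subseteq> E \<Longrightarrow> open (- drawn F)"
  using compact_drawn compact_imp_closed by (auto simp: open_Compl)

lemma drawn_mono: "F \<subseteq> F' \<Longrightarrow> drawn F \<subseteq> drawn F'" unfolding drawn_def by auto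

lemma drawn_insert: "drawn (insert e F) = drawn F \<union> path_image (g e)" unfolding drawn_def by auto

lemma img_Int_drawn: "e \<in> E \<Longrightarrow> F \<subseteq> E \<Longrightarrow> e \<notin> F \<Longrightarrow> path_image (g e) \<inter> drawn F = e"
proof -
  assume a: "e \<in> E" "F \<subseteq> E" "e \<notin> F"
  have "path_image (g e) \<inter> drawn F = e \<union> (\<Union>f\<in>F. path_image (g e) \<inter> path_image (g f))"
    unfolding drawn_def Int_Un_distrib vert[OF a(1)] by auto
  also have "\<dots> = e \<union> (\<Union>f\<in>F. e \<inter> f)" using cross[OF a(1)] a by blast
  finally show ?thesis by auto
qed

lemma open_arc:
  assumes "e \<in> E"
  shows "path_image (g e) - e \<noteq> {}" "top_connected (path_image (g e) - e)"
proof -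
  obtain a b where ab: "e = {a, b}" "arc (g e)" "pathstart (g e) = a" "pathfinish (g e) = b"
    using edge[OF assms] by blast
  then have s: "simple_path (g e)" using arc_imp_simple_path by blast
  show "top_connected (path_image (g e) - e)"
    using connected_simple_path_endless[OF s] ab by simp
  show "path_image (g e) - e \<noteq> {}"
    using nonempty_simple_path_endless[OF s] ab by simp
qed

lemma reach_path:
  assumes "F \<subseteq> E" "a \<in> P" "reach F a b"
  shows "path_component (drawn F) a b"
  using assms(3) unfolding reach_def
proof (induction rule: rtranclp_induct)
  case base
  then show ?case using assms(2) by (simp add: path_component_refl drawn_def)
next
  case (step x y)
  obtain u v where uv: "{x, y} = {u, v}" "arc (g {x,y})" "pathstart (g {x,y}) = u" "pathfinish (g {x,y}) = v"
    using edge step.hyps(2) assms(1) by (metis subsetD)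
  have "path_image (g {x,y}) \<subseteq> drawn F" using step.hyps(2) unfolding drawn_def by auto
  with uv have "path_component (drawn F) u v"
    unfolding path_component_def using arc_imp_path by blast
  with uv(1) have "path_component (drawn F) x y"
    by (metis doubleton_eq_iff path_component_sym)
  with step.IH show ?case by (rule path_component_trans)
qed

text \<open>
  The detour \<open>h\<close> through the old drawing is kept separate from the curve: the curve meets the
  drawing exactly in \<open>h\<close>, and it is the connectedness of this intersection that Janiszewski's
  theorem asks for.
\<close>

lemma closing_curve:
  assumes "F \<subseteq> E" "e \<in> E" "e \<notin> F" "e = {a, b}" "reach F a b"
  obtains h c where "simple_path c" "pathfinish c = pathstart c" "path_image c = h \<union> path_image (g e)"
    "h \<subseteq> drawn F" "top_connected h" "e \<subseteq> h"
proof -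
  obtain u v where uv: "u \<in> P" "v \<in> P" "u \<noteq> v" "e = {u, v}" "arc (g e)" "pathstart (g e) = u" "pathfinish (g e) = v"
    using edge[OF assms(2)] by blast
  have "reach F v u" using assms(4,5) uv(4) reach_sym by (metis doubleton_eq_iff)
  from reach_path[OF assms(1) uv(2) this] obtain k where
    k: "path k" "path_image k \<subseteq> drawn F" "pathstart k = v" "pathfinish k = u"
    unfolding path_component_def by blast
  obtain q where q: "arc q" "path_image q \<subseteq> path_image k" "pathstart q = v" "pathfinish q = u"
    using path_contains_arc[OF k(1) k(3) k(4)] uv(3) by metis
  have "path_image (g e) \<inter> path_image q \<subseteq> e"
    using img_Int_drawn[OF assms(2,1,3)] q(2) k(2) by blast
  then have s: "simple_path (g e +++ q)"
    using uv q by (intro simple_path_join_loop) auto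
  have img: "path_image (g e +++ q) = path_image q \<union> path_image (g e)"
    using uv q by (subst path_image_join) auto
  show ?thesis
  proof (rule that[OF s _ img])
    show "path_image q \<subseteq> drawn F" using q k by blast
    show "top_connected (path_image q)" using q connected_arc_image by blast
    show "e \<subseteq> path_image q" using q uv pathstart_in_path_image pathfinish_in_path_image by fastforce
  qed (use uv q in auto)
qed

lemma cycle_edge_Janiszewski:
  assumes "F \<subseteq> E" "e \<in> E" "e \<notin> F"
    and c: "path_image c = h \<union> path_image (g e)" "simple_path c" "h \<subseteq> drawn F" "top_connected h" "e \<subseteq> h"
    and "same_face F p q" "connected_component (- path_image c) p q"
  shows "same_face (insert e F) p q"
proof -
  have eq: "drawn F \<inter> path_image c = h"
    using img_Int_drawn[OF assms(2,1,3)] c(3,5) unfolding c(1) by blast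
  have "connected_component (- (drawn F \<union> path_image c)) p q"
    using assms eq by (intro Janiszewski compact_drawn closed_simple_path_image) auto
  moreover have "drawn F \<union> path_image c = drawn (insert e F)"
    using c unfolding drawn_insert by blast
  ultimately show ?thesis by simp
qed

text \<open>
  The old drawing splits into the part \<open>XA\<close> reachable from \<open>a\<close> and the rest \<open>Y\<close>, which contains
  \<open>b\<close>. First the new arc is glued to \<open>XA\<close> in the single point \<open>a\<close>, then \<open>Y\<close> is glued on in the
  single point \<open>b\<close>; by Janiszewski's theorem neither step separates \<open>p\<close> from \<open>q\<close>.
\<close>

lemma bridge_keeps_face:
  assumes F: "F \<subseteq> E" and e: "e \<in> E" "e \<notin> F" "e = {a, b}" and nr: "\<not> reach F a b"
    and pq: "same_face F p q" "p \<notin> path_image (g e)" "q \<notin> path_image (g e)"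
  shows "same_face (insert e F) p q"
proof -
  define A where "A = {v \<in> P. reach F a v}"
  define FA where "FA = {f \<in> F. f \<inter> A \<noteq> {}}"
  define XA where "XA = A \<union> (\<Union>f\<in>FA. path_image (g f))"
  define Y where "Y = (P - A) \<union> (\<Union>f\<in>F - FA. path_image (g f))"
  have FAE: "FA \<subseteq> E" using F FA_def by auto
  have FA: "f \<subseteq> A" if "f \<in> FA" for f
  proof -
    have "f \<in> F" "f \<in> E" using that F FA_def by auto
    obtain x y where xy: "x \<in> P" "y \<in> P" "f = {x, y}" using edge[OF \<open>f \<in> E\<close>] by blast
    have "reach F x y" "reach F y x" using xy \<open>f \<in> F\<close> by (auto intro!: reach_edge simp: insert_commute)
    moreover from that xy(3) have "x \<in> A \<or> y \<in> A" unfolding FA_def by auto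
    ultimately have "reach F a x" "reach F a y" unfolding A_def by (auto intro: reach_trans)
    then show ?thesis using xy unfolding A_def by auto
  qed
  have un: "XA \<union> Y = drawn F" unfolding XA_def Y_def drawn_def FA_def A_def by auto
  have c1: "path_image (g f) \<inter> A \<subseteq> f \<inter> A" if "f \<in> F" for f
    using vert[of f] that F A_def by blast
  have c2: "path_image (g f) \<inter> path_image (g f') = {}" if "f \<in> FA" "f' \<in> F - FA" for f f'
  proof -
    have "f \<noteq> f'" "f \<in> E" "f' \<in> E" using that F FA_def by auto
    then have "path_image (g f) \<inter> path_image (g f') = f \<inter> f'" using cross by blast
    also have "\<dots> \<subseteq> A \<inter> f'" using FA that by blast
    also have "\<dots> = {}" using that unfolding FA_def by auto
    finally show ?thesis by simp
  qed
  have c3: "path_image (g f) \<inter> (P - A) = {}" if "f \<in> FA" for f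
    using vert[of f] that F FA FAE by blast
  have disj: "XA \<inter> Y = {}"
  proof -
    have "path_image (g f) \<inter> A = {}" if "f \<in> F - FA" for f using c1[of f] that unfolding FA_def by blast
    then show ?thesis unfolding XA_def Y_def using c2 c3 by blast
  qed
  have ge: "path_image (g e) \<inter> drawn F = {a, b}" using img_Int_drawn[OF e(1) F e(2)] e(3) by simp
  have abP: "a \<in> P" "b \<in> P" using edge_sub[OF e(1)] e(3) by auto
  have aX: "a \<in> XA" using abP reach_refl[of F a] unfolding XA_def A_def by auto
  have bY: "b \<in> Y" using abP nr unfolding Y_def A_def by auto
  have cl: "compact XA" "closed Y"
  proof -
    show "compact XA" unfolding XA_def using FAE by (intro compact_part) (auto simp: A_def)
    have "compact Y" unfolding Y_def using F by (intro compact_part) auto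
    then show "closed Y" by (rule compact_imp_closed)
  qed
  have i1: "XA \<inter> path_image (g e) = {a}"
  proof -
    have "XA \<inter> path_image (g e) \<subseteq> {a, b}" "a \<in> path_image (g e)" "b \<notin> XA" using ge un bY disj by auto
    then show ?thesis using aX by auto
  qed
  have i2: "(XA \<union> path_image (g e)) \<inter> Y = {b}"
  proof -
    have "(XA \<union> path_image (g e)) \<inter> Y \<subseteq> {a, b}" "b \<in> path_image (g e)" "a \<notin> Y" using ge un aX disj by auto
    then show ?thesis using bY by auto
  qed
  have "connected_component (- path_image (g e)) p q"
    using connected_arc_complement[OF arc_g[OF e(1)]] pq(2,3)
    by (simp add: connected_iff_connected_component)
  moreover have "connected_component (- XA) p q" "connected_component (- Y) p q"
    using pq(1) connected_component_of_subset un by (metis Compl_anti_mono sup_ge1, metis Compl_anti_mono sup_ge2)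
  ultimately have "connected_component (- (XA \<union> path_image (g e))) p q"
    by (intro Janiszewski[OF cl(1) closed_arc_image[OF arc_g[OF e(1)]]]) (use i1 in simp_all)
  with \<open>connected_component (- Y) p q\<close> have "connected_component (- ((XA \<union> path_image (g e)) \<union> Y)) p q"
    by (intro Janiszewski[OF compact_Un[OF cl(1) compact_g[OF e(1)]] cl(2)]) (use i2 in simp_all)
  moreover have "(XA \<union> path_image (g e)) \<union> Y = drawn (insert e F)" unfolding drawn_insert using un by blast
  ultimately show ?thesis by simp
qed

text \<open>
  If the edge closes a cycle, two of the three points lie on the same side of that closed
  curve and Janiszewski's theorem applies; otherwise the edge separates nothing.
\<close>

lemma edge_two_faces:
  assumes F: "F \<subseteq> E" "e \<in> E" "e \<notin> F"
    and nin: "p \<notin> drawn (insert e F)" "q \<notin> drawn (insert e F)" "r \<notin> drawn (insert e F)"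
    and cc: "same_face F p q" "same_face F p r"
  shows "same_face (insert e F) p q \<or> same_face (insert e F) p r \<or>
         same_face (insert e F) q r"
proof -
  obtain a b where ab: "e = {a, b}" using edge[OF F(2)] by blast
  have qr: "same_face F q r" using cc connected_component_sym connected_component_trans by metis
  show ?thesis
  proof (cases "reach F a b")
    case True
    obtain h c where hc: "simple_path c" "pathfinish c = pathstart c" "path_image c = h \<union> path_image (g e)"
      "h \<subseteq> drawn F" "top_connected h" "e \<subseteq> h" using closing_curve[OF F ab True] by metis
    have "path_image c \<subseteq> drawn (insert e F)" using hc unfolding drawn_insert by blast
    then have "p \<notin> path_image c" "q \<notin> path_image c" "r \<notin> path_image c" using nin by auto
    from Jordan_three_points[OF hc(1,2) this] show ?thesis
      using cycle_edge_Janiszewski[OF F hc(3,1,4-6)] cc qr by blast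
  next
    case False
    show ?thesis using bridge_keeps_face[OF F ab False cc(1)] nin unfolding drawn_insert by auto
  qed
qed

text \<open>
  Faces are counted through representatives. A finite set of pairwise separated points is a lower
  bound for the number of faces and needs no proof that this number is finite.
\<close>

definition separated :: "complex set set \<Rightarrow> complex set \<Rightarrow> bool" where
  "separated F Q \<longleftrightarrow> finite Q \<and> Q \<inter> drawn F = {} \<and>
     (\<forall>p\<in>Q. \<forall>q\<in>Q. p \<noteq> q \<longrightarrow> \<not> same_face F p q)"

text \<open>
  By the Jordan curve theorem both sides of the closing curve accumulate at an interior point
  \<open>z\<close> of the new edge. So the face containing \<open>z\<close> obtains two representatives \<open>q1\<close> and \<open>q2\<close> in place of
  at most one. Each other representative is moved within its face off the new curve.
\<close>

lemma cycle_adds_face: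
  assumes F: "F \<subseteq> E" "e \<in> E" "e \<notin> F" "e = {a, b}" "reach F a b" and Q: "separated F Q"
  shows "\<exists>Q'. separated (insert e F) Q' \<and> Suc (card Q) \<le> card Q'"
proof -
  obtain h c where hc: "simple_path c" "pathfinish c = pathstart c" "path_image c = h \<union> path_image (g e)"
      "h \<subseteq> drawn F" "top_connected h" "e \<subseteq> h" using closing_curve[OF F] by metis
  obtain i o' where io: "open i" "open o'" "i \<inter> o' = {}" "i \<union> o' = - path_image c"
    "frontier i = path_image c" "frontier o' = path_image c"
    using Jordan_curve[OF hc(1,2)] by metis
  let ?C = "same_face F"
  have meets: "U \<inter> i \<noteq> {}" "U \<inter> o' \<noteq> {}" if "open U" "z \<in> U" "z \<in> path_image c" for U z
  proof -
    have "z \<in> closure i" "z \<in> closure o'" using that io by (auto simp: frontier_def)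
    then show "U \<inter> i \<noteq> {}" "U \<inter> o' \<noteq> {}" using that
      by (metis IntI empty_iff open_Int_closure_eq_empty)+
  qed
  have op: "open (connected_component_set (- drawn F) p)" for p
    using open_connected_component[OF open_compl_drawn[OF F(1)]] .
  obtain z where z: "z \<in> path_image (g e)" "z \<notin> e" using open_arc(1)[OF F(2)] by blast
  have zd: "z \<notin> drawn F" using img_Int_drawn[OF F(2,1,3)] z by blast
  have zC: "?C z z" using zd by (simp add: connected_component_refl)
  obtain q1 where q1: "?C z q1" "q1 \<in> i" using meets(1)[OF op[of z], of z] zC z hc(3) by auto
  obtain q2 where q2: "?C z q2" "q2 \<in> o'" using meets(2)[OF op[of z], of z] zC z hc(3) by auto
  have "\<exists>p'. ?C p p' \<and> p' \<notin> path_image c" if "p \<in> Q" for p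
  proof (cases "p \<in> path_image c")
    case False
    then show ?thesis using Q that unfolding separated_def by (intro exI[of _ p]) (auto intro!: connected_component_refl)
  next
    case True
    have "?C p p" using Q that unfolding separated_def by (auto intro!: connected_component_refl)
    then show ?thesis using meets(1)[OF op[of p], of p] True io(4) by blast
  qed
  then obtain m where m: "\<And>p. p \<in> Q \<Longrightarrow> ?C p (m p) \<and> m p \<notin> path_image c" by metis
  define Q1 where "Q1 = {p \<in> Q. \<not> ?C z p}"
  have finQ: "finite Q" "finite Q1" using Q unfolding separated_def Q1_def by auto
  have C_in: "?C x y \<Longrightarrow> y \<notin> drawn F" for x y using connected_component_in by fastforce
  have "card (Q - Q1) \<le> 1"
  proof -
    have "x = y" if "x \<in> Q - Q1" "y \<in> Q - Q1" for x y
    proof (rule ccontr)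
      assume "x \<noteq> y"
      have "?C z x" "?C z y" using that unfolding Q1_def by auto
      then have "?C x y" using connected_component_sym connected_component_trans by metis
      then show False using Q that \<open>x \<noteq> y\<close> unfolding separated_def by auto
    qed
    then show ?thesis using finQ by (auto simp: card_le_Suc0_iff_eq)
  qed
  then have cQ: "card Q \<le> card Q1 + 1"
    using finQ card_Diff_subset[of Q1 Q] card_mono[of Q Q1] unfolding Q1_def by auto
  define Q' where "Q' = insert q1 (insert q2 (m ` Q1))"
  have injm: "inj_on m Q1"
  proof (rule inj_onI, rule ccontr)
    fix x y assume a: "x \<in> Q1" "y \<in> Q1" "m x = m y" "x \<noteq> y"
    then have "x \<in> Q" "y \<in> Q" unfolding Q1_def by auto
    then have "?C x (m x)" "?C y (m x)" using m a(3) by metis+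
    then have "?C x y" using connected_component_sym connected_component_trans by metis
    then show False using Q a unfolding separated_def Q1_def by auto
  qed
  have nz: "\<not> ?C z (m p)" if "p \<in> Q1" for p
    using that m connected_component_sym connected_component_trans unfolding Q1_def by (smt (verit, best) mem_Collect_eq)
  have q12: "q1 \<noteq> q2" using q1 q2 io(3) by auto
  have ni: "q1 \<notin> m ` Q1" "q2 \<notin> m ` Q1" using nz q1 q2 by auto
  have cQ': "card Q' = card Q1 + 2" unfolding Q'_def using q12 ni finQ injm by (simp add: card_image)
  have sub: "same_face (insert e F) x y \<Longrightarrow> ?C x y" for x y
    by (erule connected_component_of_subset) (auto simp: drawn_insert)
  have subc: "path_image c \<subseteq> drawn (insert e F)" using hc unfolding drawn_insert by blast
  have nq: "\<not> same_face (insert e F) q1 q2"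
  proof
    assume "same_face (insert e F) q1 q2"
    then have "connected_component (- path_image c) q1 q2"
      by (rule connected_component_of_subset) (use subc in blast)
    then obtain S where "top_connected S" "S \<subseteq> i \<union> o'" "q1 \<in> S" "q2 \<in> S"
      unfolding connected_component_def io(4) by blast
    then show False using connectedD[of S i o'] io q1 q2 by blast
  qed
  have disj: "Q' \<inter> drawn (insert e F) = {}"
  proof -
    have "q1 \<notin> path_image c" "q2 \<notin> path_image c" using q1 q2 io(4) by auto
    then show ?thesis unfolding Q'_def drawn_insert using C_in q1 q2 m hc(3) unfolding Q1_def by auto
  qed
  have "\<not> same_face (insert e F) x y" if "x \<in> Q'" "y \<in> Q'" "x \<noteq> y" for x y
  proof
    assume a: "same_face (insert e F) x y"
    have cxy: "?C x y" "?C y x" using sub[OF a] connected_component_sym by metis+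
    have t: "?C u v \<Longrightarrow> ?C v w \<Longrightarrow> ?C u w" for u v w by (rule connected_component_trans)
    have mm: False if "p \<in> Q1" "p' \<in> Q1" "m p \<noteq> m p'" "?C (m p) (m p')" for p p'
    proof -
      have "?C p (m p)" "?C (m p') p'" using m that(1,2) connected_component_sym unfolding Q1_def by blast+
      then have "?C p p'" using that(4) t by blast
      then show False using Q that unfolding separated_def Q1_def by auto
    qed
    have mz: False if "p \<in> Q1" "?C z w" "?C w (m p)" for p w using that nz t by blast
    show False
      using that(1,2) unfolding Q'_def
      using that(3) cxy mm mz q1(1) q2(1) a nq connected_component_sym by (smt (verit, best) image_iff insert_iff)
  qed
  then have "separated (insert e F) Q'" unfolding separated_def using disj finQ unfolding Q'_def by auto
  then show ?thesis using cQ cQ' by (intro exI[of _ Q']) auto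
qed

text \<open>
  The inequality half of Euler's formula that bounds the number of faces from below: a spanning forest leaves at
  least one face, and every further edge adds one.
\<close>

lemma many_faces:
  assumes "P \<noteq> {}"
  shows "\<exists>Q. separated E Q \<and> card E + 2 \<le> card P + card Q"
proof -
  obtain T and c :: "complex \<Rightarrow> complex" where T: "T \<subseteq> E" and c: "\<forall>v\<in>P. \<forall>w\<in>P. c v = c w \<longrightarrow> reach T v w"
    and cE: "\<forall>e\<in>E. \<forall>v\<in>e. \<forall>w\<in>e. c v = c w" and card: "card T + card (c ` P) \<le> card P"
    using spanning_forest[OF finE finP] edge by (smt (verit, best))
  have "card (c ` P) \<ge> 1" using assms finP by (simp add: Suc_le_eq card_gt_0_iff)
  with card have cT: "card T + 1 \<le> card P" by linarith
  have "\<exists>Q. separated (T \<union> D) Q \<and> card D + 1 \<le> card Q" if "finite D" "D \<subseteq> E - T" for D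
    using that
  proof (induction D rule: finite_induct)
    case empty
    have "drawn T \<noteq> UNIV" using compact_drawn[OF T] not_compact_UNIV by metis
    then obtain p where "p \<notin> drawn T" by auto
    then have "separated T {p}" unfolding separated_def by auto
    then show ?case by (intro exI[of _ "{p}"]) auto
  next
    case (insert e D)
    from insert.IH insert.prems obtain Q where Q: "separated (T \<union> D) Q" "card D + 1 \<le> card Q" by auto
    have e: "e \<in> E" "e \<notin> T \<union> D" "T \<union> D \<subseteq> E" using insert.hyps insert.prems T by blast+
    obtain a b where ab: "a \<in> P" "b \<in> P" "e = {a, b}" using edge[OF e(1)] by blast
    have "a \<in> e" "b \<in> e" unfolding ab(3) by auto
    from bspec[OF bspec[OF bspec[OF cE e(1)] this(1)] this(2)] have "c a = c b" .
    then have "reach T a b" using c ab(1,2) by blast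
    then have "reach (T \<union> D) a b" by (rule reach_mono) simp
    from cycle_adds_face[OF e(3,1,2) ab(3) this Q(1)] obtain Q' where
      Q': "separated (insert e (T \<union> D)) Q'" "Suc (card Q) \<le> card Q'" by blast
    have "card (insert e D) = Suc (card D)" using insert by simp
    then show ?case using Q' Q(2) by (intro exI[of _ Q']) auto
  qed
  from this[of "E - T"] finE obtain Q where "separated (T \<union> (E - T)) Q" "card (E - T) + 1 \<le> card Q" by auto
  moreover have "T \<union> (E - T) = E" using T by auto
  moreover have "card (E - T) = card E - card T" using T finE finite_subset by (metis card_Diff_subset)
  ultimately show ?thesis using cT by (intro exI[of _ Q]) auto
qed

text \<open>
  The edges on the boundary of the face of \<open>p\<close>. Contact in an end of the edge does not count,
  since many faces may meet at a vertex.
\<close>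

definition touch :: "complex \<Rightarrow> complex set set" where
  "touch p = {e \<in> E. closure (connected_component_set (- drawn E) p) \<inter> (path_image (g e) - e) \<noteq> {}}"

lemma touch_common_face:
  assumes "e \<in> touch p" "z \<in> path_image (g e) - e"
  shows "same_face (E - {e}) p z"
proof -
  have e: "e \<in> E" using assms(1) unfolding touch_def by auto
  obtain y where y: "y \<in> closure (connected_component_set (- drawn E) p)" "y \<in> path_image (g e)" "y \<notin> e"
    using assms(1) unfolding touch_def by auto
  have sub: "path_image (g e) - e \<subseteq> - drawn (E - {e})"
    using img_Int_drawn[OF e, of "E - {e}"] by blast
  have "same_face (E - {e}) y z"
    unfolding connected_component_def using open_arc(2)[OF e] sub y assms(2) by blast
  moreover have "same_face (E - {e}) p y"
  proof -
    let ?U = "connected_component_set (- drawn (E - {e})) y"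
    have "open ?U" using open_connected_component[OF open_compl_drawn] by blast
    moreover have "y \<in> ?U" using sub y by (auto intro!: connected_component_refl)
    ultimately obtain x where x: "x \<in> ?U" "same_face E p x"
      using y(1) open_Int_closure_eq_empty[of ?U "connected_component_set (- drawn E) p"] by blast
    have "same_face (E - {e}) p x"
      by (rule connected_component_of_subset[OF x(2)]) (use drawn_mono[of "E - {e}" E] in auto)
    then show ?thesis using x(1) connected_component_sym connected_component_trans by (metis mem_Collect_eq)
  qed
  ultimately show ?thesis by (meson connected_component_trans)
qed

text \<open>
  Faces along \<open>e\<close> become one face when \<open>e\<close> is removed, and putting \<open>e\<close> back splits that face
  into at most two.
\<close>

lemma edge_touches_two:
  assumes Q: "separated E Q" and e: "e \<in> E"
  shows "card {p \<in> Q. e \<in> touch p} \<le> 2"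
proof (rule ccontr)
  assume "\<not> ?thesis"
  then have "3 \<le> card {p \<in> Q. e \<in> touch p}" by simp
  then obtain S where S: "S \<subseteq> {p \<in> Q. e \<in> touch p}" "card S = 3" using obtain_subset_with_card_n by metis
  then obtain p q r where pqr: "S = {p, q, r}" "p \<noteq> q" "p \<noteq> r" "q \<noteq> r"
    by (auto simp: card_3_iff)
  obtain z where z: "z \<in> path_image (g e) - e" using open_arc(1)[OF e] by blast
  let ?C = "same_face (E - {e})"
  have "?C p z" "?C q z" "?C r z" using touch_common_face[OF _ z] S(1) pqr by auto
  then have cc: "?C p q" "?C p r" using connected_component_sym connected_component_trans by metis+
  have ie: "insert e (E - {e}) = E" using e by auto
  have Qs: "p \<in> Q" "q \<in> Q" "r \<in> Q" using S pqr by auto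
  then have nin: "p \<notin> drawn E" "q \<notin> drawn E" "r \<notin> drawn E" using Q unfolding separated_def by auto
  have "same_face E p q \<or> same_face E p r \<or> same_face E q r"
    using edge_two_faces[of "E - {e}" e p q r] e nin cc unfolding ie by auto
  then show False using Q Qs pqr unfolding separated_def by blast
qed

text \<open>
  The frontier of the face of \<open>p\<close> is drawn by vertices and touched edges only. Hence the face is
  open and closed in the complement of that part of the drawing, so it is all of this complement
  and leaves no room for another edge.
\<close>

lemma touch_all_if_connected:
  assumes p: "p \<notin> drawn E" and c: "top_connected (- drawn (touch p))"
  shows "touch p = E"
proof -
  let ?F = "connected_component_set (- drawn E) p"
  let ?T = "touch p"
  have TE: "?T \<subseteq> E" unfolding touch_def by auto
  have oF: "open ?F" using open_connected_component[OF open_compl_drawn] by blast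
  have pF: "p \<in> ?F" using p by (auto intro!: connected_component_refl)
  have FE: "?F \<subseteq> - drawn E" using connected_component_subset by blast
  have fr: "closure ?F - ?F \<subseteq> drawn E"
  proof
    fix y assume y: "y \<in> closure ?F - ?F"
    show "y \<in> drawn E"
    proof (rule ccontr)
      assume "y \<notin> drawn E"
      then have yy: "y \<in> connected_component_set (- drawn E) y" by (auto intro!: connected_component_refl)
      have "open (connected_component_set (- drawn E) y)" using open_connected_component[OF open_compl_drawn] by blast
      then have "connected_component_set (- drawn E) y \<inter> ?F \<noteq> {}" using y yy open_Int_closure_eq_empty by blast
      then have "connected_component_set (- drawn E) y = ?F" by (metis connected_component_nonoverlap connected_component_eq_empty)
      then show False using y yy by auto
    qed
  qed
  have fr2: "closure ?F - ?F \<subseteq> drawn ?T"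
  proof
    fix y assume y: "y \<in> closure ?F - ?F"
    then have "y \<in> P \<or> (\<exists>e\<in>E. y \<in> path_image (g e))" using fr unfolding drawn_def by blast
    then show "y \<in> drawn ?T"
    proof
      assume "\<exists>e\<in>E. y \<in> path_image (g e)"
      then obtain e where e: "e \<in> E" "y \<in> path_image (g e)" by blast
      show ?thesis
      proof (cases "y \<in> e")
        case True then show ?thesis using edge_sub[OF e(1)] unfolding drawn_def by auto
      next
        case False
        then have "e \<in> ?T" using e y unfolding touch_def by blast
        then show ?thesis using e unfolding drawn_def by auto
      qed
    qed (auto simp: drawn_def)
  qed
  have "?F \<inter> - drawn ?T = - drawn ?T"
  proof (rule ccontr)
    assume ne: "?F \<inter> - drawn ?T \<noteq> - drawn ?T"
    have sub: "?F \<subseteq> - drawn ?T" using FE drawn_mono[OF TE] by blast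
    have "- drawn ?T \<subseteq> ?F \<union> - closure ?F" using fr2 by blast
    moreover have "?F \<inter> - closure ?F \<inter> - drawn ?T = {}" using closure_subset[of ?F] by blast
    ultimately have "?F \<inter> - drawn ?T = {} \<or> - closure ?F \<inter> - drawn ?T = {}"
      using connectedD[OF c oF, of "- closure ?F"] by blast
    then have "- closure ?F \<inter> - drawn ?T = {}" using pF sub by blast
    then have "- drawn ?T \<subseteq> ?F" using fr2 by blast
    with ne sub show False by blast
  qed
  then have "drawn E \<subseteq> drawn ?T" using FE by blast
  have "e \<in> ?T" if "e \<in> E" for e
  proof (rule ccontr)
    assume "e \<notin> ?T"
    then have "path_image (g e) \<inter> drawn ?T = e" using img_Int_drawn[OF that TE] by blast
    moreover have "path_image (g e) \<subseteq> drawn ?T" using \<open>drawn E \<subseteq> drawn ?T\<close> that unfolding drawn_def by blast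
    ultimately show False using open_arc(1)[OF that] by blast
  qed
  then show ?thesis using TE by blast
qed

text \<open>
  Vertices are left out so that arcs can be glued together in single points.
\<close>

definition net :: "complex set set \<Rightarrow> complex set" where
  "net F = (\<Union>e\<in>F. path_image (g e))"

lemma compact_net: "F \<subseteq> E \<Longrightarrow> compact (net F)"
  using compact_part[of "{}" F] unfolding net_def by simp

lemma net_nonsep_step:
  assumes "F \<subseteq> E" "e \<in> E" "e \<notin> F" "top_connected (- net F)" "card (e \<inter> \<Union>F) \<le> 1"
  shows "top_connected (- net (insert e F))"
proof -
  have "path_image (g e) \<inter> net F = (\<Union>f\<in>F. e \<inter> f)"
    unfolding net_def using cross[OF assms(2)] assms(1,3) by blast
  then have i: "path_image (g e) \<inter> net F = e \<inter> \<Union>F" by auto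
  have "finite (e \<inter> \<Union>F)" using edge_sub[OF assms(2)] finP finite_subset by blast
  with assms(5) have "e \<inter> \<Union>F = {} \<or> (\<exists>x. e \<inter> \<Union>F = {x})"
    by (metis One_nat_def card_0_eq card_1_singletonE le_Suc_eq le_zero_eq)
  then have "top_connected (path_image (g e) \<inter> net F)" unfolding i by auto
  then have "top_connected (- (path_image (g e) \<union> net F))"
    using compact_imp_closed[OF compact_net[OF assms(1)]] assms(4)
      connected_arc_complement[OF arc_g[OF assms(2)]] compact_g[OF assms(2)]
    by (intro Janiszewski_connected) auto
  moreover have "path_image (g e) \<union> net F = net (insert e F)" unfolding net_def by auto
  ultimately show ?thesis by simp
qed

lemma drawn_nonsep:
  assumes "F \<subseteq> E" "top_connected (- net F)"
  shows "top_connected (- drawn F)"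
proof -
  have "top_connected (- (P - net F))"
    using path_connected_complement_countable[of "P - net F"] finP
    by (simp add: countable_finite path_connected_imp_connected)
  then have "top_connected (- (net F \<union> (P - net F)))"
    using assms finP compact_net by (intro Janiszewski_connected finite_imp_closed) auto
  moreover have "net F \<union> (P - net F) = drawn F" unfolding net_def drawn_def by auto
  ultimately show ?thesis by (simp only:)
qed

lemma edges_meet_once:
  assumes "e \<in> E" "f \<in> E" "e \<noteq> f" shows "card (e \<inter> f) \<le> 1"
proof (rule ccontr)
  assume "\<not> ?thesis"
  then have "card (e \<inter> f) \<ge> 2" by simp
  then have "e \<inter> f = e" "e \<inter> f = f"
    using card_edge[OF assms(1)] card_edge[OF assms(2)] card_subset_eq[of e "e \<inter> f"] card_subset_eq[of f "e \<inter> f"]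
      card_mono[of e "e \<inter> f"] card_mono[of f "e \<inter> f"] by (metis card.infinite inf_le1 inf_le2 le_antisym zero_neq_numeral)+
  then show False using assms by auto
qed

lemma net_two_nonsep:
  assumes "F \<subseteq> E" "card F \<le> 2" shows "top_connected (- net F)"
proof -
  have e0: "top_connected (- net {})" unfolding net_def by (simp add: connected_UNIV)
  have e1: "top_connected (- net {e})" if "e \<in> E" for e using net_nonsep_step[of "{}" e] that e0 by simp
  have e2: "top_connected (- net {e, f})" if "e \<in> E" "f \<in> E" "e \<noteq> f" for e f
    using net_nonsep_step[of "{f}" e] that e1[of f] edges_meet_once[of e f] by simp
  have finF: "finite F" using assms finE finite_subset by blast
  consider "card F = 0" | "card F = 1" | "card F = 2" using assms(2) by linarith
  then show ?thesis
  proof cases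
    case 1 then show ?thesis using e0 finF by simp
  next
    case 2 then show ?thesis using e1 assms(1) by (auto simp: card_1_singleton_iff)
  next
    case 3 then show ?thesis using e2 assms(1) by (auto simp: card_2_iff)
  qed
qed

text \<open>
  Three edges that are not a triangle form a forest, so one of them meets the other two in
  at most one vertex and can be glued on last.
\<close>

lemma net_three_nonsep:
  assumes "F \<subseteq> E" "card F = 3" and tf: "\<not> (\<exists>a b c. {a, b} \<in> E \<and> {b, c} \<in> E \<and> {a, c} \<in> E)"
  shows "top_connected (- net F)"
proof -
  obtain e f h where F: "F = {e, f, h}" "e \<noteq> f" "e \<noteq> h" "f \<noteq> h" using assms(2) by (auto simp: card_3_iff)
  have E: "e \<in> E" "f \<in> E" "h \<in> E" using F assms(1) by auto
  have step: "top_connected (- net {x, y, z})"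
    if "{x, y, z} = {e, f, h}" "x \<noteq> y" "x \<noteq> z" "y \<noteq> z" "card (x \<inter> (y \<union> z)) \<le> 1" for x y z
  proof -
    have "{x, y, z} \<subseteq> E" using that(1) E by auto
    then have xE: "x \<in> E" "y \<in> E" "z \<in> E" by auto
    have "top_connected (- net {y, z})" using net_two_nonsep[of "{y, z}"] xE that by simp
    then show ?thesis using net_nonsep_step[of "{y, z}" x] xE that by simp
  qed
  have "card (e \<inter> (f \<union> h)) \<le> 1 \<or> card (f \<inter> (e \<union> h)) \<le> 1 \<or> card (h \<inter> (e \<union> f)) \<le> 1"
  proof (rule ccontr)
    assume n: "\<not> ?thesis"
    obtain a b where e: "e = {a, b}" "a \<noteq> b" using edge[OF E(1)] by blast
    have full: "x \<subseteq> y" if "x \<in> E" "\<not> card (x \<inter> y) \<le> 1" for x y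
    proof -
      have "finite x" "card x = 2" using card_edge[OF that(1)] card.infinite by fastforce+
      moreover from this have "card (x \<inter> y) \<le> 2" using card_mono[of x "x \<inter> y"] by auto
      ultimately have "x \<inter> y = x" using that(2) by (intro card_subset_eq) auto
      then show ?thesis by auto
    qed
    have sub: "e \<subseteq> f \<union> h" "f \<subseteq> e \<union> h" "h \<subseteq> e \<union> f" using n full E by auto
    have "\<exists>x y. f = {x, y} \<and> x \<noteq> y" "\<exists>x y. h = {x, y} \<and> x \<noteq> y" using edge E by blast+
    then obtain x y u v where xy: "f = {x, y}" "x \<noteq> y" "h = {u, v}" "u \<noteq> v" by blast
    have "\<exists>a b c. e = {a, b} \<and> f = {b, c} \<and> h = {a, c}"
      using sub F(2-4) xy e unfolding e xy
      by (smt (verit, ccfv_threshold) Un_iff doubleton_eq_iff insert_iff insert_subset singletonD empty_iff)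
    then show False using tf E by blast
  qed
  then show ?thesis
    using step[of e f h] step[of f e h] step[of h e f] F
    by (auto simp: insert_commute Un_commute)
qed

text \<open>
  Double counting of the pairs of a face and an edge on its boundary.
\<close>

lemma face_edge_count:
  assumes Q: "separated E Q" and k: "\<And>p. p \<in> Q \<Longrightarrow> k \<le> card (touch p)"
  shows "k * card Q \<le> 2 * card E"
proof -
  have finQ: "finite Q" using Q unfolding separated_def by auto
  have "k * card Q \<le> (\<Sum>p\<in>Q. card (touch p))"
    using sum_mono[of Q "\<lambda>_. k" "\<lambda>p. card (touch p)"] k by (simp add: mult.commute)
  also have "\<dots> = (\<Sum>p\<in>Q. \<Sum>e\<in>E. if e \<in> touch p then 1 else 0)"
  proof (rule sum.cong[OF refl])
    fix p
    have "touch p = {e \<in> E. e \<in> touch p}" unfolding touch_def by auto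
    then show "card (touch p) = (\<Sum>e\<in>E. if e \<in> touch p then 1 else 0)"
      using finE by (simp add: sum.If_cases Int_def)
  qed
  also have "\<dots> = (\<Sum>e\<in>E. \<Sum>p\<in>Q. if e \<in> touch p then 1 else 0)" by (rule sum.swap)
  also have "\<dots> = (\<Sum>e\<in>E. card {p \<in> Q. e \<in> touch p})"
    using finQ by (simp add: sum.If_cases Int_def)
  also have "\<dots> \<le> (\<Sum>e\<in>E. 2)" by (rule sum_mono) (use edge_touches_two[OF Q] in auto)
  finally show ?thesis by simp
qed

text \<open>
  One or two edges do not separate the plane, so once there are three edges every face touches at
  least three of them.
\<close>

theorem edge_bound: "card E \<le> 2 \<or> card E + 6 \<le> 3 * card P"
proof (cases "card E \<le> 2")
  case False
  then obtain e where "e \<in> E" by fastforce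
  then have "P \<noteq> {}" using edge by blast
  then obtain Q where Q: "separated E Q" "card E + 2 \<le> card P + card Q" using many_faces by blast
  have "3 \<le> card (touch p)" if "p \<in> Q" for p
  proof (rule ccontr)
    assume a: "\<not> ?thesis"
    have "touch p \<subseteq> E" unfolding touch_def by auto
    then have "top_connected (- drawn (touch p))" using a by (intro drawn_nonsep net_two_nonsep) auto
    moreover have "p \<notin> drawn E" using Q that unfolding separated_def by auto
    ultimately show False using touch_all_if_connected a False by force
  qed
  from face_edge_count[OF Q(1) this] Q(2) show ?thesis by linarith
qed simp

text \<open>
  Without triangles three edges do not separate the plane either, so with four edges or more
  every face touches at least four of them.
\<close>

theorem edge_bound_triangle_free:
  assumes tf: "\<not> (\<exists>a b c. {a, b} \<in> E \<and> {b, c} \<in> E \<and> {a, c} \<in> E)"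
  shows "card E \<le> 3 \<or> card E + 4 \<le> 2 * card P"
proof (cases "card E \<le> 3")
  case False
  then obtain e where "e \<in> E" by fastforce
  then have "P \<noteq> {}" using edge by blast
  then obtain Q where Q: "separated E Q" "card E + 2 \<le> card P + card Q" using many_faces by blast
  have "4 \<le> card (touch p)" if "p \<in> Q" for p
  proof (rule ccontr)
    assume a: "\<not> ?thesis"
    have T: "touch p \<subseteq> E" unfolding touch_def by auto
    have "card (touch p) = 3 \<or> card (touch p) \<le> 2" using a by linarith
    then have "top_connected (- net (touch p))" using net_two_nonsep[OF T] net_three_nonsep[OF T _ tf] by blast
    then have "top_connected (- drawn (touch p))" using T by (intro drawn_nonsep)
    moreover have "p \<notin> drawn E" using Q that unfolding separated_def by auto
    ultimately show False using touch_all_if_connected a False by force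
  qed
  from face_edge_count[OF Q(1) this] Q(2) show ?thesis by linarith
qed simp

end

section \<open>Planar graphs: edge bounds and closure properties\<close>

lemma card_arcs_edges:
  assumes "finite R" "sym R" "irrefl R"
  shows "card R = 2 * card ((\<lambda>(u, v). {u, v}) ` R)"
proof -
  let ?u = "\<lambda>(u, v). {u, v}"
  have fib: "card {a \<in> R. ?u a = e} = 2" if e: "e \<in> ?u ` R" for e
  proof -
    obtain u v where uv: "(u, v) \<in> R" "e = {u, v}" using e by auto
    have "(v, u) \<in> R" "u \<noteq> v" using uv assms(2,3) by (auto dest: symD irreflD)
    then have "{a \<in> R. ?u a = e} = {(u, v), (v, u)}" using uv by (auto simp: doubleton_eq_iff)
    then show ?thesis using \<open>u \<noteq> v\<close> by simp
  qed
  have "card R = (\<Sum>a\<in>R. 1)" by simp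
  also have "\<dots> = (\<Sum>e\<in>?u ` R. \<Sum>a\<in>{a \<in> R. ?u a = e}. 1)" using assms(1) by (rule sum.image_gen)
  also have "\<dots> = (\<Sum>e\<in>?u ` R. card {a \<in> R. ?u a = e})" by simp
  also have "\<dots> = (\<Sum>e\<in>?u ` R. 2)" by (rule sum.cong) (use fib in auto)
  finally show ?thesis by simp
qed

lemma pair_graph_facts:
  assumes "pair_graph G"
  shows "finite (pverts G)" "finite (parcs G)" "(u, v) \<in> parcs G \<Longrightarrow> (v, u) \<in> parcs G"
    "(u, v) \<in> parcs G \<Longrightarrow> u \<noteq> v" "(u, v) \<in> parcs G \<Longrightarrow> u \<in> pverts G" "(u, v) \<in> parcs G \<Longrightarrow> v \<in> pverts G"
    "sym (parcs G)" "irrefl (parcs G)"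
proof -
  interpret pair_graph G by fact
  show "finite (pverts G)" "finite (parcs G)" by (rule pair_finite_verts, rule pair_finite_arcs)
  show s: "(u, v) \<in> parcs G \<Longrightarrow> (v, u) \<in> parcs G" for u v by (rule arcs_symmetric)
  show n: "(u, v) \<in> parcs G \<Longrightarrow> u \<noteq> v" for u v using pair_no_loops[of "(u, v)"] by auto
  show "(u, v) \<in> parcs G \<Longrightarrow> u \<in> pverts G" "(u, v) \<in> parcs G \<Longrightarrow> v \<in> pverts G" by (auto dest: in_arcsD1 in_arcsD2)
  show "sym (parcs G)" using s by (auto intro: symI)
  show "irrefl (parcs G)" using n by (auto intro: irreflI)
qed

lemma pair_graphI:
  assumes "finite (pverts G)" "\<And>u v. (u, v) \<in> parcs G \<Longrightarrow> u \<in> pverts G \<and> u \<noteq> v \<and> (v, u) \<in> parcs G"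
  shows "pair_graph G"
proof -
  have "a \<in> pverts G \<times> pverts G" if "a \<in> parcs G" for a
    using assms(2)[of "fst a" "snd a"] assms(2)[of "snd a" "fst a"] that by (cases a) auto
  then have "parcs G \<subseteq> pverts G \<times> pverts G" by blast
  then have "finite (parcs G)" using assms(1) finite_subset by blast
  moreover have E: "fst e \<in> pverts G \<and> snd e \<in> pverts G \<and> fst e \<noteq> snd e" if "e \<in> parcs G" for e
    using assms(2)[of "fst e" "snd e"] assms(2)[of "snd e" "fst e"] that by auto
  moreover have "symmetric (with_proj G)"
    unfolding symmetric_def using assms(2) by (auto intro: symI)
  ultimately show ?thesis using assms(1) by unfold_locales auto
qed

lemma plane_drawingD:
  assumes "plane_drawing G f \<gamma>"
  shows "inj_on f (pverts G)"
    and "(u, v) \<in> parcs G \<Longrightarrow> arc (\<gamma> {u, v})"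
    and "(u, v) \<in> parcs G \<Longrightarrow> {pathstart (\<gamma> {u, v}), pathfinish (\<gamma> {u, v})} = {f u, f v}"
    and "(u, v) \<in> parcs G \<Longrightarrow> path_image (\<gamma> {u, v}) \<inter> f ` pverts G = {f u, f v}"
    and "(u, v) \<in> parcs G \<Longrightarrow> (w, z) \<in> parcs G \<Longrightarrow> {u, v} \<noteq> {w, z} \<Longrightarrow>
      path_image (\<gamma> {u, v}) \<inter> path_image (\<gamma> {w, z}) = f ` ({u, v} \<inter> {w, z})"
proof -
  note A = assms[unfolded plane_drawing_def, THEN conjunct2, THEN conjunct1]
    and B = assms[unfolded plane_drawing_def, THEN conjunct2, THEN conjunct2]
  show "inj_on f (pverts G)" by (rule assms[unfolded plane_drawing_def, THEN conjunct1])
  { assume uv: "(u, v) \<in> parcs G"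
    have *: "arc (\<gamma> {u, v}) \<and> {pathstart (\<gamma> {u, v}), pathfinish (\<gamma> {u, v})} = {f u, f v} \<and>
        path_image (\<gamma> {u, v}) \<inter> f ` pverts G = {f u, f v}"
      using bspec[OF A uv] by (simp only: prod.case)
    show "arc (\<gamma> {u, v})" "{pathstart (\<gamma> {u, v}), pathfinish (\<gamma> {u, v})} = {f u, f v}"
      "path_image (\<gamma> {u, v}) \<inter> f ` pverts G = {f u, f v}" using * by blast+
    have C: "\<forall>(w, z) \<in> parcs G. {u, v} \<noteq> {w, z} \<longrightarrow>
        path_image (\<gamma> {u, v}) \<inter> path_image (\<gamma> {w, z}) = f ` ({u, v} \<inter> {w, z})"
      using bspec[OF B uv] by (simp only: prod.case)
    assume wz: "(w, z) \<in> parcs G" "{u, v} \<noteq> {w, z}"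
    have "{u, v} \<noteq> {w, z} \<longrightarrow>
        path_image (\<gamma> {u, v}) \<inter> path_image (\<gamma> {w, z}) = f ` ({u, v} \<inter> {w, z})"
      using bspec[OF C wz(1)] by (simp only: prod.case)
    then show "path_image (\<gamma> {u, v}) \<inter> path_image (\<gamma> {w, z}) = f ` ({u, v} \<inter> {w, z})"
      using wz(2) by (rule mp)
  }
qed

lemma plane_drawingI:
  assumes "inj_on f (pverts G)"
    and "\<And>u v. (u, v) \<in> parcs G \<Longrightarrow> arc (\<gamma> {u, v})"
    and "\<And>u v. (u, v) \<in> parcs G \<Longrightarrow> {pathstart (\<gamma> {u, v}), pathfinish (\<gamma> {u, v})} = {f u, f v}"
    and "\<And>u v. (u, v) \<in> parcs G \<Longrightarrow> path_image (\<gamma> {u, v}) \<inter> f ` pverts G = {f u, f v}"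
    and "\<And>u v w z. (u, v) \<in> parcs G \<Longrightarrow> (w, z) \<in> parcs G \<Longrightarrow> {u, v} \<noteq> {w, z} \<Longrightarrow>
      path_image (\<gamma> {u, v}) \<inter> path_image (\<gamma> {w, z}) = f ` ({u, v} \<inter> {w, z})"
  shows "plane_drawing G f \<gamma>"
  unfolding plane_drawing_def
  by (intro conjI ballI case_prodI2 impI; hypsubst?; rule assms; assumption)

lemma plane_drawing_plane_graph:
  assumes G: "pair_graph G" and d: "plane_drawing G f \<gamma>"
  shows "plane_graph (f ` pverts G) ((`) f ` (\<lambda>(u, v). {u, v}) ` parcs G)
           (\<lambda>e. \<gamma> {v \<in> pverts G. f v \<in> e})"
proof -
  note F = pair_graph_facts[OF G]
  have inj: "inj_on f (pverts G)" using d unfolding plane_drawing_def by blast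
  have pre: "{x \<in> pverts G. f x \<in> f ` {u, v}} = {u, v}" if "(u, v) \<in> parcs G" for u v
    using F(5,6)[OF that] inj by (auto dest: inj_onD)
  note d1 = plane_drawingD(2-4)[OF d] and d2 = plane_drawingD(5)[OF d]
  show ?thesis
  proof
    show "finite (f ` pverts G)" using F by simp
  next
    fix e assume "e \<in> (`) f ` (\<lambda>(u, v). {u, v}) ` parcs G"
    then obtain u v where uv: "(u, v) \<in> parcs G" "e = f ` {u, v}" by auto
    let ?g = "\<gamma> {v \<in> pverts G. f v \<in> e}"
    have g: "?g = \<gamma> {u, v}" using pre[OF uv(1)] uv(2) by simp
    have ne: "f u \<noteq> f v" using F(4-6)[OF uv(1)] inj by (auto dest: inj_onD)
    show "path_image ?g \<inter> f ` pverts G = e" unfolding g using d1(3)[OF uv(1)] uv(2) by auto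
    consider "pathstart ?g = f u" "pathfinish ?g = f v" | "pathstart ?g = f v" "pathfinish ?g = f u"
      using d1(2)[OF uv(1)] unfolding g by (auto simp: doubleton_eq_iff)
    then show "\<exists>a b. a \<in> f ` pverts G \<and> b \<in> f ` pverts G \<and> a \<noteq> b \<and> e = {a, b} \<and> arc ?g \<and> pathstart ?g = a \<and> pathfinish ?g = b"
    proof cases
      case 1
      then show ?thesis using uv ne F(5,6)[OF uv(1)] d1(1)[OF uv(1)] unfolding g
        by (intro exI[of _ "f u"] exI[of _ "f v"]) auto
    next
      case 2
      then show ?thesis using uv ne F(5,6)[OF uv(1)] d1(1)[OF uv(1)] unfolding g
        by (intro exI[of _ "f v"] exI[of _ "f u"]) auto
    qed
  next
    fix e e' assume "e \<in> (`) f ` (\<lambda>(u, v). {u, v}) ` parcs G" "e' \<in> (`) f ` (\<lambda>(u, v). {u, v}) ` parcs G" and ne: "e \<noteq> e'"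
    then obtain uv' wz' where "uv' \<in> parcs G" "e = f ` (case uv' of (u, v) \<Rightarrow> {u, v})"
      "wz' \<in> parcs G" "e' = f ` (case wz' of (u, v) \<Rightarrow> {u, v})" by (elim imageE) simp
    then obtain u v w z where uv: "(u, v) \<in> parcs G" "e = f ` {u, v}" and wz: "(w, z) \<in> parcs G" "e' = f ` {w, z}"
      by (cases uv', cases wz') simp
    have "{u, v} \<noteq> {w, z}" using ne uv wz by auto
    have "path_image (\<gamma> {u, v}) \<inter> path_image (\<gamma> {w, z}) = f ` ({u, v} \<inter> {w, z})"
      by (rule d2) fact+
    also have "\<dots> = f ` {u, v} \<inter> f ` {w, z}"
      by (rule inj_on_image_Int[OF inj]) (use F(5,6) uv(1) wz(1) in auto)
    finally show "path_image (\<gamma> {v \<in> pverts G. f v \<in> e}) \<inter> path_image (\<gamma> {v \<in> pverts G. f v \<in> e'}) = e \<inter> e'"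
      unfolding uv(2) wz(2) pre[OF uv(1)] pre[OF wz(1)] .
  qed
qed

text \<open>
  Every edge is counted as two arcs, so these are the bounds \<open>3 v - 6\<close> and \<open>2 v - 4\<close> with both sides doubled.
\<close>

lemma planar_arc_bounds:
  assumes G: "pair_graph G" "planar G"
  shows "card (parcs G) \<le> 4 \<or> card (parcs G) + 12 \<le> 6 * card (pverts G)"
    and "(\<And>a b c. (a, b) \<in> parcs G \<Longrightarrow> (b, c) \<in> parcs G \<Longrightarrow> (a, c) \<notin> parcs G) \<Longrightarrow>
      card (parcs G) \<le> 6 \<or> card (parcs G) + 8 \<le> 4 * card (pverts G)"
proof -
  note F = pair_graph_facts[OF G(1)]
  obtain f \<gamma> where d: "plane_drawing G f \<gamma>" using G(2) unfolding planar_def by blast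
  let ?E = "(\<lambda>(u, v). {u, v}) ` parcs G"
  interpret plane_graph "f ` pverts G" "(`) f ` ?E" "\<lambda>e. \<gamma> {v \<in> pverts G. f v \<in> e}"
    by (rule plane_drawing_plane_graph[OF G(1) d])
  have inj: "inj_on f (pverts G)" using d unfolding plane_drawing_def by blast
  have "inj_on ((`) f) ?E"
    by (rule inj_on_image) (rule inj_on_subset[OF inj], use F(5,6) in auto)
  then have cE: "card ((`) f ` ?E) = card ?E" by (rule card_image)
  have cP: "card (f ` pverts G) = card (pverts G)" using inj by (rule card_image)
  have cA: "card (parcs G) = 2 * card ?E" by (rule card_arcs_edges) (use F in auto)
  show "card (parcs G) \<le> 4 \<or> card (parcs G) + 12 \<le> 6 * card (pverts G)"
    using edge_bound cE cP cA by linarith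
  assume tf: "\<And>a b c. (a, b) \<in> parcs G \<Longrightarrow> (b, c) \<in> parcs G \<Longrightarrow> (a, c) \<notin> parcs G"
  have pre_img: "\<exists>u v. (u, v) \<in> parcs G \<and> a = f u \<and> b = f v" if "{a, b} \<in> (`) f ` ?E" for a b
  proof -
    note T = that
    obtain u v where uv: "(u, v) \<in> parcs G" "{a, b} = {f u, f v}" using T by auto
    then consider "a = f u" "b = f v" | "a = f v" "b = f u" by (auto simp: doubleton_eq_iff)
    then show ?thesis using uv(1) F(3)[OF uv(1)] by cases auto
  qed
  have "\<not> (\<exists>a b c. {a, b} \<in> (`) f ` ?E \<and> {b, c} \<in> (`) f ` ?E \<and> {a, c} \<in> (`) f ` ?E)"
  proof
    assume "\<exists>a b c. {a, b} \<in> (`) f ` ?E \<and> {b, c} \<in> (`) f ` ?E \<and> {a, c} \<in> (`) f ` ?E"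
    then obtain a b c where "{a, b} \<in> (`) f ` ?E" "{b, c} \<in> (`) f ` ?E" "{a, c} \<in> (`) f ` ?E"
      by (elim exE conjE) (rule that)
    note abc = this
    obtain u v where 1: "(u, v) \<in> parcs G" "a = f u" "b = f v" using pre_img[OF abc(1)] by blast
    obtain v' w where 2: "(v', w) \<in> parcs G" "b = f v'" "c = f w" using pre_img[OF abc(2)] by blast
    obtain u' w' where 3: "(u', w') \<in> parcs G" "a = f u'" "c = f w'" using pre_img[OF abc(3)] by blast
    have "v = v'" "u = u'" "w = w'" using 1 2 3 inj_onD[OF inj] F(5,6) by metis+
    then show False using tf 1 2 3 by blast
  qed
  from edge_bound_triangle_free[OF this] cE cP cA
  show "card (parcs G) \<le> 6 \<or> card (parcs G) + 8 \<le> 4 * card (pverts G)" by linarith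
qed

lemma planar_subgraph:
  assumes "planar G" "pair_graph H" "pverts H \<subseteq> pverts G" "parcs H \<subseteq> parcs G"
  shows "planar H"
proof -
  obtain f \<gamma> where d: "plane_drawing G f \<gamma>" using assms(1) unfolding planar_def by blast
  note F = pair_graph_facts[OF assms(2)]
  have "plane_drawing H f \<gamma>"
  proof (rule plane_drawingI)
    show "inj_on f (pverts H)" using plane_drawingD(1)[OF d] assms(3) by (rule inj_on_subset)
  next
    fix u v assume uv: "(u, v) \<in> parcs H"
    then have uvG: "(u, v) \<in> parcs G" using assms(4) by auto
    show "arc (\<gamma> {u, v})" "{pathstart (\<gamma> {u, v}), pathfinish (\<gamma> {u, v})} = {f u, f v}"
      using plane_drawingD(2,3)[OF d uvG] .
    show "path_image (\<gamma> {u, v}) \<inter> f ` pverts H = {f u, f v}"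
      using plane_drawingD(4)[OF d uvG] F(5,6)[OF uv] assms(3) by blast
    fix w z assume "(w, z) \<in> parcs H" "{u, v} \<noteq> {w, z}"
    then show "path_image (\<gamma> {u, v}) \<inter> path_image (\<gamma> {w, z}) = f ` ({u, v} \<inter> {w, z})"
      using plane_drawingD(5)[OF d uvG] assms(4) by blast
  qed
  then show ?thesis unfolding planar_def by blast
qed

text \<open>
  A path of length two through \<open>d\<close> is redrawn as a single edge by joining its two arcs. The
  other edges at \<open>d\<close> disappear, so nothing else passes through that point.
\<close>

lemma planar_suppress:
  assumes G: "pair_graph G" "planar G" and H: "pair_graph H"
    and "pverts H \<subseteq> pverts G - {d}" "parcs H \<subseteq> parcs G \<union> {(a, b), (b, a)}"
    and ad: "(a, d) \<in> parcs G" "(d, b) \<in> parcs G" "a \<noteq> b"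
  shows "planar H"
proof -
  obtain f \<gamma> where dr: "plane_drawing G f \<gamma>" using G(2) unfolding planar_def by blast
  note F = pair_graph_facts[OF G(1)] and FH = pair_graph_facts[OF H]
  have inj: "inj_on f (pverts G)" using dr unfolding plane_drawing_def by blast
  note d1 = plane_drawingD(2-4)[OF dr] and d2 = plane_drawingD(5)[OF dr]
  have V: "a \<in> pverts G" "b \<in> pverts G" "d \<in> pverts G" "a \<noteq> d" "b \<noteq> d" using F(4-6)[OF ad(1)] F(4-6)[OF ad(2)] by auto
  have or: "\<exists>k. arc k \<and> pathstart k = f u \<and> pathfinish k = f v \<and> path_image k = path_image (\<gamma> {u, v})"
    if "(u, v) \<in> parcs G" for u v
  proof -
    note T = that
    consider "pathstart (\<gamma> {u, v}) = f u" "pathfinish (\<gamma> {u, v}) = f v" |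
      "pathstart (\<gamma> {u, v}) = f v" "pathfinish (\<gamma> {u, v}) = f u"
      using d1(2)[OF T] by (auto simp: doubleton_eq_iff)
    then show ?thesis
    proof cases
      case 1 then show ?thesis using d1(1)[OF that] by blast
    next
      case 2 then show ?thesis using d1(1)[OF that]
        by (intro exI[of _ "reversepath (\<gamma> {u, v})"]) (auto intro: arc_reversepath)
    qed
  qed
  obtain k1 where k1: "arc k1" "pathstart k1 = f a" "pathfinish k1 = f d" "path_image k1 = path_image (\<gamma> {a, d})"
    using or[OF ad(1)] by blast
  obtain k2 where k2: "arc k2" "pathstart k2 = f d" "pathfinish k2 = f b" "path_image k2 = path_image (\<gamma> {d, b})"
    using or[OF ad(2)] by blast
  have "{a, d} \<noteq> {d, b}" using ad(3) V by (auto simp: doubleton_eq_iff)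
  from d2[OF ad(1,2) this] have i: "path_image k1 \<inter> path_image k2 = {f d}" using k1 k2 V ad(3) by auto
  define k where "k = k1 +++ k2"
  have "arc k" unfolding k_def by (rule arc_join) (use k1 k2 i in auto)
  then have k: "arc k" "pathstart k = f a" "pathfinish k = f b" unfolding k_def using k1 k2 by auto
  have ki: "path_image k = path_image (\<gamma> {a, d}) \<union> path_image (\<gamma> {d, b})"
    unfolding k_def using k1 k2 by (simp add: path_image_join)
  define \<gamma>' where "\<gamma>' = \<gamma>({a, b} := k)"
  have g1: "\<gamma>' {a, b} = k" "\<And>e. e \<noteq> {a, b} \<Longrightarrow> \<gamma>' e = \<gamma> e" unfolding \<gamma>'_def by auto
  have HG: "(u, v) \<in> parcs G" if "(u, v) \<in> parcs H" "{u, v} \<noteq> {a, b}" for u v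
    using that assms(5) by auto
  have nd: "u \<noteq> d \<and> v \<noteq> d" if "(u, v) \<in> parcs H" for u v using FH(5,6)[OF that] assms(4) by auto
  have cr: "path_image k \<inter> path_image (\<gamma> {u, v}) = f ` ({a, b} \<inter> {u, v})"
    if "(u, v) \<in> parcs H" "{u, v} \<noteq> {a, b}" for u v
  proof -
    have n: "u \<noteq> d" "v \<noteq> d" using nd[OF that(1)] by auto
    have "path_image (\<gamma> {a, d}) \<inter> path_image (\<gamma> {u, v}) = f ` ({a, d} \<inter> {u, v})"
      "path_image (\<gamma> {d, b}) \<inter> path_image (\<gamma> {u, v}) = f ` ({d, b} \<inter> {u, v})"
    proof -
      have ne: "{a, d} \<noteq> {u, v}" "{d, b} \<noteq> {u, v}" using n by auto
      show "path_image (\<gamma> {a, d}) \<inter> path_image (\<gamma> {u, v}) = f ` ({a, d} \<inter> {u, v})"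
        by (rule d2[OF ad(1) HG[OF that] ne(1)])
      show "path_image (\<gamma> {d, b}) \<inter> path_image (\<gamma> {u, v}) = f ` ({d, b} \<inter> {u, v})"
        by (rule d2[OF ad(2) HG[OF that] ne(2)])
    qed
    then show ?thesis unfolding ki using n by auto
  qed
  have main: "arc (\<gamma>' {u, v}) \<and> {pathstart (\<gamma>' {u, v}), pathfinish (\<gamma>' {u, v})} = {f u, f v} \<and>
        path_image (\<gamma>' {u, v}) \<inter> f ` pverts H = {f u, f v}" if uv: "(u, v) \<in> parcs H" for u v
  proof -
    have P: "u \<in> pverts H" "v \<in> pverts H" using FH(5,6)[OF uv] .
    show ?thesis
    proof (cases "{u, v} = {a, b}")
      case True
      have ab: "a \<in> pverts H" "b \<in> pverts H" using P True by (auto simp: doubleton_eq_iff)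
      have sub: "path_image k \<inter> f ` pverts G \<subseteq> {f a, f d, f b}"
        unfolding ki Int_Un_distrib2 d1(3)[OF ad(1)] d1(3)[OF ad(2)] by simp
      have fd: "f d \<notin> f ` pverts H" using inj V assms(4) by (auto dest: inj_onD)
      have HG': "f ` pverts H \<subseteq> f ` pverts G" using assms(4) by auto
      have "path_image k \<inter> f ` pverts H \<subseteq> {f a, f b}"
      proof
        fix y assume y: "y \<in> path_image k \<inter> f ` pverts H"
        then have "y \<in> {f a, f d, f b}" using sub HG' by (meson IntE IntI subsetD)
        moreover have "y \<noteq> f d" using y fd by (metis IntD2)
        ultimately show "y \<in> {f a, f b}" by simp
      qed
      moreover have "{f a, f b} \<subseteq> path_image k \<inter> f ` pverts H"
        using k ab pathstart_in_path_image[of k] pathfinish_in_path_image[of k] by auto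
      moreover have "{f u, f v} = {f a, f b}" using True by (auto simp: doubleton_eq_iff)
      ultimately have "path_image k \<inter> f ` pverts H = {f u, f v}" by simp
      moreover have "{pathstart k, pathfinish k} = {f u, f v}"
        unfolding k(2,3) \<open>{f u, f v} = {f a, f b}\<close> ..
      ultimately show ?thesis unfolding True g1(1) using k(1) by simp
    next
      case False
      have uvG: "(u, v) \<in> parcs G" using HG[OF uv False] .
      have "path_image (\<gamma> {u, v}) \<inter> f ` pverts H = {f u, f v}" using d1(3)[OF uvG] P assms(4) by blast
      then show ?thesis using d1[OF uvG] g1(2)[OF False] by simp
    qed
  qed
  have "plane_drawing H f \<gamma>'"
  proof (rule plane_drawingI)
    show "inj_on f (pverts H)" using inj assms(4) by (auto intro: inj_on_subset)
  next
    fix u v assume uv: "(u, v) \<in> parcs H"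
    show "arc (\<gamma>' {u, v})" "{pathstart (\<gamma>' {u, v}), pathfinish (\<gamma>' {u, v})} = {f u, f v}"
      "path_image (\<gamma>' {u, v}) \<inter> f ` pverts H = {f u, f v}" using main[OF uv] by blast+
    fix w z assume wz: "(w, z) \<in> parcs H" "{u, v} \<noteq> {w, z}"
    show "path_image (\<gamma>' {u, v}) \<inter> path_image (\<gamma>' {w, z}) = f ` ({u, v} \<inter> {w, z})"
    proof (cases "{u, v} = {a, b}")
      case True
      then have ne: "{w, z} \<noteq> {a, b}" using wz(2) by auto
      show ?thesis unfolding True g1(1) g1(2)[OF ne] using cr[OF wz(1) ne] .
    next
      case False
      show ?thesis
      proof (cases "{w, z} = {a, b}")
        case True
        show ?thesis unfolding True g1(1) g1(2)[OF False] using cr[OF uv False] by (simp only: Int_commute)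
      next
        case F2: False
        show ?thesis unfolding g1(2)[OF False] g1(2)[OF F2] using d2[OF HG[OF uv False] HG[OF wz(1) F2] wz(2)] .
      qed
    qed
  qed
  then show ?thesis unfolding planar_def by blast
qed

section \<open>An explicit drawing with two hubs\<close>

text \<open>
  A drawing is determined up to parametrisation by the point sets of its edges, and disjointness is
  easier to check for these.
\<close>

lemma planarI_images:
  fixes f :: "'a \<Rightarrow> complex"
  assumes H: "pair_graph H" and inj: "inj_on f (pverts H)"
    and a: "\<And>u v. (u, v) \<in> parcs H \<Longrightarrow>
      \<exists>c. arc c \<and> {pathstart c, pathfinish c} = f ` {u, v} \<and> path_image c = I {u, v}"
    and b: "\<And>u v x. (u, v) \<in> parcs H \<Longrightarrow> x \<in> pverts H \<Longrightarrow> f x \<in> I {u, v} \<Longrightarrow> x \<in> {u, v}"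
    and c: "\<And>u v w z p. (u, v) \<in> parcs H \<Longrightarrow> (w, z) \<in> parcs H \<Longrightarrow> {u, v} \<noteq> {w, z} \<Longrightarrow>
      p \<in> I {u, v} \<Longrightarrow> p \<in> I {w, z} \<Longrightarrow> p \<in> f ` ({u, v} \<inter> {w, z})"
  shows "planar H"
proof -
  note F = pair_graph_facts[OF H]
  define \<gamma> where "\<gamma> e = (SOME c. arc c \<and> {pathstart c, pathfinish c} = f ` e \<and> path_image c = I e)" for e
  have g: "arc (\<gamma> {u, v}) \<and> {pathstart (\<gamma> {u, v}), pathfinish (\<gamma> {u, v})} = f ` {u, v} \<and> path_image (\<gamma> {u, v}) = I {u, v}"
    if "(u, v) \<in> parcs H" for u v
    using someI_ex[OF a[OF that]] unfolding \<gamma>_def .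
  have ends: "f ` {u, v} \<subseteq> I {u, v}" if "(u, v) \<in> parcs H" for u v
  proof -
    have "f ` {u, v} = {pathstart (\<gamma> {u, v}), pathfinish (\<gamma> {u, v})}" "path_image (\<gamma> {u, v}) = I {u, v}"
      using g[OF that] by simp_all
    then show ?thesis using pathstart_in_path_image[of "\<gamma> {u, v}"] pathfinish_in_path_image[of "\<gamma> {u, v}"] by simp
  qed
  have "plane_drawing H f \<gamma>"
  proof (rule plane_drawingI)
    fix u v assume uv: "(u, v) \<in> parcs H"
    show "arc (\<gamma> {u, v})" "{pathstart (\<gamma> {u, v}), pathfinish (\<gamma> {u, v})} = {f u, f v}"
      using g[OF uv] by simp_all
    have "I {u, v} \<inter> f ` pverts H \<subseteq> {f u, f v}" using b[OF uv] by blast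
    moreover have "{f u, f v} \<subseteq> I {u, v} \<inter> f ` pverts H" using ends[OF uv] F(5,6)[OF uv] by simp
    ultimately have "I {u, v} \<inter> f ` pverts H = {f u, f v}" by (rule subset_antisym)
    then show "path_image (\<gamma> {u, v}) \<inter> f ` pverts H = {f u, f v}" using g[OF uv] by simp
    fix w z assume wz: "(w, z) \<in> parcs H" "{u, v} \<noteq> {w, z}"
    have imgs: "path_image (\<gamma> {u, v}) = I {u, v}" "path_image (\<gamma> {w, z}) = I {w, z}"
      using g[OF uv] g[OF wz(1)] by simp_all
    show "path_image (\<gamma> {u, v}) \<inter> path_image (\<gamma> {w, z}) = f ` ({u, v} \<inter> {w, z})"
      unfolding imgs
    proof
      show "I {u, v} \<inter> I {w, z} \<subseteq> f ` ({u, v} \<inter> {w, z})" using c[OF uv wz] by blast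
      show "f ` ({u, v} \<inter> {w, z}) \<subseteq> I {u, v} \<inter> I {w, z}"
        using ends[OF uv] ends[OF wz(1)] by blast
    qed
  qed (rule inj)
  then show ?thesis unfolding planar_def by blast
qed

text \<open>
  The complement of a bounded convex set is path-connected, and the two rays attach \<open>x\<close> and \<open>y\<close> to it.
\<close>

lemma arc_outside_convex:
  fixes K :: "complex set"
  assumes "bounded K" "convex K" "x \<noteq> y"
    and x: "\<And>t::real. t > 0 \<Longrightarrow> x + of_real t * dx \<notin> K" and y: "\<And>t::real. t > 0 \<Longrightarrow> y + of_real t * dy \<notin> K"
  shows "\<exists>c. arc c \<and> pathstart c = x \<and> pathfinish c = y \<and> path_image c \<inter> K \<subseteq> {x, y}"
proof -
  define ray where "ray p d = (\<lambda>t::real. p + of_real t * d) ` {0..}" for p d :: complex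
  have pc: "path_connected (ray p d)" for p d unfolding ray_def
    by (intro path_connected_continuous_image continuous_intros convex_imp_path_connected) simp
  have ray_out: "ray p d \<inter> - K \<noteq> {}" "ray p d \<subseteq> insert p (- K)" "p \<in> ray p d"
    if "\<And>t::real. t > 0 \<Longrightarrow> p + of_real t * d \<notin> K" for p d
  proof -
    have "p + of_real 1 * d \<in> ray p d" unfolding ray_def by (rule imageI) simp
    then show "ray p d \<inter> - K \<noteq> {}" using that[of 1] by auto
    show "ray p d \<subseteq> insert p (- K)" unfolding ray_def
    proof (rule image_subsetI)
      fix t :: real assume "t \<in> {0..}"
      then show "p + of_real t * d \<in> insert p (- K)" using that[of t] by (cases "t = 0") auto
    qed
    have "p + of_real 0 * d \<in> ray p d" unfolding ray_def by (rule imageI) simp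
    then show "p \<in> ray p d" by simp
  qed
  have "path_connected (- K)" using path_connected_complement_bounded_convex[OF assms(1,2)] by simp
  then have "path_connected (- K \<union> ray x dx)"
    by (rule path_connected_Un[OF _ pc]) (use ray_out(1)[OF x] in blast)
  then have "path_connected ((- K \<union> ray x dx) \<union> ray y dy)"
    by (rule path_connected_Un[OF _ pc]) (use ray_out(1)[OF y] in blast)
  moreover have "x \<in> (- K \<union> ray x dx) \<union> ray y dy" "y \<in> (- K \<union> ray x dx) \<union> ray y dy"
    using ray_out(3)[OF x] ray_out(3)[OF y] by auto
  ultimately obtain c where c: "arc c" "path_image c \<subseteq> (- K \<union> ray x dx) \<union> ray y dy" "pathstart c = x" "pathfinish c = y"
    using assms(3) unfolding path_connected_arcwise by blast
  then show ?thesis using ray_out(2)[OF x] ray_out(2)[OF y] by blast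
qed

text \<open>
  The vertices of \<open>W\<close> are put on the real axis in the order given by \<open>s\<close>, with one hub above and
  one below the axis. All edges are straight segments, except that one more edge \<open>pq\<close> may be led around the
  outside: it joins either the two hubs or the first and the last vertex of \<open>W\<close>. The vertices outside
  \<open>W\<close> are pendant at the upper hub. They are put halfway along the segment from this hub to the point \<open>s v\<close> of the
  axis; the values of \<open>s\<close> are distinct, so segments from the upper hub never meet again.
\<close>

lemma planar_two_hubs:
  fixes H :: "'a pair_pre_digraph" and s :: "'a \<Rightarrow> real"
  assumes H: "pair_graph H" and hubs: "u1 \<in> pverts H" "u2 \<in> pverts H" "u1 \<noteq> u2"
    and s: "inj_on s (pverts H - {u1, u2})" "\<And>v. v \<in> pverts H - {u1, u2} \<Longrightarrow> 0 \<le> s v \<and> s v \<le> M" "0 \<le> M"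
    and W: "W \<subseteq> pverts H - {u1, u2}"
    and closing: "p \<noteq> q" "(p = u1 \<and> q = u2) \<or> (p \<in> W \<and> q \<in> W \<and> s p = 0 \<and> s q = M)"
    and edges: "\<And>v w. (v, w) \<in> parcs H \<Longrightarrow> {v, w} = {p, q} \<or>
       (\<exists>x \<in> pverts H - {u1, u2}. {v, w} = {u1, x}) \<or> (\<exists>x \<in> W. {v, w} = {u2, x}) \<or>
       (v \<in> W \<and> w \<in> W \<and> (\<forall>x \<in> W. s x \<le> min (s v) (s w) \<or> max (s v) (s w) \<le> s x))"
  shows "planar H"
proof -
  let ?O = "pverts H - {u1, u2}"
  note F = pair_graph_facts[OF H]
  define h where "h v = (if v \<in> W then 1 else 1/2 :: real)" for v
  have h: "0 < h v" "h v \<le> 1" "h v = 1 \<longleftrightarrow> v \<in> W" for v unfolding h_def by auto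
  define f where "f v = (if v = u1 then Complex 0 1 else if v = u2 then Complex 0 (-1) else Complex (s v * h v) (1 - h v))" for v
  have f1: "f u1 = Complex 0 1" and f2: "f u2 = Complex 0 (-1)" using hubs unfolding f_def by auto
  have fo: "f v = Complex (s v * h v) (1 - h v)" if "v \<in> ?O" for v using that unfolding f_def by auto
  have sinj: "v = w" if "s v = s w" "v \<in> ?O" "w \<in> ?O" for v w
    using s(1) that by (auto dest: inj_onD)
  \<comment> \<open>Everything but the outer edge is drawn in this box, whose boundary contains the ends of that edge.\<close>
  define K where "K = {z. 0 \<le> Re z \<and> Re z \<le> M \<and> -1 \<le> Im z \<and> Im z \<le> 1}"
  have Kbox: "K = cbox (Complex 0 (-1)) (Complex M 1)"
    unfolding K_def by (auto simp: in_cbox_complex_iff)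
  have K: "bounded K" "convex K" unfolding Kbox by (auto intro: bounded_cbox convex_box)
  have fK: "f v \<in> K" if "v \<in> pverts H" for v
  proof -
    note T = that
    consider "v = u1" | "v = u2" | "v \<in> ?O" using T by blast
    then show ?thesis
    proof cases
      case 3
      have "s v * h v \<le> M * 1" using s(2)[OF 3] s(3) h by (intro mult_mono) (auto simp: less_imp_le)
      then show ?thesis using fo[OF 3] s(2)[OF 3] h[of v] unfolding K_def by auto
    qed (use f1 f2 s(3) in \<open>auto simp: K_def\<close>)
  qed
  have "inj_on f (pverts H)"
  proof (rule inj_onI)
    fix v w assume a: "v \<in> pverts H" "w \<in> pverts H" "f v = f w"
    show "v = w"
    proof (cases "v \<in> {u1, u2} \<or> w \<in> {u1, u2}")
      case True
      then show ?thesis using a h[of v] h[of w] unfolding f_def by (auto split: if_splits)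
    next
      case False
      then have vw: "v \<in> ?O" "w \<in> ?O" using a by auto
      then have "h v = h w" "s v * h v = s w * h w" using a(3) fo by auto
      then have "s v = s w" using h(1)[of w] by auto
      then show ?thesis using sinj vw by blast
    qed
  qed
  note finj = this
  define outward where "outward v = (if v = u1 then \<i> else if v = u2 then - \<i> else if v = p then - 1 else (1::complex))" for v
  have out: "f v + of_real t * outward v \<notin> K" if "v \<in> {p, q}" "t > 0" for v and t :: real
  proof -
    have WV: "x \<in> W \<Longrightarrow> x \<noteq> u1 \<and> x \<noteq> u2" for x using W by auto
    show ?thesis using closing that hubs(3) h(3)[of v] unfolding outward_def K_def f_def
      by (auto dest: WV split: if_splits)
  qed
  have pqV: "p \<in> pverts H" "q \<in> pverts H" using closing(2) hubs W by auto
  have "f p \<noteq> f q" using finj closing(1) pqV by (auto dest: inj_onD)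
  then obtain cl where cl: "arc cl" "pathstart cl = f p" "pathfinish cl = f q" "path_image cl \<inter> K \<subseteq> {f p, f q}"
    using arc_outside_convex[OF K _ out[of p] out[of q]] by blast
  \<comment> \<open>Convex hulls of pairs are the segments, without a choice of direction.\<close>
  define I where "I e = (if e = {p, q} then path_image cl else convex hull (f ` e))" for e
  define base where "base e \<longleftrightarrow> (\<exists>x \<in> ?O. e = {u1, x}) \<or> (\<exists>x \<in> W. e = {u2, x}) \<or>
       (\<exists>v\<in>W. \<exists>w\<in>W. e = {v, w} \<and> s v < s w \<and> (\<forall>x \<in> W. s x \<le> s v \<or> s w \<le> s x))" for e
  have baseE: "base {v, w}" if "(v, w) \<in> parcs H" "{v, w} \<noteq> {p, q}" for v w
  proof -
    note T = that
    consider "(\<exists>x \<in> ?O. {v, w} = {u1, x}) \<or> (\<exists>x \<in> W. {v, w} = {u2, x})" |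
      "v \<in> W" "w \<in> W" "\<forall>x \<in> W. s x \<le> min (s v) (s w) \<or> max (s v) (s w) \<le> s x"
      using edges[OF T(1)] T(2) by blast
    then show ?thesis
    proof cases
      case 2
      have "s v \<noteq> s w" using sinj[of v w] 2 W F(4)[OF that(1)] by auto
      then consider "s v < s w" | "s w < s v" by linarith
      then show ?thesis
      proof cases
        case a: 1
        then have "\<forall>x \<in> W. s x \<le> s v \<or> s w \<le> s x" using 2(3) by auto
        then show ?thesis unfolding base_def using 2 a by blast
      next
        case a: 2
        then have "\<forall>x \<in> W. s x \<le> s w \<or> s v \<le> s x" using 2(3) by auto
        moreover have "{v, w} = {w, v}" by auto
        ultimately show ?thesis unfolding base_def using 2(1,2) a by blast
      qed
    qed (auto simp: base_def)
  qed
  have segA: "\<exists>t. 0 \<le> t \<and> t \<le> h x \<and> Re z = s x * t \<and> Im z = 1 - t"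
    if "z \<in> convex hull (f ` {u1, x})" "x \<in> ?O" for z x
  proof -
    have "z \<in> closed_segment (f u1) (f x)" using that(1) by (simp add: segment_convex_hull)
    then obtain u where u: "0 \<le> u" "u \<le> 1" "z = (1 - u) *\<^sub>R f u1 + u *\<^sub>R f x" unfolding in_segment by blast
    have "Re z = s x * (u * h x)" "Im z = 1 - u * h x"
      unfolding u(3) f1 fo[OF that(2)] by (auto simp: algebra_simps)
    moreover have "u * h x \<le> h x" using u h(1)[of x] by (simp add: mult_left_le_one_le)
    ultimately show ?thesis using u h(1)[of x] by (intro exI[of _ "u * h x"]) (auto simp: mult_nonneg_nonneg)
  qed
  have segB: "\<exists>t. 0 \<le> t \<and> t \<le> 1 \<and> Re z = s x * t \<and> Im z = t - 1"
    if "z \<in> convex hull (f ` {u2, x})" "x \<in> W" for z x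
  proof -
    have "z \<in> closed_segment (f u2) (f x)" using that(1) by (simp add: segment_convex_hull)
    then obtain u where u: "0 \<le> u" "u \<le> 1" "z = (1 - u) *\<^sub>R f u2 + u *\<^sub>R f x" unfolding in_segment by blast
    have fx: "f x = Complex (s x) 0" using fo[of x] that(2) W h(3)[of x] by auto
    have "Re z = s x * u" "Im z = u - 1" unfolding u(3) f2 fx by (auto simp: algebra_simps)
    then show ?thesis using u by (intro exI[of _ u]) auto
  qed
  have segC: "Im z = 0 \<and> s v \<le> Re z \<and> Re z \<le> s w"
    if "z \<in> convex hull (f ` {v, w})" "v \<in> W" "w \<in> W" "s v < s w" for z v w
  proof -
    have "z \<in> closed_segment (f v) (f w)" using that(1) by (simp add: segment_convex_hull)
    then obtain u where u: "0 \<le> u" "u \<le> 1" "z = (1 - u) *\<^sub>R f v + u *\<^sub>R f w" unfolding in_segment by blast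
    moreover have "f v = Complex (s v) 0" "f w = Complex (s w) 0" using fo[of v] fo[of w] that(2,3) W h(3)[of v] h(3)[of w] by auto
    ultimately have z: "z = Complex ((1 - u) * s v + u * s w) 0" by (auto simp: complex_eq_iff)
    have "(1 - u) * s v + u * s w = s v + u * (s w - s v)" by algebra
    moreover have "0 \<le> u * (s w - s v)" "u * (s w - s v) \<le> 1 * (s w - s v)" using u that(4) by (auto intro: mult_right_mono)
    ultimately show ?thesis unfolding z by auto
  qed
  have pt: "f x = z" if "x \<in> W" "Re z = s x" "Im z = 0" for x z
    using fo[of x] that W h(3)[of x] by (auto simp: complex_eq_iff)
  have pt1: "f u1 = z" if "Re z = 0" "Im z = 1" for z using f1 that by (auto simp: complex_eq_iff)
  have pt2: "f u2 = z" if "Re z = 0" "Im z = -1" for z using f2 that by (auto simp: complex_eq_iff)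
  have WV: "x \<in> ?O" if "x \<in> W" for x using that W by auto
  have vtx: "x \<in> e" if "base e" "x \<in> pverts H" "f x \<in> convex hull (f ` e)" for e x
  proof -
    note T = that
    consider "x = u1" | "x = u2" | "x \<in> ?O" using T(2) by blast
    note xc = this
    from that(1) consider (A) y where "y \<in> ?O" "e = {u1, y}" | (B) y where "y \<in> W" "e = {u2, y}" |
      (C) v w where "v \<in> W" "w \<in> W" "e = {v, w}" "s v < s w" "\<forall>x \<in> W. s x \<le> s v \<or> s w \<le> s x"
      unfolding base_def by blast
    then show ?thesis
    proof cases
      case A
      obtain t where t: "0 \<le> t" "t \<le> h y" "Re (f x) = s y * t" "Im (f x) = 1 - t" using segA[OF _ A(1)] T(3) A(2) by blast
      from xc show ?thesis
      proof cases
        case 3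
        then have "t = h x" "s x * h x = s y * t" using t fo[OF 3] by auto
        then have "s x = s y" using h(1)[of x] by auto
        then show ?thesis using sinj[OF _ 3 A(1)] A(2) by auto
      qed (use t f2 h(2)[of y] A(2) in auto)
    next
      case B
      obtain t where t: "0 \<le> t" "t \<le> 1" "Re (f x) = s y * t" "Im (f x) = t - 1" using segB[OF _ B(1)] T(3) B(2) by blast
      from xc show ?thesis
      proof cases
        case 3
        then have "1 - h x = t - 1" "s x * h x = s y * t" using t fo[OF 3] by auto
        then have "t = 1" "h x = 1" using t h(2)[of x] by auto
        then have "s x = s y" using \<open>s x * h x = s y * t\<close> by auto
        then show ?thesis using sinj[OF _ 3 WV[OF B(1)]] B(2) by auto
      qed (use t f1 B(2) in auto)
    next
      case C
      have z: "Im (f x) = 0" "s v \<le> Re (f x)" "Re (f x) \<le> s w" using segC[of "f x" v w] that(3) C by auto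
      from xc show ?thesis
      proof cases
        case 3
        then have "h x = 1" using z fo[OF 3] by auto
        then have "x \<in> W" "Re (f x) = s x" using h(3)[of x] fo[OF 3] by auto
        then have "s x = s v \<or> s x = s w" using z C(5) by force
        then show ?thesis using sinj[OF _ 3 WV[OF C(1)]] sinj[OF _ 3 WV[OF C(2)]] C(3) by auto
      qed (use z f1 f2 in auto)
    qed
  qed
  have AA: "z \<in> f ` ({u1, x} \<inter> {u1, y})" if "x \<in> ?O" "y \<in> ?O" "x \<noteq> y"
    "z \<in> convex hull (f ` {u1, x})" "z \<in> convex hull (f ` {u1, y})" for x y z
  proof -
    note T = that
    obtain t where t: "0 \<le> t" "t \<le> h x" "Re z = s x * t" "Im z = 1 - t" using segA[OF T(4,1)] by blast
    obtain t' where t': "0 \<le> t'" "t' \<le> h y" "Re z = s y * t'" "Im z = 1 - t'" using segA[OF T(5,2)] by blast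
    have "t = t'" using t t' by simp
    have "s x \<noteq> s y" using sinj that by blast
    then have "t = 0" using t(3) t'(3) \<open>t = t'\<close> by auto
    then have "f u1 = z" using t pt1 by auto
    then show ?thesis by blast
  qed
  have AB: "z \<in> f ` ({u1, x} \<inter> {u2, y})" if "x \<in> ?O" "y \<in> W"
    "z \<in> convex hull (f ` {u1, x})" "z \<in> convex hull (f ` {u2, y})" for x y z
  proof -
    note T = that
    obtain t where t: "0 \<le> t" "t \<le> h x" "Re z = s x * t" "Im z = 1 - t" using segA[OF T(3,1)] by blast
    obtain t' where t': "0 \<le> t'" "t' \<le> 1" "Re z = s y * t'" "Im z = t' - 1" using segB[OF T(4,2)] by blast
    have 1: "t = 1" "t' = 1" using t t' h(2)[of x] by auto
    then have "s x = s y" using t t' by simp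
    then have "x = y" using sinj that WV by blast
    moreover have "f x = z" using pt[of y z] that(2) t' 1 \<open>x = y\<close> by auto
    ultimately show ?thesis by blast
  qed
  have AC: "z \<in> f ` ({u1, x} \<inter> {v, w})" if "x \<in> ?O" "v \<in> W" "w \<in> W" "s v < s w"
    "\<forall>x \<in> W. s x \<le> s v \<or> s w \<le> s x" "z \<in> convex hull (f ` {u1, x})" "z \<in> convex hull (f ` {v, w})" for x v w z
  proof -
    note T = that
    obtain t where t: "0 \<le> t" "t \<le> h x" "Re z = s x * t" "Im z = 1 - t" using segA[OF T(6,1)] by blast
    have c: "Im z = 0" "s v \<le> Re z" "Re z \<le> s w" using segC[OF that(7,2,3,4)] by auto
    have "t = 1" using t c by simp
    then have "h x = 1" using t h(2)[of x] by auto
    then have xW: "x \<in> W" using h(3) by blast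
    then have "f x = z" using pt[of x z] t \<open>t = 1\<close> by auto
    moreover have "s x = s v \<or> s x = s w" using that(5) xW c t \<open>t = 1\<close> by force
    then have "x = v \<or> x = w" using sinj that(1-3) WV by blast
    ultimately show ?thesis by blast
  qed
  have BB: "z \<in> f ` ({u2, x} \<inter> {u2, y})" if "x \<in> W" "y \<in> W" "x \<noteq> y"
    "z \<in> convex hull (f ` {u2, x})" "z \<in> convex hull (f ` {u2, y})" for x y z
  proof -
    note T = that
    obtain t where t: "0 \<le> t" "t \<le> 1" "Re z = s x * t" "Im z = t - 1" using segB[OF T(4,1)] by blast
    obtain t' where t': "0 \<le> t'" "t' \<le> 1" "Re z = s y * t'" "Im z = t' - 1" using segB[OF T(5,2)] by blast
    have "t = t'" using t t' by simp
    have "s x \<noteq> s y" using sinj that WV by blast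
    then have "t = 0" using t(3) t'(3) \<open>t = t'\<close> by auto
    then have "f u2 = z" using t pt2 by auto
    then show ?thesis by blast
  qed
  have BC: "z \<in> f ` ({u2, x} \<inter> {v, w})" if "x \<in> W" "v \<in> W" "w \<in> W" "s v < s w"
    "\<forall>x \<in> W. s x \<le> s v \<or> s w \<le> s x" "z \<in> convex hull (f ` {u2, x})" "z \<in> convex hull (f ` {v, w})" for x v w z
  proof -
    note T = that
    obtain t where t: "0 \<le> t" "t \<le> 1" "Re z = s x * t" "Im z = t - 1" using segB[OF T(6,1)] by blast
    have c: "Im z = 0" "s v \<le> Re z" "Re z \<le> s w" using segC[OF that(7,2,3,4)] by auto
    have "t = 1" using t c by simp
    then have "f x = z" using pt[of x z] that(1) t by auto
    moreover have "s x = s v \<or> s x = s w" using that(5) that(1) c t \<open>t = 1\<close> by force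
    then have "x = v \<or> x = w" using sinj that(1-3) WV by blast
    ultimately show ?thesis by blast
  qed
  have CC: "z \<in> f ` ({a, b} \<inter> {v, w})" if "a \<in> W" "b \<in> W" "s a < s b" "\<forall>x \<in> W. s x \<le> s a \<or> s b \<le> s x"
    "v \<in> W" "w \<in> W" "s v < s w" "\<forall>x \<in> W. s x \<le> s v \<or> s w \<le> s x" "{a, b} \<noteq> {v, w}"
    "z \<in> convex hull (f ` {a, b})" "z \<in> convex hull (f ` {v, w})" for a b v w z
  proof -
    note T = that
    have c: "Im z = 0" "s v \<le> Re z" "Re z \<le> s w" using segC[OF that(11,5,6,7)] by auto
    have d: "s a \<le> Re z" "Re z \<le> s b" using segC[OF that(10,1,2,3)] by auto
    have cc: "s a \<le> s v \<or> s w \<le> s a" "s b \<le> s v \<or> s w \<le> s b" "s v \<le> s a \<or> s b \<le> s v" "s w \<le> s a \<or> s b \<le> s w"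
      using that(1,2,4,5,6,8) by auto
    then consider "s a = s w" | "s b = s v" | "s a = s v" "s b = s w" using c d T(3,7) by linarith
    then show ?thesis
    proof cases
      case 1
      then have "a = w" "Re z = s a" using sinj WV that c d by (blast, linarith)
      then show ?thesis using pt[of a z] that(1) c by blast
    next
      case 2
      then have "b = v" "Re z = s b" using sinj WV that c d by (blast, linarith)
      then show ?thesis using pt[of b z] that(2) c by blast
    next
      case 3
      then have "a = v" "b = w" using sinj WV that by blast+
      then show ?thesis using that(9) by blast
    qed
  qed
  have crs: "z \<in> f ` (e \<inter> e')" if "base e" "base e'" "e \<noteq> e'" "z \<in> convex hull (f ` e)" "z \<in> convex hull (f ` e')" for e e' z
  proof -
    have sw: "f ` (A \<inter> B) = f ` (B \<inter> A)" for A B by (simp add: Int_commute)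
    from that(1) consider (A) y where "y \<in> ?O" "e = {u1, y}" | (B) y where "y \<in> W" "e = {u2, y}" |
      (C) v w where "v \<in> W" "w \<in> W" "e = {v, w}" "s v < s w" "\<forall>x \<in> W. s x \<le> s v \<or> s w \<le> s x"
      unfolding base_def by blast
    note c1 = this
    from that(2) consider (A) y where "y \<in> ?O" "e' = {u1, y}" | (B) y where "y \<in> W" "e' = {u2, y}" |
      (C) v w where "v \<in> W" "w \<in> W" "e' = {v, w}" "s v < s w" "\<forall>x \<in> W. s x \<le> s v \<or> s w \<le> s x"
      unfolding base_def by blast
    note c2 = this
    from c1 show ?thesis
    proof cases
      case (A y)
      from c2 show ?thesis
      proof cases
        case (A x) then show ?thesis using AA[of y x z] \<open>y \<in> _\<close> \<open>e = _\<close> that by auto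
      next
        case (B x) then show ?thesis using AB[of y x z] \<open>y \<in> _\<close> \<open>e = _\<close> that by simp
      next
        case (C v w) then show ?thesis using AC[of y v w z] \<open>y \<in> _\<close> \<open>e = _\<close> that by simp
      qed
    next
      case (B y)
      from c2 show ?thesis
      proof cases
        case (A x) then show ?thesis using AB[of x y z] \<open>y \<in> _\<close> \<open>e = _\<close> that sw[of e e'] by simp
      next
        case (B x) then show ?thesis using BB[of y x z] \<open>y \<in> _\<close> \<open>e = _\<close> that by auto
      next
        case (C v w) then show ?thesis using BC[of y v w z] \<open>y \<in> _\<close> \<open>e = _\<close> that by simp
      qed
    next
      case e: (C a b)
      from c2 show ?thesis
      proof cases
        case (A x) then show ?thesis using AC[of x a b z] e that sw[of e e'] by simp
      next
        case (B x) then show ?thesis using BC[of x a b z] e that sw[of e e'] by simp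
      next
        case (C v w) then show ?thesis using CC[of a b v w z] e that by simp
      qed
    qed
  qed
  show ?thesis
  proof (rule planarI_images[OF H finj, of I])
    fix u v assume uv: "(u, v) \<in> parcs H"
    show "\<exists>c. arc c \<and> {pathstart c, pathfinish c} = f ` {u, v} \<and> path_image c = I {u, v}"
    proof (cases "{u, v} = {p, q}")
      case True
      then show ?thesis unfolding True I_def using cl by (intro exI[of _ cl]) auto
    next
      case False
      have "f u \<noteq> f v" using finj F(4-6)[OF uv] by (auto dest: inj_onD)
      then show ?thesis using False unfolding I_def
        by (intro exI[of _ "linepath (f u) (f v)"]) (auto simp: segment_convex_hull)
    qed
  next
    fix u v x assume a: "(u, v) \<in> parcs H" "x \<in> pverts H" "f x \<in> I {u, v}"
    show "x \<in> {u, v}"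
    proof (cases "{u, v} = {p, q}")
      case True
      then have "f x \<in> {f p, f q}" using a fK cl(4) unfolding I_def by auto
      then show ?thesis unfolding True using finj a(2) pqV by (auto dest: inj_onD)
    next
      case False
      then show ?thesis using vtx[OF baseE[OF a(1) False] a(2)] a(3) unfolding I_def by auto
    qed
  next
    fix u v w z y assume a: "(u, v) \<in> parcs H" "(w, z) \<in> parcs H" "{u, v} \<noteq> {w, z}" "y \<in> I {u, v}" "y \<in> I {w, z}"
    have cb: "y \<in> f ` ({p, q} \<inter> {w, z})" if "(w, z) \<in> parcs H" "{w, z} \<noteq> {p, q}" "y \<in> path_image cl" "y \<in> convex hull (f ` {w, z})" for w z y
    proof -
      have "f ` {w, z} \<subseteq> K" using fK F(5,6)[OF that(1)] by auto
      then have "y \<in> K" using that(4) K(2) hull_minimal by blast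
      then have "y = f p \<or> y = f q" using that(3) cl(4) by blast
      then obtain x where x: "x \<in> {p, q}" "y = f x" by blast
      then have "x \<in> {w, z}" using vtx[OF baseE[OF that(1,2)], of x] that(4) pqV by auto
      then show ?thesis using x by blast
    qed
    show "y \<in> f ` ({u, v} \<inter> {w, z})"
    proof (cases "{u, v} = {p, q}")
      case True
      then have "{w, z} \<noteq> {p, q}" using a(3) by simp
      then show ?thesis using cb[OF a(2), of y] a(4,5) True unfolding I_def by simp
    next
      case F1: False
      show ?thesis
      proof (cases "{w, z} = {p, q}")
        case True
        then have "y \<in> f ` ({w, z} \<inter> {u, v})" using cb[OF a(1) F1, of y] a(4,5) F1 unfolding I_def by simp
        then show ?thesis by (simp add: Int_commute)
      next
        case False
        then show ?thesis using crs[OF baseE[OF a(1) F1] baseE[OF a(2) False] a(3), of y] a(4,5) F1 unfolding I_def by simp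
      qed
    qed
  qed
qed

section \<open>Graphs of maximum degree two\<close>

definition path_list :: "('a \<Rightarrow> 'a \<Rightarrow> bool) \<Rightarrow> 'a list \<Rightarrow> bool" where
  "path_list E xs \<longleftrightarrow> distinct xs \<and> (\<forall>i. Suc i < length xs \<longrightarrow> E (xs ! i) (xs ! Suc i))"

definition cycle_list :: "('a \<Rightarrow> 'a \<Rightarrow> bool) \<Rightarrow> 'a list \<Rightarrow> bool" where
  "cycle_list E xs \<longleftrightarrow> path_list E xs \<and> 3 \<le> length xs \<and> E (xs ! (length xs - 1)) (xs ! 0)"

definition linear_adj :: "('a \<Rightarrow> 'a \<Rightarrow> bool) \<Rightarrow> 'a list \<Rightarrow> bool" where
  "linear_adj E xs \<longleftrightarrow> (\<forall>i<length xs. \<forall>j<length xs. E (xs ! i) (xs ! j) \<longleftrightarrow> j = Suc i \<or> i = Suc j)"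

definition cyclic_adj :: "('a \<Rightarrow> 'a \<Rightarrow> bool) \<Rightarrow> 'a list \<Rightarrow> bool" where
  "cyclic_adj E xs \<longleftrightarrow> 3 \<le> length xs \<and> (\<forall>i<length xs. \<forall>j<length xs. E (xs ! i) (xs ! j) \<longleftrightarrow>
     j = Suc i \<or> i = Suc j \<or> (i = 0 \<and> j = length xs - 1) \<or> (j = 0 \<and> i = length xs - 1))"

definition degree_le_two :: "('a \<Rightarrow> 'a \<Rightarrow> bool) \<Rightarrow> bool" where
  "degree_le_two E \<longleftrightarrow> (\<forall>a b c d. E a b \<longrightarrow> E a c \<longrightarrow> E a d \<longrightarrow> b = c \<or> b = d \<or> c = d)"

text \<open>
  A path through \<open>v\<close> that is as long as possible cannot be extended at its ends, and its inner
  vertices have used up both neighbours. So it is closed under adjacency, and the only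
  further adjacency left is between its two ends.
\<close>

lemma path_or_cycle:
  assumes sym: "\<And>a b. E a b \<Longrightarrow> E b a" and irr: "\<And>a. \<not> E a a"
    and fin: "finite S" and v: "v \<in> S" and closed: "\<And>a b. a \<in> S \<Longrightarrow> E a b \<Longrightarrow> b \<in> S"
    and deg2: "degree_le_two E"
  shows "\<exists>xs. v \<in> set xs \<and> set xs \<subseteq> S \<and> path_list E xs \<and> (\<forall>a\<in>set xs. \<forall>b. E a b \<longrightarrow> b \<in> set xs) \<and>
    (linear_adj E xs \<or> cyclic_adj E xs)"
proof -
  have deg: "\<And>a b c d. E a b \<Longrightarrow> E a c \<Longrightarrow> E a d \<Longrightarrow> b = c \<or> b = d \<or> c = d"
    using deg2 unfolding degree_le_two_def by blast
  define Q where "Q xs \<longleftrightarrow> v \<in> set xs \<and> set xs \<subseteq> S \<and> path_list E xs" for xs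
  have Q0: "Q [v]" using v unfolding Q_def path_list_def by auto
  have bnd: "length xs < Suc (card S)" if "Q xs" for xs
    using that distinct_card[of xs] card_mono[OF fin, of "set xs"] unfolding Q_def path_list_def by auto
  obtain xs where xs: "Q xs" and mx: "\<And>ys. Q ys \<Longrightarrow> length ys \<le> length xs"
    using ex_has_greatest_nat[of Q "[v]" length "Suc (card S)"] Q0 bnd by (metis less_imp_le)
  define k where "k = length xs"
  have vx: "v \<in> set xs" and sub: "set xs \<subseteq> S" and dist: "distinct xs"
    and adj: "\<And>i. Suc i < k \<Longrightarrow> E (xs ! i) (xs ! Suc i)"
    using xs unfolding Q_def path_list_def k_def by auto
  have k: "k \<ge> 1" using vx unfolding k_def by (cases xs) auto
  have inS: "xs ! i \<in> S" if "i < k" for i using that sub unfolding k_def by auto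
  have inj: "xs ! i = xs ! j \<longleftrightarrow> i = j" if "i < k" "j < k" for i j
    using nth_eq_iff_index_eq[OF dist] that unfolding k_def by auto
  have F1: "b \<in> set xs" if "E (xs ! 0) b" for b
  proof (rule ccontr)
    assume nb: "b \<notin> set xs"
    have "b \<in> S" using closed[OF inS[of 0] that] k by auto
    have "E ((b # xs) ! i) ((b # xs) ! Suc i)" if "Suc i < length (b # xs)" for i
      using that sym[OF \<open>E (xs ! 0) b\<close>] adj unfolding k_def by (cases i) auto
    then have "Q (b # xs)" using vx sub dist nb \<open>b \<in> S\<close> unfolding Q_def path_list_def by auto
    from mx[OF this] show False by simp
  qed
  have F2: "b \<in> set xs" if "E (xs ! (k - 1)) b" for b
  proof (rule ccontr)
    assume nb: "b \<notin> set xs"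
    have "b \<in> S" using closed[OF inS[of "k - 1"] that] k by auto
    have "E ((xs @ [b]) ! i) ((xs @ [b]) ! Suc i)" if i: "Suc i < length (xs @ [b])" for i
    proof (cases "Suc i < k")
      case True then show ?thesis using adj[OF True] unfolding k_def by (simp add: nth_append)
    next
      case False
      then have "i = k - 1" "Suc i = k" using i unfolding k_def by auto
      then show ?thesis using \<open>E (xs ! (k - 1)) b\<close> unfolding k_def by (simp add: nth_append)
    qed
    then have "Q (xs @ [b])" using vx sub dist nb \<open>b \<in> S\<close> unfolding Q_def path_list_def by auto
    from mx[OF this] show False by simp
  qed
  have clos: "b \<in> set xs" if "a \<in> set xs" "E a b" for a b
  proof -
    obtain i where i: "i < k" "a = xs ! i" using \<open>a \<in> set xs\<close> unfolding k_def by (auto simp: in_set_conv_nth)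
    show ?thesis
    proof (cases "i = 0 \<or> i = k - 1")
      case True then show ?thesis using F1 F2 that i by auto
    next
      case False
      then have "Suc i < k" "Suc (i - 1) = i" using i by auto
      then have "E a (xs ! (i - 1))" "E a (xs ! Suc i)" using adj[of i] adj[of "i - 1"] sym i by auto
      moreover have "xs ! (i - 1) \<noteq> xs ! Suc i" using inj[of "i - 1" "Suc i"] \<open>Suc i < k\<close> by auto
      ultimately have "b = xs ! (i - 1) \<or> b = xs ! Suc i" using deg[of "xs ! i" b "xs ! (i - 1)" "xs ! Suc i"] that i by auto
      then show ?thesis using \<open>Suc i < k\<close> unfolding k_def by auto
    qed
  qed
  have ends: "i = 0 \<and> j = k - 1" if e: "E (xs ! i) (xs ! j)" "i < j" "j < k" "j \<noteq> Suc i" for i j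
  proof -
    have "i = 0"
    proof (rule ccontr)
      assume "i \<noteq> 0"
      then have "E (xs ! i) (xs ! (i - 1))" using sym adj[of "i - 1"] e by auto
      moreover have "E (xs ! i) (xs ! Suc i)" using adj[of i] e by auto
      ultimately have "xs ! (i - 1) = xs ! Suc i \<or> xs ! (i - 1) = xs ! j \<or> xs ! Suc i = xs ! j"
        using deg[of "xs ! i"] e by auto
      then show False using inj e \<open>i \<noteq> 0\<close> by auto
    qed
    moreover have "j = k - 1"
    proof (rule ccontr)
      assume "j \<noteq> k - 1"
      then have "E (xs ! j) (xs ! Suc j)" using adj[of j] e by auto
      moreover have "E (xs ! j) (xs ! (j - 1))" using sym adj[of "j - 1"] e by auto
      ultimately have "xs ! Suc j = xs ! (j - 1) \<or> xs ! Suc j = xs ! i \<or> xs ! (j - 1) = xs ! i"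
        using deg[of "xs ! j"] sym[OF e(1)] by auto
      then show False using inj e \<open>j \<noteq> k - 1\<close> by auto
    qed
    ultimately show ?thesis by blast
  qed
  have nE: "\<not> E (xs ! i) (xs ! i)" for i using irr by auto
  have "linear_adj E xs \<or> cyclic_adj E xs"
  proof (cases "E (xs ! 0) (xs ! (k - 1)) \<and> 3 \<le> k")
    case True
    have "E (xs ! i) (xs ! j) \<longleftrightarrow> j = Suc i \<or> i = Suc j \<or> (i = 0 \<and> j = k - 1) \<or> (j = 0 \<and> i = k - 1)"
      if "i < k" "j < k" for i j
    proof
      assume e: "E (xs ! i) (xs ! j)"
      then have "i \<noteq> j" using nE by auto
      then consider "i < j" | "j < i" by linarith
      then show "j = Suc i \<or> i = Suc j \<or> (i = 0 \<and> j = k - 1) \<or> (j = 0 \<and> i = k - 1)"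
        using ends[of i j] ends[of j i] e sym[OF e] that by cases auto
    next
      assume "j = Suc i \<or> i = Suc j \<or> (i = 0 \<and> j = k - 1) \<or> (j = 0 \<and> i = k - 1)"
      then show "E (xs ! i) (xs ! j)" using adj sym True that by auto
    qed
    then show ?thesis using True unfolding cyclic_adj_def k_def by auto
  next
    case False
    have "E (xs ! i) (xs ! j) \<longleftrightarrow> j = Suc i \<or> i = Suc j" if "i < k" "j < k" for i j
    proof
      assume e: "E (xs ! i) (xs ! j)"
      then have "i \<noteq> j" using nE by auto
      then consider "i < j" | "j < i" by linarith
      then show "j = Suc i \<or> i = Suc j"
      proof cases
        case 1
        then show ?thesis using ends[of i j] e that False by (cases "j = Suc i") auto
      next
        case 2
        then show ?thesis using ends[of j i] e sym[OF e] that False by (cases "i = Suc j") auto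
      qed
    next
      assume "j = Suc i \<or> i = Suc j"
      then show "E (xs ! i) (xs ! j)" using adj sym that by auto
    qed
    then show ?thesis unfolding linear_adj_def k_def by auto
  qed
  then show ?thesis using vx sub xs clos unfolding Q_def by blast
qed

lemma cyclic_adj_cycle_list:
  assumes "cyclic_adj E xs" "distinct xs" shows "cycle_list E xs"
proof -
  have 3: "3 \<le> length xs" using assms unfolding cyclic_adj_def by auto
  have *: "\<And>i j. i < length xs \<Longrightarrow> j < length xs \<Longrightarrow> E (xs ! i) (xs ! j) \<longleftrightarrow>
     j = Suc i \<or> i = Suc j \<or> (i = 0 \<and> j = length xs - 1) \<or> (j = 0 \<and> i = length xs - 1)"
    using assms unfolding cyclic_adj_def by blast
  have "E (xs ! i) (xs ! Suc i)" if "Suc i < length xs" for i using *[of i "Suc i"] that by auto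
  moreover have "E (xs ! (length xs - 1)) (xs ! 0)" using *[of "length xs - 1" 0] 3 by (cases xs) auto
  ultimately show ?thesis using 3 assms(2) unfolding cycle_list_def path_list_def by blast
qed

lemma cycle_list_two_neighbours:
  assumes sym: "\<And>a b. E a b \<Longrightarrow> E b a" and xs: "cycle_list E xs" and a: "a \<in> set xs"
  shows "\<exists>b\<in>set xs. \<exists>c\<in>set xs. b \<noteq> c \<and> E a b \<and> E a c"
proof -
  let ?k = "length xs"
  have k: "3 \<le> ?k" and d: "distinct xs" and adj: "\<And>i. Suc i < ?k \<Longrightarrow> E (xs ! i) (xs ! Suc i)"
    and cl: "E (xs ! (?k - 1)) (xs ! 0)"
    using xs unfolding cycle_list_def path_list_def by auto
  obtain i where i: "i < ?k" "a = xs ! i" using a by (auto simp: in_set_conv_nth)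
  define p where "p = (if i = 0 then ?k - 1 else i - 1)"
  define q where "q = (if i = ?k - 1 then 0 else Suc i)"
  have pq: "p < ?k" "q < ?k" "p \<noteq> q" using i k unfolding p_def q_def by (auto split: if_splits)
  have "E a (xs ! p)" using sym adj[of "i - 1"] cl i k unfolding p_def by auto
  moreover have "E a (xs ! q)" using adj[of i] cl i k unfolding q_def by (auto split: if_splits)
  moreover have "xs ! p \<noteq> xs ! q" using pq d by (simp add: nth_eq_iff_index_eq)
  ultimately show ?thesis using pq by (meson nth_mem)
qed

text \<open>
  The component of some vertex is a path; its order is followed by an order of the other
  vertices.
\<close>

lemma linear_forest_order:
  assumes sym: "\<And>a b. E a b \<Longrightarrow> E b a" and irr: "\<And>a. \<not> E a a"
    and deg: "degree_le_two E"
    and acyc: "\<And>xs. \<not> cycle_list E xs"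
    and "finite S" "\<And>a b. a \<in> S \<Longrightarrow> E a b \<Longrightarrow> b \<in> S"
  shows "\<exists>ys. distinct ys \<and> set ys = S \<and>
    (\<forall>i<length ys. \<forall>j<length ys. E (ys ! i) (ys ! j) \<longrightarrow> j = Suc i \<or> i = Suc j)"
  using assms(5,6)
proof (induction "card S" arbitrary: S rule: less_induct)
  case less
  show ?case
  proof (cases "S = {}")
    case True then show ?thesis by auto
  next
    case False
    then obtain v where v: "v \<in> S" by blast
    have "\<exists>xs. v \<in> set xs \<and> set xs \<subseteq> S \<and> path_list E xs \<and> (\<forall>a\<in>set xs. \<forall>b. E a b \<longrightarrow> b \<in> set xs) \<and>
      (linear_adj E xs \<or> cyclic_adj E xs)"
      by (rule path_or_cycle) (fact sym irr v less.prems deg)+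
    then obtain xs where xs: "v \<in> set xs" "set xs \<subseteq> S" "path_list E xs"
      "\<And>a b. a \<in> set xs \<Longrightarrow> E a b \<Longrightarrow> b \<in> set xs" "linear_adj E xs \<or> cyclic_adj E xs"
      by blast
    have dx: "distinct xs" using xs(3) unfolding path_list_def by auto
    then have lin: "linear_adj E xs" using xs(5) acyc cyclic_adj_cycle_list by blast
    have "card (S - set xs) < card S" using xs(1,2) v less.prems(1) by (intro psubset_card_mono) auto
    moreover have "b \<in> S - set xs" if "a \<in> S - set xs" "E a b" for a b
      using that less.prems(2) xs(4)[of b a] sym by blast
    ultimately obtain ys where ys: "distinct ys" "set ys = S - set xs"
      "\<forall>i<length ys. \<forall>j<length ys. E (ys ! i) (ys ! j) \<longrightarrow> j = Suc i \<or> i = Suc j"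
      using less.hyps[of "S - set xs"] less.prems(1) by blast
    have "j = Suc i \<or> i = Suc j" if ij: "i < length (xs @ ys)" "j < length (xs @ ys)" "E ((xs @ ys) ! i) ((xs @ ys) ! j)" for i j
    proof -
      have cross: False if "a \<in> set xs" "b \<in> set ys" "E a b \<or> E b a" for a b
        using that xs(4) sym ys(2) by blast
      consider "i < length xs" "j < length xs" | "i < length xs" "\<not> j < length xs" |
         "\<not> i < length xs" "j < length xs" | "\<not> i < length xs" "\<not> j < length xs" by blast
      then show ?thesis
      proof cases
        case 1 then show ?thesis using lin ij(3) unfolding linear_adj_def by (simp add: nth_append)
      next
        case 2
        then have "E (xs ! i) (ys ! (j - length xs))" "j - length xs < length ys" using ij by (auto simp: nth_append)
        then show ?thesis using cross 2 by (meson nth_mem)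
      next
        case 3
        then have "E (ys ! (i - length xs)) (xs ! j)" "i - length xs < length ys" using ij by (auto simp: nth_append)
        then show ?thesis using cross 3 by (meson nth_mem)
      next
        case 4
        then have "E (ys ! (i - length xs)) (ys ! (j - length xs))" "i - length xs < length ys" "j - length xs < length ys"
          using ij by (auto simp: nth_append)
        then have "j - length xs = Suc (i - length xs) \<or> i - length xs = Suc (j - length xs)" using ys(3) by blast
        then show ?thesis using 4 by auto
      qed
    qed
    moreover have "distinct (xs @ ys)" "set (xs @ ys) = S" using dx ys xs(2) by auto
    ultimately show ?thesis by blast
  qed
qed

lemma list_index:
  assumes "distinct xs" obtains s :: "'a \<Rightarrow> nat" where "\<And>i. i < length xs \<Longrightarrow> s (xs ! i) = i"
proof -
  have "inj_on ((!) xs) {..<length xs}" using assms by (auto intro: inj_on_nth)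
  then have "\<And>i. i < length xs \<Longrightarrow> the_inv_into {..<length xs} ((!) xs) (xs ! i) = i"
    by (simp add: the_inv_into_f_f)
  then show ?thesis using that by blast
qed

text \<open>
  The same graph as the induced subgraph of \<^const>\<open>with_proj\<close> \<open>G\<close>, but again as a pair graph, so that
  the results on pair graphs apply to it.
\<close>

definition induced :: "'a pair_pre_digraph \<Rightarrow> 'a set \<Rightarrow> 'a pair_pre_digraph" where
  "induced G R = \<lparr> pverts = R, parcs = {(u, v) \<in> parcs G. u \<in> R \<and> v \<in> R} \<rparr>"

lemma induced_simps [simp]: "pverts (induced G R) = R"
  "(u, v) \<in> parcs (induced G R) \<longleftrightarrow> (u, v) \<in> parcs G \<and> u \<in> R \<and> v \<in> R"
  unfolding induced_def by auto

lemma with_proj_induced: "with_proj G \<restriction> R = with_proj (induced G R)"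
  unfolding with_proj_def induce_subgraph_def induced_def by auto

lemma pair_graph_induced: "pair_graph G \<Longrightarrow> R \<subseteq> pverts G \<Longrightarrow> pair_graph (induced G R)"
  using pair_graph_facts[of G] by (intro pair_graphI) (auto intro: finite_subset)

lemma wf_pair_graph: "pair_graph G \<Longrightarrow> wf_digraph (with_proj G)"
proof -
  assume "pair_graph G" then interpret pair_graph G .
  show ?thesis by unfold_locales
qed

lemma contains_copyD:
  assumes "contains_copy (with_proj G) (with_proj F)"
  obtains h where "inj_on h (pverts F)" "h ` pverts F \<subseteq> pverts G" "\<And>a b. (a, b) \<in> parcs F \<Longrightarrow> (h a, h b) \<in> parcs G"
proof -
  obtain S f where S: "subgraph S (with_proj G)" and f: "pre_digraph.digraph_isomorphism (with_proj F) f" "S = app_iso f (with_proj F)"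
    using assms unfolding contains_copy_def digraph_iso_def by blast
  have T: "iso_tail f = fst" "iso_head f = snd"
    using S f(2) unfolding subgraph_def compatible_def by auto
  have A: "iso_arcs f ` parcs F \<subseteq> parcs G" "iso_verts f ` pverts F \<subseteq> pverts G"
    using S f(2) unfolding subgraph_def by auto
  have D: "inj_on (iso_verts f) (pverts F)"
    "\<And>e. e \<in> parcs F \<Longrightarrow> iso_verts f (fst e) = fst (iso_arcs f e) \<and> iso_verts f (snd e) = snd (iso_arcs f e)"
    using f(1) T unfolding pre_digraph.digraph_isomorphism_def by auto
  have "(iso_verts f a, iso_verts f b) \<in> parcs G" if "(a, b) \<in> parcs F" for a b
    using A(1) D(2)[OF that] that by (metis fst_conv image_subset_iff prod.collapse snd_conv)
  then show ?thesis using that[of "iso_verts f"] D A by blast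
qed

text \<open>
  The map on vertices determines the one on arcs, and the isomorphism must carry \<^const>\<open>fst\<close> and
  \<^const>\<open>snd\<close> along as the end maps of its target.
\<close>

lemma digraph_iso_pairI:
  assumes G: "wf_digraph (with_proj G)" and h: "inj_on h (pverts G)" "pverts K = h ` pverts G"
    "parcs K = (\<lambda>(u, v). (h u, h v)) ` parcs G"
  shows "digraph_iso (with_proj G) (with_proj K)"
proof -
  interpret pair_wf_digraph G using G by (simp add: wf_digraph_wp_iff)
  define f where "f = \<lparr> iso_verts = h, iso_arcs = (\<lambda>(u, v). (h u, h v)), iso_head = snd, iso_tail = fst \<rparr>"
  have "inj_on (\<lambda>(u, v). (h u, h v)) (parcs G)"
    using h(1) in_arcsD1 in_arcsD2 by (auto intro!: inj_onI dest: inj_onD)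
  then have "pre_digraph.digraph_isomorphism (with_proj G) f"
    unfolding pre_digraph.digraph_isomorphism_def f_def using G h(1) by auto
  moreover have "with_proj K = app_iso f (with_proj G)"
    unfolding app_iso_def f_def with_proj_def using h by simp
  ultimately show ?thesis unfolding digraph_iso_def by blast
qed

lemma contains_copyI:
  assumes G: "wf_digraph (with_proj G)" and F: "wf_digraph (with_proj F)"
    and h: "inj_on h (pverts F)" "h ` pverts F \<subseteq> pverts G" "\<And>a b. (a, b) \<in> parcs F \<Longrightarrow> (h a, h b) \<in> parcs G"
  shows "contains_copy (with_proj G) (with_proj F)"
proof -
  interpret F: pair_wf_digraph F using F by (simp add: wf_digraph_wp_iff)
  define S where "S = \<lparr> pverts = h ` pverts F, parcs = (\<lambda>(u, v). (h u, h v)) ` parcs F \<rparr>"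
  have iso: "digraph_iso (with_proj F) (with_proj S)"
    by (rule digraph_iso_pairI[OF F h(1)]) (simp_all add: S_def)
  have "wf_digraph (with_proj S)"
    unfolding wf_digraph_wp_iff by unfold_locales (auto simp: S_def dest: F.in_arcsD1 F.in_arcsD2)
  then have "subgraph (with_proj S) (with_proj G)"
    unfolding subgraph_def using G h by (auto simp: S_def compatible_def)
  with iso show ?thesis unfolding contains_copy_def by blast
qed

definition adj :: "'a pair_pre_digraph \<Rightarrow> 'a \<Rightarrow> 'a \<Rightarrow> bool" where
  "adj K a b \<longleftrightarrow> (a, b) \<in> parcs K"

lemma iso_from_list:
  assumes K: "pair_graph K" and xs: "distinct xs" "set xs = pverts K"
    and q: "\<And>i j. i < length xs \<Longrightarrow> j < length xs \<Longrightarrow> (xs ! i, xs ! j) \<in> parcs K \<longleftrightarrow> q i j"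
  shows "digraph_iso (with_proj K)
    (with_proj \<lparr> pverts = {..<length xs}, parcs = {(i, j). i < length xs \<and> j < length xs \<and> q i j} \<rparr>)"
proof -
  obtain s where s: "\<And>i. i < length xs \<Longrightarrow> s (xs ! i) = i" using list_index[OF xs(1)] by blast
  note F = pair_graph_facts[OF K]
  have V: "\<And>v. v \<in> pverts K \<Longrightarrow> \<exists>i<length xs. v = xs ! i" unfolding xs(2)[symmetric] in_set_conv_nth by auto
  have V': "\<And>i. i < length xs \<Longrightarrow> xs ! i \<in> pverts K" unfolding xs(2)[symmetric] by (rule nth_mem)
  have idx: "s v < length xs" "xs ! s v = v" if "v \<in> pverts K" for v using V[OF that] s by auto
  have img: "s ` pverts K = {..<length xs}"
  proof (intro equalityI subsetI)
    fix i assume "i \<in> {..<length xs}"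
    then have "i = s (xs ! i)" "xs ! i \<in> pverts K" using s V' by auto
    then show "i \<in> s ` pverts K" by (rule image_eqI)
  qed (use idx in auto)
  have arcs: "{(i, j). i < length xs \<and> j < length xs \<and> q i j} = (\<lambda>(u, v). (s u, s v)) ` parcs K"
  proof (intro equalityI subsetI)
    fix e assume "e \<in> {(i, j). i < length xs \<and> j < length xs \<and> q i j}"
    then obtain i j where ij: "e = (i, j)" "i < length xs" "j < length xs" "q i j" by auto
    then have "(xs ! i, xs ! j) \<in> parcs K" using q by blast
    then have "(\<lambda>(u, v). (s u, s v)) (xs ! i, xs ! j) \<in> (\<lambda>(u, v). (s u, s v)) ` parcs K" by (rule imageI)
    then show "e \<in> (\<lambda>(u, v). (s u, s v)) ` parcs K" using ij(1-3) s by simp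
  next
    fix e assume "e \<in> (\<lambda>(u, v). (s u, s v)) ` parcs K"
    then obtain u v where uv: "(u, v) \<in> parcs K" "e = (s u, s v)" by auto
    note i = idx[OF F(5)[OF uv(1)]] and j = idx[OF F(6)[OF uv(1)]]
    have "q (s u) (s v)" using q[OF i(1) j(1)] uv(1) i(2) j(2) by simp
    then show "e \<in> {(i, j). i < length xs \<and> j < length xs \<and> q i j}" using uv(2) i(1) j(1) by simp
  qed
  show ?thesis
  proof (rule digraph_iso_pairI[OF wf_pair_graph[OF K]])
    show "inj_on s (pverts K)" by (rule inj_on_inverseI[of _ "\<lambda>i. xs ! i"]) (rule idx)
  qed (simp_all add: img arcs)
qed

lemma iso_path_graph:
  assumes "pair_graph K" "distinct xs" "set xs = pverts K" "linear_adj (adj K) xs"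
  shows "digraph_iso (with_proj K) (with_proj (path_graph (length xs)))"
  unfolding path_graph_def using assms unfolding linear_adj_def adj_def by (intro iso_from_list) blast+

lemma iso_cycle_graph:
  assumes K: "pair_graph K" and xs: "distinct xs" "set xs = pverts K" "cyclic_adj (adj K) xs"
  shows "digraph_iso (with_proj K) (with_proj (cycle_graph (length xs)))"
  unfolding cycle_graph_def
proof (rule iso_from_list[OF K xs(1,2)])
  fix i j assume ij: "i < length xs" "j < length xs"
  have k: "3 \<le> length xs" using xs(3) unfolding cyclic_adj_def by auto
  have mod: "j = Suc i mod length xs \<longleftrightarrow> j = Suc i \<or> (j = 0 \<and> i = length xs - 1)" if "i < length xs" "j < length xs" for i j
    using that k by (cases "Suc i = length xs") auto
  show "(xs ! i, xs ! j) \<in> parcs K \<longleftrightarrow> j = Suc i mod length xs \<or> i = Suc j mod length xs"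
    using xs(3) ij unfolding cyclic_adj_def adj_def mod[OF ij] mod[OF ij(2,1)] by auto
qed

lemma degree_two_component:
  assumes K: "pair_graph K"
    and deg: "degree_le_two (adj K)"
    and v: "v \<in> pverts K"
  shows "\<exists>xs. v \<in> set xs \<and> set xs \<subseteq> pverts K \<and> path_list (adj K) xs \<and>
    (\<forall>a\<in>set xs. \<forall>b. adj K a b \<longrightarrow> b \<in> set xs) \<and> (linear_adj (adj K) xs \<or> cyclic_adj (adj K) xs)"
proof (rule path_or_cycle[OF _ _ _ v])
  note F = pair_graph_facts[OF K]
  show "finite (pverts K)" by (rule F)
  show "adj K b a" if "adj K a b" for a b using that F(3) unfolding adj_def by simp
  show "\<not> adj K a a" for a using F(4)[of a a] unfolding adj_def by auto
  show "b \<in> pverts K" if "adj K a b" for a b using that F(6) unfolding adj_def by simp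
  show "degree_le_two (adj K)" by (rule deg)
qed

lemma component_path_or_cycle:
  assumes K: "pair_graph K"
    and deg: "degree_le_two (adj K)"
    and C: "C \<in> pre_digraph.sccs (with_proj K)"
  shows "is_path C \<or> (is_cycle C \<and> (\<exists>xs. cycle_list (adj K) xs \<and> set xs \<subseteq> pverts K))"
proof -
  interpret pair_graph K by fact
  note F = pair_graph_facts[OF K]
  have ind: "induced_subgraph C (with_proj K)" and sc: "strongly_connected C" using C unfolding sccs_def by auto
  have Cv: "verts C \<in> sccs_verts" using C by (intro in_sccs_vertsI_sccs) auto
  have sub: "subgraph C (with_proj K)" using ind unfolding induced_subgraph_def by auto
  have vC: "verts C \<subseteq> pverts K" using sub unfolding subgraph_def by auto
  have Ceq: "C = with_proj (induced K (verts C))"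
    using ind unfolding induced_subgraph_def subgraph_def compatible_def with_proj_def induced_def
    by (intro pre_digraph.equality) auto
  obtain v where v: "v \<in> verts C" using sc unfolding strongly_connected_def by blast
  obtain xs where xs: "v \<in> set xs" "set xs \<subseteq> pverts K" "path_list (adj K) xs"
      "\<And>a b. a \<in> set xs \<Longrightarrow> adj K a b \<Longrightarrow> b \<in> set xs" "linear_adj (adj K) xs \<or> cyclic_adj (adj K) xs"
    using degree_two_component[OF K deg subsetD[OF vC v]] by blast
  have dx: "distinct xs" using xs(3) unfolding path_list_def by auto
  have reach_in: "w \<in> set xs" if "v \<rightarrow>\<^sup>*\<^bsub>with_proj K\<^esub> w" for w
    using that
  proof (induction rule: reachable_induct)
    case base show ?case by (rule xs(1))
  next
    case (step x y) then show ?case using xs(4)[of x y] unfolding adj_def by auto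
  qed
  have fwd: "xs ! 0 \<rightarrow>\<^sup>*\<^bsub>with_proj K\<^esub> xs ! i" if "i < length xs" for i
    using that
  proof (induction i)
    case 0 then show ?case using xs(2) by (auto intro!: reachable_refl)
  next
    case (Suc i)
    then have "xs ! i \<rightarrow>\<^bsub>with_proj K\<^esub> xs ! Suc i" using xs(3) unfolding path_list_def adj_def by auto
    with Suc.IH Suc.prems show ?case using reachable_adj_trans[of "xs ! 0" "xs ! i" "xs ! Suc i"] by simp
  qed
  have all: "x \<rightarrow>\<^sup>*\<^bsub>with_proj K\<^esub> y" if "x \<in> set xs" "y \<in> set xs" for x y
  proof -
    have "xs ! 0 \<rightarrow>\<^sup>*\<^bsub>with_proj K\<^esub> x" "xs ! 0 \<rightarrow>\<^sup>*\<^bsub>with_proj K\<^esub> y" using that fwd by (metis in_set_conv_nth)+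
    then show ?thesis using symmetric_reachable[OF sym_arcs] reachable_trans by blast
  qed
  have CX: "verts C = set xs"
  proof
    show "verts C \<subseteq> set xs"
    proof
      fix w assume "w \<in> verts C"
      then have "v \<rightarrow>\<^sup>*\<^bsub>with_proj K\<^esub> w" using Cv v unfolding sccs_verts_def by blast
      then show "w \<in> set xs" by (rule reach_in)
    qed
    show "set xs \<subseteq> verts C"
    proof
      fix w assume "w \<in> set xs"
      then have "v \<rightarrow>\<^sup>*\<^bsub>with_proj K\<^esub> w" "w \<rightarrow>\<^sup>*\<^bsub>with_proj K\<^esub> v" using all xs(1) by auto
      then show "w \<in> verts C" using Cv v unfolding sccs_verts_def by blast
    qed
  qed
  let ?K = "induced K (set xs)"
  have PG: "pair_graph ?K" using pair_graph_induced[OF K xs(2)] .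
  have tr: "linear_adj (adj K) xs \<Longrightarrow> linear_adj (adj ?K) xs" "cyclic_adj (adj K) xs \<Longrightarrow> cyclic_adj (adj ?K) xs"
    unfolding linear_adj_def cyclic_adj_def adj_def by auto
  from xs(5) show ?thesis
  proof
    assume "linear_adj (adj K) xs"
    from iso_path_graph[OF PG dx _ tr(1)[OF this]] have "digraph_iso C (with_proj (path_graph (length xs)))"
      using Ceq CX by simp
    moreover have "length xs \<ge> 1" using xs(1) by (cases xs) auto
    ultimately show ?thesis unfolding is_path_def by blast
  next
    assume c: "cyclic_adj (adj K) xs"
    from iso_cycle_graph[OF PG dx _ tr(2)[OF this]] have "digraph_iso C (with_proj (cycle_graph (length xs)))"
      using Ceq CX by simp
    moreover have "length xs \<ge> 3" using c unfolding cyclic_adj_def by auto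
    moreover have "cycle_list (adj K) xs" using cyclic_adj_cycle_list[OF c dx] .
    ultimately show ?thesis unfolding is_cycle_def using xs(2) by blast
  qed
qed

lemma cycle_copy_cycle_list:
  assumes "contains_copy (with_proj K) (with_proj (cycle_graph m))" "3 \<le> m"
  obtains xs where "cycle_list (adj K) xs" "set xs \<subseteq> pverts K" "length xs = m"
proof -
  obtain h where h: "inj_on h {..<m}" "h ` {..<m} \<subseteq> pverts K"
    "\<And>a b. (a, b) \<in> parcs (cycle_graph m) \<Longrightarrow> (h a, h b) \<in> parcs K"
    using contains_copyD[OF assms(1)] unfolding cycle_graph_def by (auto simp: lessThan_def)
  have "distinct (map h [0..<m])" using h(1) by (simp add: distinct_map atLeast0LessThan)
  moreover have "adj K (h i) (h (Suc i))" if "Suc i < m" for i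
    using h(3)[of i "Suc i"] that unfolding cycle_graph_def adj_def by auto
  moreover have "adj K (h (m - 1)) (h 0)" using h(3)[of "m - 1" 0] assms(2) unfolding cycle_graph_def adj_def by auto
  ultimately have "cycle_list (adj K) (map h [0..<m])" using assms(2) unfolding cycle_list_def path_list_def by auto
  moreover have "set (map h [0..<m]) \<subseteq> pverts K" using h(2) by auto
  ultimately show ?thesis using that by auto
qed

text \<open>
  The component found from a vertex of the cycle contains the whole cycle, and it is not a path
  because its first vertex has two neighbours on the cycle.
\<close>

lemma spanning_cycle_cyclic:
  assumes K: "pair_graph K"
    and deg: "degree_le_two (adj K)"
    and zs: "cycle_list (adj K) zs" "set zs = pverts K"
  obtains xs where "distinct xs" "set xs = pverts K" "cyclic_adj (adj K) xs"
proof -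
  note F = pair_graph_facts[OF K]
  have sym: "\<And>a b. adj K a b \<Longrightarrow> adj K b a" using F unfolding adj_def by blast
  have z0: "zs ! 0 \<in> pverts K"
    unfolding zs(2)[symmetric] by (rule nth_mem) (use zs(1) in \<open>auto simp: cycle_list_def\<close>)
  obtain xs where xs: "zs ! 0 \<in> set xs" "set xs \<subseteq> pverts K" "path_list (adj K) xs"
      "\<And>a b. a \<in> set xs \<Longrightarrow> adj K a b \<Longrightarrow> b \<in> set xs" "linear_adj (adj K) xs \<or> cyclic_adj (adj K) xs"
    using degree_two_component[OF K deg z0(1)] by blast
  have dx: "distinct xs" using xs(3) unfolding path_list_def by auto
  have "zs ! i \<in> set xs" if "i < length zs" for i
    using that
  proof (induction i)
    case 0 then show ?case using xs(1) by simp
  next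
    case (Suc i)
    then show ?case using xs(4)[of "zs ! i" "zs ! Suc i"] zs(1) unfolding cycle_list_def path_list_def by auto
  qed
  then have all: "set xs = pverts K" using xs(2) zs(2) by (metis in_set_conv_nth subsetI subset_antisym)
  have "\<not> linear_adj (adj K) xs"
  proof
    assume lin: "linear_adj (adj K) xs"
    have x0: "0 < length xs" using xs(1) by (cases xs) auto
    then have "xs ! 0 \<in> set zs" using all zs(2) by auto
    then obtain b c where bc: "b \<in> set zs" "c \<in> set zs" "b \<noteq> c" "adj K (xs ! 0) b" "adj K (xs ! 0) c"
      using cycle_list_two_neighbours[OF sym zs(1)] by blast
    obtain i j where ij: "i < length xs" "b = xs ! i" "j < length xs" "c = xs ! j" using bc(1,2) all zs(2) by (metis in_set_conv_nth)
    then have "i = Suc 0" "j = Suc 0" using lin bc x0 unfolding linear_adj_def by auto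
    then show False using bc ij by auto
  qed
  then show ?thesis using that dx all xs(5) by blast
qed

section \<open>The spectral radius as a maximum of the quadratic form\<close>

definition quad :: "'a pair_pre_digraph \<Rightarrow> ('a \<Rightarrow> real) \<Rightarrow> real" where
  "quad G y = (\<Sum>v\<in>pverts G. \<Sum>u\<in>nbhd G v. y v * y u)"

definition sqnorm :: "'a pair_pre_digraph \<Rightarrow> ('a \<Rightarrow> real) \<Rightarrow> real" where
  "sqnorm G y = (\<Sum>v\<in>pverts G. (y v)\<^sup>2)"

lemma sum_adj_matrix:
  assumes "pair_graph G"
  shows "(\<Sum>u\<in>pverts G. adj_matrix G v u * y u) = (\<Sum>u\<in>nbhd G v. y u)"
proof -
  have "(\<Sum>u\<in>pverts G. adj_matrix G v u * y u) = (\<Sum>u\<in>pverts G. if (v, u) \<in> parcs G then y u else 0)"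
    unfolding adj_matrix_def by (rule sum.cong) auto
  also have "\<dots> = (\<Sum>u\<in>pverts G \<inter> {u. (v, u) \<in> parcs G}. y u)"
    using pair_graph_facts(1)[OF assms] by (simp add: sum.inter_restrict)
  also have "pverts G \<inter> {u. (v, u) \<in> parcs G} = nbhd G v" unfolding nbhd_def by auto
  finally show ?thesis .
qed

lemma eigen_eq:
  assumes "pair_graph G" "adj_eigenvector G x l" "v \<in> pverts G"
  shows "(\<Sum>u\<in>nbhd G v. x u) = l * x v"
  using assms sum_adj_matrix[OF assms(1), of v x] unfolding adj_eigenvector_def by simp

lemma finite_nbhd: "pair_graph G \<Longrightarrow> finite (nbhd G v)"
  unfolding nbhd_def using pair_graph_facts(1)[of G] by simp

lemma quad_matrix:
  assumes "pair_graph G"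
  shows "(\<Sum>v\<in>pverts G. \<Sum>u\<in>nbhd G v. y v * z u) = (\<Sum>v\<in>pverts G. \<Sum>u\<in>pverts G. adj_matrix G v u * (y v * z u))"
proof (rule sum.cong[OF refl])
  fix v
  show "(\<Sum>u\<in>nbhd G v. y v * z u) = (\<Sum>u\<in>pverts G. adj_matrix G v u * (y v * z u))"
    using sum_adj_matrix[OF assms, of v z] by (simp add: sum_distrib_left[symmetric] mult.left_commute)
qed

lemma adj_matrix_sym: "pair_graph G \<Longrightarrow> adj_matrix G u v = adj_matrix G v u"
  unfolding adj_matrix_def using pair_graph_facts(3)[of G] by auto

lemma quad_swap:
  fixes y z :: "'a \<Rightarrow> real"
  assumes "pair_graph G"
  shows "(\<Sum>v\<in>pverts G. \<Sum>u\<in>nbhd G v. y v * z u) = (\<Sum>v\<in>pverts G. \<Sum>u\<in>nbhd G v. z v * y u)"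
proof -
  have "(\<Sum>v\<in>pverts G. \<Sum>u\<in>pverts G. adj_matrix G v u * (y v * z u)) =
    (\<Sum>u\<in>pverts G. \<Sum>v\<in>pverts G. adj_matrix G v u * (y v * z u))" by (rule sum.swap)
  also have "\<dots> = (\<Sum>v\<in>pverts G. \<Sum>u\<in>pverts G. adj_matrix G v u * (z v * y u))"
    by (intro sum.cong refl) (simp add: adj_matrix_sym[OF assms] mult.commute)
  finally show ?thesis using quad_matrix[OF assms, of y z] quad_matrix[OF assms, of z y] by simp
qed

lemma eigenvectors_orthogonal:
  assumes G: "pair_graph G" and y: "adj_eigenvector G y l" and z: "adj_eigenvector G z m" and "l \<noteq> m"
  shows "(\<Sum>v\<in>pverts G. y v * z v) = 0"
proof -
  have "m * (\<Sum>v\<in>pverts G. y v * z v) = (\<Sum>v\<in>pverts G. \<Sum>u\<in>nbhd G v. y v * z u)"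
    unfolding sum_distrib_left
    by (rule sum.cong[OF refl]) (simp add: sum_distrib_left[symmetric] eigen_eq[OF G z] mult.left_commute)
  also have "\<dots> = (\<Sum>v\<in>pverts G. \<Sum>u\<in>nbhd G v. z v * y u)" by (rule quad_swap[OF G])
  also have "\<dots> = l * (\<Sum>v\<in>pverts G. y v * z v)"
    unfolding sum_distrib_left
    by (rule sum.cong[OF refl]) (simp only: sum_distrib_left[symmetric] eigen_eq[OF G y], simp)
  finally show ?thesis using assms(4) by simp
qed

lemma quad_eigenvector:
  assumes G: "pair_graph G" and y: "adj_eigenvector G y l"
  shows "quad G y = l * sqnorm G y"
  unfolding quad_def sqnorm_def sum_distrib_left
  by (rule sum.cong[OF refl])
    (simp add: sum_distrib_left[symmetric] eigen_eq[OF G y] power2_eq_square mult.left_commute)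

text \<open>
  Bessel's inequality for the coordinate vector at \<open>v\<close>, expanded in eigenvectors for distinct eigenvalues,
  bounds the sum of their normalised squared entries at \<open>v\<close> by \<open>1\<close>. Summing over all vertices
  counts the eigenvalues.
\<close>

lemma card_eigenvalues:
  assumes G: "pair_graph G" and T: "finite T" "T \<subseteq> {l. \<exists>x. adj_eigenvector G x l}"
  shows "card T \<le> card (pverts G)"
proof -
  let ?V = "pverts G"
  have fin: "finite ?V" by (rule pair_graph_facts[OF G])
  have "\<forall>l\<in>T. \<exists>x. adj_eigenvector G x l" using T(2) by auto
  then obtain Y where Y: "\<And>l. l \<in> T \<Longrightarrow> adj_eigenvector G (Y l) l" by metis
  define N where "N l = sqnorm G (Y l)" for l
  have Npos: "N l > 0" if "l \<in> T" for l
  proof -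
    have "adj_eigenvector G (Y l) l" by (rule Y[OF that])
    then obtain v where "v \<in> ?V" "Y l v \<noteq> 0" unfolding adj_eigenvector_def by blast
    then show ?thesis unfolding N_def sqnorm_def using fin by (intro sum_pos2[of _ v]) auto
  qed
  have orth: "(\<Sum>w\<in>?V. Y l w * Y m w) = (if l = m then N l else 0)" if "l \<in> T" "m \<in> T" for l m
    using eigenvectors_orthogonal[OF G Y[OF that(1)] Y[OF that(2)]] unfolding N_def sqnorm_def
    by (simp add: power2_eq_square)
  have bessel: "(\<Sum>l\<in>T. (Y l v)\<^sup>2 / N l) \<le> 1" if v: "v \<in> ?V" for v
  proof -
    define c where "c l = Y l v / N l" for l
    define d where "d w = (if w = v then 1 else 0 :: real)" for w
    define p where "p w = (\<Sum>l\<in>T. c l * Y l w)" for w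
    have "0 \<le> (\<Sum>w\<in>?V. (d w - p w)\<^sup>2)" by (simp add: sum_nonneg)
    also have "\<dots> = (\<Sum>w\<in>?V. (d w)\<^sup>2) - 2 * (\<Sum>w\<in>?V. d w * p w) + (\<Sum>w\<in>?V. (p w)\<^sup>2)"
      by (simp add: power2_diff sum.distrib sum_subtractf sum_distrib_left algebra_simps)
    also have "(\<Sum>w\<in>?V. (d w)\<^sup>2) = 1"
    proof -
      have "(\<Sum>w\<in>?V. (d w)\<^sup>2) = (\<Sum>w\<in>?V. if w = v then 1 else 0)" unfolding d_def by (rule sum.cong) auto
      then show ?thesis using v fin by simp
    qed
    also have "(\<Sum>w\<in>?V. d w * p w) = p v"
    proof -
      have "(\<Sum>w\<in>?V. d w * p w) = (\<Sum>w\<in>?V. if w = v then p v else 0)" unfolding d_def by (rule sum.cong) auto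
      then show ?thesis using v fin by simp
    qed
    also have "p v = (\<Sum>l\<in>T. (Y l v)\<^sup>2 / N l)" unfolding p_def c_def by (simp add: power2_eq_square)
    also have "(\<Sum>w\<in>?V. (p w)\<^sup>2) = (\<Sum>w\<in>?V. \<Sum>l\<in>T. \<Sum>m\<in>T. (c l * c m) * (Y l w * Y m w))"
      unfolding p_def power2_eq_square sum_product by (simp add: algebra_simps)
    also have "\<dots> = (\<Sum>l\<in>T. \<Sum>m\<in>T. \<Sum>w\<in>?V. (c l * c m) * (Y l w * Y m w))"
      by (subst sum.swap, rule sum.cong[OF refl], rule sum.swap)
    also have "\<dots> = (\<Sum>l\<in>T. \<Sum>m\<in>T. (c l * c m) * (if l = m then N l else 0))"
      by (intro sum.cong refl) (simp only: sum_distrib_left[symmetric] orth)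
    also have "\<dots> = (\<Sum>l\<in>T. \<Sum>m\<in>T. if l = m then c l * c l * N l else 0)"
      by (intro sum.cong refl) simp
    also have "\<dots> = (\<Sum>l\<in>T. c l * c l * N l)" using T(1) by simp
    also have "\<dots> = (\<Sum>l\<in>T. (Y l v)\<^sup>2 / N l)"
    proof (rule sum.cong[OF refl])
      fix l assume "l \<in> T"
      from Npos[OF this] show "c l * c l * N l = (Y l v)\<^sup>2 / N l" unfolding c_def by (simp add: power2_eq_square)
    qed
    finally show ?thesis by simp
  qed
  have "real (card T) = (\<Sum>l\<in>T. (\<Sum>v\<in>?V. (Y l v)\<^sup>2 / N l))"
  proof -
    have "(\<Sum>v\<in>?V. (Y l v)\<^sup>2 / N l) = 1" if "l \<in> T" for l
      using Npos[OF that] unfolding sum_divide_distrib[symmetric] N_def sqnorm_def by simp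
    then show ?thesis by simp
  qed
  also have "\<dots> = (\<Sum>v\<in>?V. (\<Sum>l\<in>T. (Y l v)\<^sup>2 / N l))" by (rule sum.swap)
  also have "\<dots> \<le> (\<Sum>v\<in>?V. 1)" by (rule sum_mono) (rule bessel)
  finally show ?thesis by simp
qed

text \<open>
  Without finiteness the maximum in \<^const>\<open>spec_radius\<close> would be an arbitrary value.
\<close>

lemma finite_eigenvalues:
  assumes "pair_graph G" shows "finite {l. \<exists>x. adj_eigenvector G x l}"
  by (rule finite_if_finite_subsets_card_bdd[where C = "card (pverts G)", THEN conjunct1])
    (use card_eigenvalues[OF assms] in blast)

lemma eigenvalue_le_spec_radius:
  assumes "pair_graph G" "adj_eigenvector G x l" shows "l \<le> spec_radius G"
  unfolding spec_radius_def using finite_eigenvalues[OF assms(1)] assms(2) by (intro Max_ge) auto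

text \<open>
  The unit sphere is compact in the product topology once the values outside the vertex set are
  fixed to be \<open>0\<close>.
\<close>

lemma Rayleigh_maximizer:
  assumes G: "pair_graph G" and ne: "pverts G \<noteq> {}"
  shows "\<exists>y. sqnorm G y = 1 \<and> (\<forall>z. quad G z \<le> quad G y * sqnorm G z)"
proof -
  let ?V = "pverts G"
  have fin: "finite ?V" by (rule pair_graph_facts[OF G])
  define B where "B = (\<Pi>\<^sub>E v\<in>UNIV. if v \<in> ?V then {-1..1} else {0 :: real})"
  have "compactin (product_topology (\<lambda>_. euclidean) UNIV) B"
    unfolding B_def by (subst compactin_PiE) (auto simp: compactin_euclidean_iff)
  then have cB: "compact B" by (simp add: euclidean_product_topology compactin_euclidean_iff)
  have cont1: "continuous_on UNIV (\<lambda>y. y v)" for v :: 'a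
    by (rule continuous_on_product_coordinates)
  have cont: "continuous_on UNIV (sqnorm G)" "continuous_on UNIV (quad G)"
    unfolding sqnorm_def[abs_def] quad_def[abs_def] by (intro continuous_intros cont1)+
  define S where "S = B \<inter> sqnorm G -` {1}"
  have "closed (sqnorm G -` {1})" using cont(1) by (intro closed_vimage) auto
  then have "compact S" unfolding S_def by (intro compact_Int_closed cB)
  obtain v0 where v0: "v0 \<in> ?V" using ne by blast
  have "(\<lambda>v. if v = v0 then 1 else 0) \<in> S"
  proof -
    have "sqnorm G (\<lambda>v. if v = v0 then 1 else 0) = (\<Sum>v\<in>?V. if v = v0 then 1 else 0)"
      unfolding sqnorm_def by (rule sum.cong) auto
    also have "\<dots> = 1" using v0 fin by simp
    finally show ?thesis unfolding S_def B_def using v0 by auto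
  qed
  then have "S \<noteq> {}" by blast
  then obtain y where y: "y \<in> S" "\<And>z. z \<in> S \<Longrightarrow> quad G z \<le> quad G y"
    using continuous_attains_sup[OF \<open>compact S\<close>] continuous_on_subset[OF cont(2)] by (metis subset_UNIV)
  have y1: "sqnorm G y = 1" using y(1) unfolding S_def by auto
  have "quad G z \<le> quad G y * sqnorm G z" for z
  proof (cases "sqnorm G z = 0")
    case True
    then have "\<forall>v\<in>?V. z v = 0" unfolding sqnorm_def using fin by (simp add: sum_nonneg_eq_0_iff)
    then have "quad G z = 0" unfolding quad_def by (intro sum.neutral ballI) auto
    then show ?thesis using True by simp
  next
    case False
    have nn: "sqnorm G z \<ge> 0" unfolding sqnorm_def by (simp add: sum_nonneg)
    define r where "r = sqrt (sqnorm G z)"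
    have r: "r > 0" "r\<^sup>2 = sqnorm G z" using False nn unfolding r_def by auto
    define w where "w v = (if v \<in> ?V then z v / r else 0)" for v
    have sw: "sqnorm G w = 1"
    proof -
      have "sqnorm G w = (\<Sum>v\<in>?V. (z v)\<^sup>2 / r\<^sup>2)" unfolding sqnorm_def w_def by (rule sum.cong) (auto simp: power_divide)
      also have "\<dots> = sqnorm G z / r\<^sup>2" unfolding sqnorm_def by (rule sum_divide_distrib[symmetric])
      finally show ?thesis using r False by simp
    qed
    have "w \<in> S"
    proof -
      have "\<bar>w v\<bar> \<le> 1" if "v \<in> ?V" for v
      proof -
        have "(w v)\<^sup>2 \<le> sqnorm G w" unfolding sqnorm_def using fin that by (intro member_le_sum) auto
        then show ?thesis using sw by (simp add: abs_square_le_1)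
      qed
      note bd = this
      have "w v \<in> (if v \<in> ?V then {-1..1} else {0})" for v
      proof (cases "v \<in> ?V")
        case True then show ?thesis using bd[OF True] by (auto simp: abs_le_iff)
      qed (simp add: w_def)
      then have "w \<in> B" unfolding B_def by (simp add: PiE_iff)
      then show ?thesis using sw unfolding S_def by auto
    qed
    have "quad G w = quad G z / r\<^sup>2"
    proof -
      have "quad G w = (\<Sum>v\<in>?V. \<Sum>u\<in>nbhd G v. (z v * z u) / r\<^sup>2)"
        unfolding quad_def w_def by (intro sum.cong refl) (auto simp: nbhd_def power2_eq_square)
      also have "\<dots> = quad G z / r\<^sup>2" unfolding quad_def by (simp add: sum_divide_distrib)
      finally show ?thesis .
    qed
    with y(2)[OF \<open>w \<in> S\<close>] r False nn show ?thesis by (simp add: field_simps)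
  qed
  with y1 show ?thesis by blast
qed

text \<open>
  The defect \<open>D\<close> of the eigenvector equation at \<open>v\<close> is the first-order change when only the entry at
  \<open>v\<close> is varied; it vanishes at a maximum.
\<close>

lemma Rayleigh_eigenvector:
  assumes G: "pair_graph G" and y1: "sqnorm G y = 1" and mx: "\<And>z. quad G z \<le> quad G y * sqnorm G z"
  shows "adj_eigenvector G y (quad G y)"
proof -
  let ?V = "pverts G"
  have fin: "finite ?V" by (rule pair_graph_facts[OF G])
  define mu where "mu = quad G y"
  have "(\<Sum>u\<in>nbhd G v. y u) = mu * y v" if v: "v \<in> ?V" for v
  proof -
    define D where "D = (\<Sum>u\<in>nbhd G v. y u) - mu * y v"
    define d where "d w = (if w = v then 1 else 0 :: real)" for w
    have vn: "v \<notin> nbhd G v" using pair_graph_facts(4)[OF G, of v v] unfolding nbhd_def by auto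
    have dsum: "(\<Sum>w\<in>?V. d w * f w) = f v" for f
    proof -
      have "(\<Sum>w\<in>?V. d w * f w) = (\<Sum>w\<in>?V. if w = v then f v else 0)" unfolding d_def by (rule sum.cong) auto
      then show ?thesis using v fin by simp
    qed
    have dy: "(\<Sum>w\<in>?V. \<Sum>u\<in>nbhd G w. d w * y u) = (\<Sum>u\<in>nbhd G v. y u)"
      using dsum[of "\<lambda>w. \<Sum>u\<in>nbhd G w. y u"] by (simp add: sum_distrib_left)
    have dd: "(\<Sum>w\<in>?V. \<Sum>u\<in>nbhd G w. d w * d u) = 0"
    proof -
      have "(\<Sum>w\<in>?V. \<Sum>u\<in>nbhd G w. d w * d u) = (\<Sum>u\<in>nbhd G v. d u)"
        using dsum[of "\<lambda>w. \<Sum>u\<in>nbhd G w. d u"] by (simp add: sum_distrib_left)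
      also have "\<dots> = 0" using vn unfolding d_def by (intro sum.neutral) auto
      finally show ?thesis .
    qed
    have key: "2 * t * D \<le> mu * t\<^sup>2" for t
    proof -
      define z where "z w = y w + t * d w" for w
      have "quad G z = (\<Sum>w\<in>?V. \<Sum>u\<in>nbhd G w. y w * y u + t * (y w * d u) + t * (d w * y u) + t\<^sup>2 * (d w * d u))"
        unfolding quad_def z_def by (intro sum.cong refl) (simp add: algebra_simps power2_eq_square)
      also have "\<dots> = quad G y + t * (\<Sum>w\<in>?V. \<Sum>u\<in>nbhd G w. y w * d u)
        + t * (\<Sum>w\<in>?V. \<Sum>u\<in>nbhd G w. d w * y u) + t\<^sup>2 * (\<Sum>w\<in>?V. \<Sum>u\<in>nbhd G w. d w * d u)"
        unfolding quad_def by (simp add: sum.distrib sum_distrib_left)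
      also have "\<dots> = mu + 2 * t * (\<Sum>u\<in>nbhd G v. y u)"
        unfolding quad_swap[OF G, of y d] dy dd mu_def by simp
      finally have q: "quad G z = mu + 2 * t * (\<Sum>u\<in>nbhd G v. y u)" .
      have "sqnorm G z = (\<Sum>w\<in>?V. (y w)\<^sup>2 + 2 * t * (d w * y w) + t\<^sup>2 * (d w * d w))"
        unfolding sqnorm_def z_def by (intro sum.cong refl) (simp add: power2_eq_square algebra_simps)
      also have "\<dots> = sqnorm G y + 2 * t * (\<Sum>w\<in>?V. d w * y w) + t\<^sup>2 * (\<Sum>w\<in>?V. d w * d w)"
        unfolding sqnorm_def by (simp add: sum.distrib sum_distrib_left)
      also have "\<dots> = 1 + 2 * t * y v + t\<^sup>2" unfolding dsum y1 by (simp add: d_def)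
      finally have s: "sqnorm G z = 1 + 2 * t * y v + t\<^sup>2" .
      have "quad G z \<le> mu * sqnorm G z" unfolding mu_def by (rule mx)
      then show ?thesis unfolding q s D_def by (simp add: algebra_simps)
    qed
    have "D = 0"
    proof (rule ccontr)
      assume "D \<noteq> 0"
      \<comment> \<open>With step D / m the gain of first order exceeds the quadratic term.\<close>
      define m where "m = \<bar>mu\<bar> + 1"
      have m: "m > 0" "mu < m" "m * m > 0" unfolding m_def by (auto simp: add_nonneg_pos)
      have "2 * (D / m) * D \<le> mu * (D / m)\<^sup>2" by (rule key)
      then have "2 * D\<^sup>2 * m \<le> mu * D\<^sup>2" using m by (simp add: power2_eq_square field_simps)
      moreover have "mu * D\<^sup>2 < m * D\<^sup>2" using m \<open>D \<noteq> 0\<close> by (intro mult_strict_right_mono) auto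
      moreover have "m * D\<^sup>2 \<ge> 0" using m by auto
      ultimately show False by (simp add: mult.commute mult.left_commute)
    qed
    then show ?thesis unfolding D_def by simp
  qed
  moreover have "\<exists>v\<in>?V. y v \<noteq> 0"
  proof (rule ccontr)
    assume "\<not> ?thesis"
    then have "sqnorm G y = 0" unfolding sqnorm_def by (intro sum.neutral) auto
    then show False using y1 by simp
  qed
  ultimately show ?thesis unfolding adj_eigenvector_def sum_adj_matrix[OF G] mu_def by blast
qed

theorem quad_le_spec_radius:
  assumes "pair_graph G" "pverts G \<noteq> {}"
  shows "quad G z \<le> spec_radius G * sqnorm G z"
proof -
  obtain y where y: "sqnorm G y = 1" "\<And>z. quad G z \<le> quad G y * sqnorm G z"
    using Rayleigh_maximizer[OF assms] by blast
  have "quad G y \<le> spec_radius G"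
    using Rayleigh_eigenvector[OF assms(1) y] eigenvalue_le_spec_radius[OF assms(1)] by blast
  moreover have "sqnorm G z \<ge> 0" unfolding sqnorm_def by (simp add: sum_nonneg)
  ultimately show ?thesis using y(2)[of z] mult_right_mono by (meson order_trans)
qed

section \<open>Two dominating vertices\<close>

lemma card_arcs_between:
  assumes "pair_graph G" "finite A"
  shows "card {(v, w) \<in> parcs G. v \<in> A \<and> w \<in> B} = (\<Sum>v\<in>A. card (nbhd G v \<inter> B))"
proof -
  note F = pair_graph_facts[OF assms(1)]
  have "{(v, w) \<in> parcs G. v \<in> A \<and> w \<in> B} = Sigma A (\<lambda>v. nbhd G v \<inter> B)"
    using F(6) unfolding nbhd_def by auto
  then show ?thesis using assms(2) finite_nbhd[OF assms(1)] by (simp add: card_SigmaI)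
qed

lemma nbhd_iff: "pair_graph G \<Longrightarrow> w \<in> nbhd G v \<longleftrightarrow> (v, w) \<in> parcs G"
  using pair_graph_facts(6)[of G] unfolding nbhd_def by auto

lemma planar_inner_degrees:
  assumes G: "pair_graph G" "planar G" and S: "S \<subseteq> pverts G" "S \<noteq> {}"
  shows "(\<Sum>v\<in>S. card (nbhd G v \<inter> S)) < 6 * card S"
proof -
  have finS: "finite S" using S pair_graph_facts(1)[OF G(1)] finite_subset by blast
  have PG: "pair_graph (induced G S)" by (rule pair_graph_induced[OF G(1) S(1)])
  have "planar (induced G S)" by (rule planar_subgraph[OF G(2) PG]) (use S in auto)
  from planar_arc_bounds(1)[OF PG this] have "card (parcs (induced G S)) < 6 * card S"
    using S finS by (auto simp: card_gt_0_iff Suc_le_eq dest: card_0_eq) 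
  moreover have "parcs (induced G S) = {(v, w) \<in> parcs G. v \<in> S \<and> w \<in> S}" by auto
  ultimately show ?thesis using card_arcs_between[OF G(1) finS] by simp
qed

lemma planar_bipartite_degrees:
  assumes G: "pair_graph G" "planar G" and AB: "A \<subseteq> pverts G" "B \<subseteq> pverts G" "A \<inter> B = {}"
  shows "(\<Sum>v\<in>A. card (nbhd G v \<inter> B)) \<le> 3 \<or> (\<Sum>v\<in>A. card (nbhd G v \<inter> B)) + 4 \<le> 2 * (card A + card B)"
proof -
  note F = pair_graph_facts[OF G(1)]
  have fin: "finite A" "finite B" using AB F(1) finite_subset by blast+
  let ?X = "{(v, w) \<in> parcs G. v \<in> A \<and> w \<in> B}" and ?Y = "{(v, w) \<in> parcs G. v \<in> B \<and> w \<in> A}"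
  define K where "K = \<lparr> pverts = A \<union> B, parcs = ?X \<union> ?Y \<rparr>"
  have PK: "pair_graph K" using fin F by (intro pair_graphI) (auto simp: K_def)
  have plK: "planar K" by (rule planar_subgraph[OF G(2) PK]) (use AB in \<open>auto simp: K_def\<close>)
  have tf: "(a, c) \<notin> parcs K" if "(a, b) \<in> parcs K" "(b, c) \<in> parcs K" for a b c
    using that AB(3) unfolding K_def by auto
  have finXY: "finite ?X" "finite ?Y" using F(2) by (auto intro: rev_finite_subset)
  have "?X \<inter> ?Y = {}" using AB(3) by auto
  then have "card (parcs K) = card ?X + card ?Y" unfolding K_def using finXY by (simp add: card_Un_disjoint)
  moreover have "?Y = prod.swap ` ?X" using F(3) by (auto simp: image_iff)
  then have "card ?Y = card ?X" by (simp add: card_image)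
  moreover have "card (pverts K) = card A + card B" unfolding K_def using fin AB(3) by (simp add: card_Un_disjoint)
  moreover have "card (parcs K) \<le> 6 \<or> card (parcs K) + 8 \<le> 4 * card (pverts K)"
    using planar_arc_bounds(2)[OF PK plK] tf by blast
  ultimately show ?thesis
    using card_arcs_between[OF G(1) fin(1), of B] by auto
qed

text \<open>
  From \<open>n \<ge> 10\<^sup>1\<^sup>6\<close> on, all error terms below are a small fraction of \<open>n\<close>.
\<close>

locale planar_eigen =
  fixes G :: "'a pair_pre_digraph" and n :: nat and x :: "'a \<Rightarrow> real" and r :: real
  assumes G: "pair_graph G" and planarG: "planar G" and n: "card (pverts G) = n"
    and big: "real n \<ge> 10 ^ 16"
    and eig: "\<And>v. v \<in> pverts G \<Longrightarrow> (\<Sum>u\<in>nbhd G v. x u) = r * x v"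
    and pos: "\<And>v. v \<in> pverts G \<Longrightarrow> 0 < x v" and le1: "\<And>v. v \<in> pverts G \<Longrightarrow> x v \<le> 1"
    and r: "0 < r" "2 * real n - 4 \<le> r\<^sup>2"
begin

abbreviation V where "V \<equiv> pverts G"
abbreviation N where "N \<equiv> nbhd G"

lemma finV: "finite V" by (rule pair_graph_facts[OF G])
lemma finN: "finite (N v)" by (rule finite_nbhd[OF G])
lemma NV: "w \<in> N v \<Longrightarrow> w \<in> V" unfolding nbhd_def by auto
lemma N_sym: "w \<in> N v \<longleftrightarrow> v \<in> N w"
  using pair_graph_facts(3)[OF G] by (auto simp: nbhd_iff[OF G])
lemma N_irr: "v \<notin> N v" using pair_graph_facts(4)[OF G, of v v] by (auto simp: nbhd_iff[OF G])
lemma arc_N: "(v, w) \<in> parcs G \<longleftrightarrow> w \<in> N v" by (simp add: nbhd_iff[OF G])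

lemma degree_sum: "S \<subseteq> V \<Longrightarrow> (\<Sum>v\<in>S. card (N v \<inter> S)) \<le> 6 * card S"
  using planar_inner_degrees[OF G planarG, of S] by (cases "S = {}") auto

lemma degree_sum_sub: "S \<subseteq> V \<Longrightarrow> (\<Sum>v\<in>S. card (N v)) \<le> 6 * n"
proof -
  assume S: "S \<subseteq> V"
  have "(\<Sum>v\<in>S. card (N v)) \<le> (\<Sum>v\<in>V. card (N v))" using S finV by (intro sum_mono2) auto
  also have "\<dots> = (\<Sum>v\<in>V. card (N v \<inter> V))" by (intro sum.cong refl arg_cong[where f = card]) (use NV in auto)
  also have "\<dots> \<le> 6 * n" using degree_sum[of V] n by simp
  finally show ?thesis .
qed

lemma no_K33:
  assumes "A \<subseteq> V" "B \<subseteq> V" "A \<inter> B = {}" "card A = 3" "card B = 3" "\<And>a b. a \<in> A \<Longrightarrow> b \<in> B \<Longrightarrow> b \<in> N a"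
  shows False
proof -
  have "N a \<inter> B = B" if "a \<in> A" for a using assms(6) that by auto
  then have "(\<Sum>v\<in>A. card (N v \<inter> B)) = 9" using assms(4,5) by simp
  then show False using planar_bipartite_degrees[OF G planarG assms(1-3)] assms(4,5) by simp
qed

definition L where "L = {v \<in> V. x v \<ge> 1 / 1000}"

lemma r_big: "r \<ge> 10 ^ 8"
proof (rule power2_le_imp_le)
  have "(10 ^ 8)\<^sup>2 \<le> 2 * real n - 4" using big by simp
  then show "(10 ^ 8)\<^sup>2 \<le> r\<^sup>2" using r(2) by linarith
qed (use r in simp)

lemma sum_le_degree: "v \<in> V \<Longrightarrow> r * x v \<le> card (N v)"
proof -
  assume "v \<in> V"
  have "(\<Sum>u\<in>N v. x u) \<le> (\<Sum>u\<in>N v. 1)" by (rule sum_mono) (use le1 NV in blast)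
  then show ?thesis using eig[OF \<open>v \<in> V\<close>] by simp
qed

text \<open>
  A large entry forces a degree of at least \<open>r / 1000\<close>, and the degrees sum to at most \<open>6 n\<close>.
\<close>

lemma card_L: "real (card L) \<le> 6 / 10 ^ 5 * real n"
proof -
  have LV: "L \<subseteq> V" unfolding L_def by auto
  have "real (card L) * (10 ^ 8 / 1000) = (\<Sum>v\<in>L. 10 ^ 8 * (1 / 1000))" by simp
  also have "\<dots> \<le> (\<Sum>v\<in>L. r * x v)" by (intro sum_mono mult_mono) (use r_big r in \<open>auto simp: L_def\<close>)
  also have "\<dots> \<le> (\<Sum>v\<in>L. real (card (N v)))" by (rule sum_mono) (use sum_le_degree LV in blast)
  also have "\<dots> = real (\<Sum>v\<in>L. card (N v))" by simp
  also have "\<dots> \<le> real (6 * n)" using degree_sum_sub[OF LV] by (rule of_nat_mono)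
  finally show ?thesis by simp
qed

text \<open>
  The edges counted by the bipartite bound between \<open>N u - L\<close> and \<open>insert u L\<close> include one edge to \<open>u\<close> from
  every vertex of \<open>N u - L\<close>. This is why only one further edge per neighbour remains, up to a multiple
  of the size of \<open>L\<close>.
\<close>

lemma large_codegrees:
  assumes u: "u \<in> V"
  shows "(\<Sum>v\<in>N u. card (N v \<inter> (L - {u}))) \<le> card (N u) + 8 * card L + 5"
proof -
  have LV: "L \<subseteq> V" unfolding L_def by auto
  have finL: "finite L" using LV finV finite_subset by blast
  let ?A = "N u - L" and ?B = "insert u L"
  have A: "finite ?A" "?A \<subseteq> V" using finN NV by auto
  have B: "?B \<subseteq> V" "?A \<inter> ?B = {}" using LV u N_irr[of u] by auto
  have "card (N v \<inter> (L - {u})) + 1 = card (N v \<inter> ?B)" if "v \<in> ?A" for v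
  proof -
    have "u \<in> N v" using that N_sym by auto
    then have "N v \<inter> ?B = insert u (N v \<inter> (L - {u}))" by auto
    then show ?thesis using finN[of v] by simp
  qed
  define s where "s = (\<Sum>v\<in>?A. card (N v \<inter> (L - {u})))"
  define t where "t = (\<Sum>v\<in>?A. card (N v \<inter> ?B))"
  note eq = \<open>\<And>v. v \<in> ?A \<Longrightarrow> card (N v \<inter> (L - {u})) + 1 = card (N v \<inter> ?B)\<close>
  then have "(\<Sum>v\<in>?A. card (N v \<inter> (L - {u})) + 1) = (\<Sum>v\<in>?A. card (N v \<inter> ?B))"
    by (rule sum.cong[OF refl])
  then have "(\<Sum>v\<in>?A. card (N v \<inter> (L - {u}))) + card ?A = (\<Sum>v\<in>?A. card (N v \<inter> ?B))"
    by (simp add: sum.distrib sum_Suc)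
  moreover have "(\<Sum>v\<in>?A. card (N v \<inter> ?B)) \<le> 2 * (card ?A + card ?B) + 3"
    using planar_bipartite_degrees[OF G planarG A(2) B] by linarith
  moreover have "card ?B \<le> card L + 1" using finL by (simp add: card_insert_if)
  ultimately have 1: "(\<Sum>v\<in>?A. card (N v \<inter> (L - {u}))) \<le> card ?A + 2 * card L + 5"
    unfolding s_def[symmetric] t_def[symmetric] by simp
  have "(\<Sum>v\<in>N u \<inter> L. card (N v \<inter> (L - {u}))) \<le> (\<Sum>v\<in>N u \<inter> L. card (N v \<inter> L))"
    by (intro sum_mono card_mono) (use finL in auto)
  also have "\<dots> \<le> (\<Sum>v\<in>L. card (N v \<inter> L))" using finL by (intro sum_mono2) auto
  also have "\<dots> \<le> 6 * card L" by (rule degree_sum[OF LV])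
  finally have 2: "(\<Sum>v\<in>N u \<inter> L. card (N v \<inter> (L - {u}))) \<le> 6 * card L" .
  have "(\<Sum>v\<in>N u. card (N v \<inter> (L - {u}))) =
     (\<Sum>v\<in>N u \<inter> L. card (N v \<inter> (L - {u}))) + (\<Sum>v\<in>?A. card (N v \<inter> (L - {u})))"
    by (rule sum.Int_Diff[OF finN])
  moreover have "card ?A \<le> card (N u)" by (rule card_mono[OF finN]) auto
  ultimately show ?thesis using 1 2 by linarith
qed

text \<open>
  Walks of length two from \<open>u\<close>, split by their end: \<open>u\<close> itself, another vertex of \<open>L\<close>, or a vertex with a
  small entry.
\<close>

lemma second_moment:
  assumes u: "u \<in> V" and m: "0 \<le> m" "\<And>w. w \<in> V - {u} \<Longrightarrow> x w \<le> m"
  shows "r\<^sup>2 * x u \<le> card (N u) * x u + m * (card (N u) + 5 / 10 ^ 4 * real n) + 6 / 1000 * real n"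
proof -
  have LV: "L \<subseteq> V" unfolding L_def by auto
  have inner: "(\<Sum>w\<in>N v. x w) \<le> x u + m * card (N v \<inter> (L - {u})) + 1 / 1000 * card (N v)" if v: "v \<in> N u" for v
  proof -
    have uN: "u \<in> N v" using v N_sym by auto
    have "(\<Sum>w\<in>N v. x w) = x u + (\<Sum>w\<in>N v - {u}. x w)" by (rule sum.remove[OF finN uN])
    also have "(\<Sum>w\<in>N v - {u}. x w) = (\<Sum>w\<in>(N v - {u}) \<inter> L. x w) + (\<Sum>w\<in>(N v - {u}) - L. x w)"
      by (rule sum.Int_Diff) (use finN in auto)
    also have "(\<Sum>w\<in>(N v - {u}) \<inter> L. x w) \<le> (\<Sum>w\<in>(N v - {u}) \<inter> L. m)"
      by (rule sum_mono) (use m NV in blast)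
    also have "\<dots> = m * card (N v \<inter> (L - {u}))"
    proof -
      have "(N v - {u}) \<inter> L = N v \<inter> (L - {u})" by auto
      then show ?thesis by simp
    qed
    also have "(\<Sum>w\<in>(N v - {u}) - L. x w) \<le> (\<Sum>w\<in>(N v - {u}) - L. 1 / 1000)"
      by (rule sum_mono) (use NV in \<open>fastforce simp: L_def\<close>)
    also have "\<dots> \<le> 1 / 1000 * card (N v)"
      using card_mono[OF finN[of v], of "N v - {u} - L"] by auto
    finally show ?thesis by simp
  qed
  have "r\<^sup>2 * x u = r * (\<Sum>v\<in>N u. x v)" using eig[OF u] by (simp add: power2_eq_square)
  also have "\<dots> = (\<Sum>v\<in>N u. \<Sum>w\<in>N v. x w)"
    unfolding sum_distrib_left by (rule sum.cong[OF refl]) (use eig NV in auto)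
  also have "\<dots> \<le> (\<Sum>v\<in>N u. x u + m * card (N v \<inter> (L - {u})) + 1 / 1000 * card (N v))"
    by (rule sum_mono) (rule inner)
  also have "\<dots> = card (N u) * x u + m * real (\<Sum>v\<in>N u. card (N v \<inter> (L - {u}))) + 1 / 1000 * real (\<Sum>v\<in>N u. card (N v))"
    by (simp add: sum.distrib sum_distrib_left)
  also have "\<dots> \<le> card (N u) * x u + m * (card (N u) + 5 / 10 ^ 4 * real n) + 1 / 1000 * (6 * real n)"
  proof -
    have "real (\<Sum>v\<in>N u. card (N v \<inter> (L - {u}))) \<le> real (card (N u) + 8 * card L + 5)"
      using large_codegrees[OF u] by (rule of_nat_mono)
    also have "\<dots> \<le> card (N u) + 5 / 10 ^ 4 * real n" using card_L big by simp
    finally have a: "m * real (\<Sum>v\<in>N u. card (N v \<inter> (L - {u}))) \<le> m * (card (N u) + 5 / 10 ^ 4 * real n)"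
      using m(1) by (rule mult_left_mono)
    have "real (\<Sum>v\<in>N u. card (N v)) \<le> real (6 * n)"
      by (rule of_nat_mono) (rule degree_sum_sub, use NV in auto)
    then show ?thesis using a by simp
  qed
  finally show ?thesis by simp
qed

lemma degree_lower:
  assumes u: "u \<in> V" and m: "0 \<le> m" "m \<le> 1" "\<And>w. w \<in> V - {u} \<Longrightarrow> x w \<le> m"
  shows "2 * real n * x u \<le> card (N u) * x u + m * (card (N u) + 5 / 10 ^ 4 * real n) + 61 / 10 ^ 4 * real n"
proof -
  have "(2 * real n - 4) * x u \<le> r\<^sup>2 * x u" using r(2) pos[OF u] by (intro mult_right_mono) auto
  moreover have "4 * x u \<le> 1 / 10 ^ 4 * real n" using le1[OF u] big by simp
  ultimately show ?thesis using second_moment[OF u m(1,3)] by (simp add: algebra_simps)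
qed

lemma common_neighbours:
  assumes "u \<in> V" "v \<in> V" "w \<in> V" "u \<noteq> v" "u \<noteq> w" "v \<noteq> w"
  shows "card (N u \<inter> N v \<inter> N w) \<le> 2"
proof (rule ccontr)
  assume "\<not> ?thesis"
  then have "3 \<le> card (N u \<inter> N v \<inter> N w)" by simp
  then obtain B where B: "B \<subseteq> N u \<inter> N v \<inter> N w" "card B = 3" by (metis obtain_subset_with_card_n)
  show False
  proof (rule no_K33[of "{u, v, w}" B])
    show "{u, v, w} \<subseteq> V" "card {u, v, w} = 3" using assms by auto
    show "B \<subseteq> V" using B(1) NV by blast
    show "{u, v, w} \<inter> B = {}" using B(1) N_irr by blast
    show "card B = 3" by (rule B(2))
    show "b \<in> N a" if "a \<in> {u, v, w}" "b \<in> B" for a b using that B(1) by blast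
  qed
qed

text \<open>
  The vertex \<open>u1\<close> with entry \<open>1\<close> gets degree almost \<open>n\<close>. For the walks of length two from \<open>u1\<close> to reach weight \<open>2 n\<close>, the largest
  entry elsewhere must be almost \<open>1\<close> as well; its vertex \<open>u2\<close> is the second hub. A third vertex has at
  most two neighbours in common with both hubs, hence small degree and small entry.
\<close>

lemma two_hubs_exist:
  assumes "\<exists>u\<in>V. x u = 1"
  shows "\<exists>u1\<in>V. \<exists>u2\<in>V. u1 \<noteq> u2 \<and> x u1 = 1 \<and> x u2 \<ge> 993 / 1000 \<and>
     real (card (N u1 \<inter> N u2)) \<ge> 98 / 100 * real n \<and>
     (\<forall>w\<in>V - {u1, u2}. x w \<le> 1 / 50) \<and> r\<^sup>2 \<le> 201 / 100 * real n"
proof -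
  obtain u1 where u1: "u1 \<in> V" "x u1 = 1" using assms by blast
  have dn: "card (N v) \<le> n" for v using card_mono[OF finV, of "N v"] NV n by blast
  have d1: "real (card (N u1)) \<ge> 9967 / 10 ^ 4 * real n"
    using degree_lower[OF u1(1), of 1] le1 u1(2) by simp
  have "card (V - {u1}) > 0" using n big u1(1) finV by simp
  then have "V - {u1} \<noteq> {}" by (metis card.empty less_irrefl)
  then have "finite (x ` (V - {u1}))" "x ` (V - {u1}) \<noteq> {}" using finV by blast+
  then have "Max (x ` (V - {u1})) \<in> x ` (V - {u1})" by (rule Max_in)
  then obtain u2 where u2: "u2 \<in> V - {u1}" "x u2 = Max (x ` (V - {u1}))" by (metis imageE)
  have mx: "x w \<le> x u2" if "w \<in> V - {u1}" for w unfolding u2(2) using that finV by (intro Max_ge) auto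
  have u2V: "u2 \<in> V" "u2 \<noteq> u1" using u2 by auto
  have x2: "x u2 \<ge> 993 / 1000"
  proof -
    have "2 * real n \<le> card (N u1) + x u2 * (card (N u1) + 5 / 10 ^ 4 * real n) + 61 / 10 ^ 4 * real n"
      using degree_lower[OF u1(1), of "x u2"] mx pos[OF u2V(1)] le1[OF u2V(1)] u1(2) by simp
    also have "\<dots> \<le> real n + x u2 * (real n + 5 / 10 ^ 4 * real n) + 61 / 10 ^ 4 * real n"
      using dn[of u1] pos[OF u2V(1)] by (intro add_mono mult_left_mono) auto
    finally have "real n * (9939 / 10 ^ 4) \<le> real n * (x u2 * (10005 / 10 ^ 4))" by (simp add: algebra_simps)
    moreover have "real n > 0" using big by simp
    ultimately have "9939 / 10 ^ 4 \<le> x u2 * (10005 / 10 ^ 4)" by (simp only: mult_le_cancel_left_pos)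
    then show ?thesis by simp
  qed
  have d_gen: "2 * real n * x w \<le> 2 * real (card (N w)) + 66 / 10 ^ 4 * real n" if "w \<in> V" for w
  proof -
    have "card (N w) * x w \<le> real (card (N w)) * 1" using le1[OF that] by (intro mult_left_mono) auto
    then show ?thesis using degree_lower[OF that, of 1] le1 by simp
  qed
  have d2: "real (card (N u2)) \<ge> 9897 / 10 ^ 4 * real n"
  proof -
    have "2 * real n * (993 / 1000) \<le> 2 * real n * x u2" using x2 by (intro mult_left_mono) auto
    then show ?thesis using d_gen[OF u2V(1)] by simp
  qed
  have "card (N u1) + card (N u2) = card (N u1 \<union> N u2) + card (N u1 \<inter> N u2)" by (rule card_Un_Int[OF finN finN])
  moreover have "card (N u1 \<union> N u2) \<le> n" using card_mono[OF finV, of "N u1 \<union> N u2"] NV n by blast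
  ultimately have "real (card (N u1)) + real (card (N u2)) \<le> real n + real (card (N u1 \<inter> N u2))" by linarith
  then have R: "real (card (N u1 \<inter> N u2)) \<ge> 9864 / 10 ^ 4 * real n" using d1 d2 by simp
  have small: "x w \<le> 1 / 50" if w: "w \<in> V - {u1, u2}" for w
  proof -
    let ?R = "N u1 \<inter> N u2"
    have "N w \<subseteq> (?R \<inter> N w) \<union> (V - ?R)" using NV by blast
    then have "card (N w) \<le> card ((?R \<inter> N w) \<union> (V - ?R))" using finN finV by (intro card_mono) auto
    also have "\<dots> \<le> card (?R \<inter> N w) + card (V - ?R)" by (rule card_Un_le)
    also have "card (V - ?R) = n - card ?R" using finN n NV by (subst card_Diff_subset) auto
    also have "card (?R \<inter> N w) \<le> 2" using common_neighbours[of u1 u2 w] w u1 u2V by auto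
    finally have "card (N w) \<le> 2 + (n - card ?R)" by simp
    moreover have "card ?R \<le> n" using card_mono[OF finV, of ?R] NV n by blast
    ultimately have "real (card (N w)) \<le> 2 + (real n - real (card ?R))" by linarith
    then have "real (card (N w)) \<le> 2 + 136 / 10 ^ 4 * real n" using R by simp
    then have "2 * real n * x w \<le> 4 + 338 / 10 ^ 4 * real n" using d_gen[of w] w by simp
    also have "\<dots> \<le> 2 * real n * (1 / 50)" using big by simp
    finally have "2 * real n * x w \<le> 2 * real n * (1 / 50)" .
    moreover have "2 * real n > 0" using big by simp
    ultimately show ?thesis by (simp only: mult_le_cancel_left_pos)
  qed
  have "r\<^sup>2 \<le> 201 / 100 * real n"
    using second_moment[OF u1(1), of 1] le1 u1(2) dn[of u1] by simp
  then show ?thesis using u1 u2V x2 R small by (intro bexI[of _ u1] bexI[of _ u2]) auto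
qed

text \<open>
  Planar graphs have a vertex of degree at most five. Removing it loses at most five edges, each
  counted in both directions, whose other end has entry at most \<open>c\<close>.
\<close>

lemma inner_weight:
  assumes "S \<subseteq> V" and c: "\<And>v. v \<in> S \<Longrightarrow> x v \<le> c"
  shows "(\<Sum>v\<in>S. \<Sum>u\<in>N v \<inter> S. x v * x u) \<le> 10 * c * (\<Sum>v\<in>S. x v)"
  using assms
proof (induction "card S" arbitrary: S rule: less_induct)
  case less
  show ?case
  proof (cases "S = {}")
    case False
    have finS: "finite S" using less.prems(1) finV finite_subset by blast
    have "\<exists>v\<in>S. card (N v \<inter> S) \<le> 5"
    proof (rule ccontr)
      assume "\<not> ?thesis"
      then have "(\<Sum>v\<in>S. 6) \<le> (\<Sum>v\<in>S. card (N v \<inter> S))" by (intro sum_mono) force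
      then show False using planar_inner_degrees[OF G planarG less.prems(1) False] by simp
    qed
    then obtain v where v: "v \<in> S" "card (N v \<inter> S) \<le> 5" by blast
    let ?S = "S - {v}"
    have xp: "0 < x w" if "w \<in> S" for w using that less.prems(1) pos by blast
    have cv: "0 \<le> c" using xp[OF v(1)] less.prems(2)[OF v(1)] by simp
    have split: "(\<Sum>u\<in>N w \<inter> S. x w * x u) = (\<Sum>u\<in>N w \<inter> ?S. x w * x u) + (if v \<in> N w then x w * x v else 0)" for w
    proof (cases "v \<in> N w")
      case True
      have "N w \<inter> S = insert v (N w \<inter> ?S)" using True v(1) by auto
      then show ?thesis using True finN[of w] by simp
    next
      case False
      then have "N w \<inter> S = N w \<inter> ?S" by auto
      then show ?thesis using False by simp
    qed
    have "(\<Sum>w\<in>S. \<Sum>u\<in>N w \<inter> S. x w * x u) = (\<Sum>u\<in>N v \<inter> S. x v * x u) + (\<Sum>w\<in>?S. \<Sum>u\<in>N w \<inter> S. x w * x u)"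
      by (rule sum.remove[OF finS v(1)])
    also have "(\<Sum>w\<in>?S. \<Sum>u\<in>N w \<inter> S. x w * x u) = (\<Sum>w\<in>?S. \<Sum>u\<in>N w \<inter> ?S. x w * x u) + (\<Sum>w\<in>?S. if v \<in> N w then x w * x v else 0)"
      unfolding split by (rule sum.distrib)
    also have "(\<Sum>w\<in>?S. if v \<in> N w then x w * x v else 0) = (\<Sum>w\<in>?S \<inter> {w. v \<in> N w}. x w * x v)"
      using finS by (simp add: sum.inter_restrict)
    also have "?S \<inter> {w. v \<in> N w} = N v \<inter> S" using N_sym N_irr by auto
    also have "(\<Sum>w\<in>?S. \<Sum>u\<in>N w \<inter> ?S. x w * x u) \<le> 10 * c * (\<Sum>w\<in>?S. x w)"
    proof (rule less.hyps)
      show "card ?S < card S" using v(1) finS by (intro psubset_card_mono) auto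
    qed (use less.prems in auto)
    also have "(\<Sum>u\<in>N v \<inter> S. x v * x u) \<le> 5 * c * x v"
    proof -
      have "(\<Sum>u\<in>N v \<inter> S. x v * x u) \<le> (\<Sum>u\<in>N v \<inter> S. x v * c)"
        by (intro sum_mono mult_left_mono) (use less.prems(2) xp[OF v(1)] in auto)
      also have "\<dots> = real (card (N v \<inter> S)) * (x v * c)" by simp
      also have "\<dots> \<le> 5 * (x v * c)" using v(2) xp[OF v(1)] cv by (intro mult_right_mono) auto
      finally show ?thesis by (simp add: algebra_simps)
    qed
    also have "(\<Sum>w\<in>N v \<inter> S. x w * x v) \<le> 5 * c * x v"
    proof -
      have "(\<Sum>w\<in>N v \<inter> S. x w * x v) \<le> (\<Sum>w\<in>N v \<inter> S. c * x v)"
        by (intro sum_mono mult_right_mono) (use less.prems(2) xp[OF v(1)] in auto)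
      also have "\<dots> = real (card (N v \<inter> S)) * (c * x v)" by simp
      also have "\<dots> \<le> 5 * (c * x v)" using v(2) xp[OF v(1)] cv by (intro mult_right_mono) auto
      finally show ?thesis by (simp add: algebra_simps)
    qed
    also have "5 * c * x v + (10 * c * (\<Sum>w\<in>?S. x w) + 5 * c * x v) = 10 * c * (\<Sum>w\<in>S. x w)"
      using sum.remove[OF finS v(1), of x] by (simp add: algebra_simps)
    finally show ?thesis by simp
  qed simp
qed

end

section \<open>Rewiring the vertices outside the common neighbourhood\<close>

locale two_hubs = planar_eigen +
  fixes u1 u2 :: 'a
  assumes hub: "u1 \<in> V" "u2 \<in> V" "u1 \<noteq> u2"
    and x1: "x u1 = 1" and x2: "993 / 1000 \<le> x u2"
    and R_large: "98 / 100 * real n \<le> real (card (N u1 \<inter> N u2))"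
    and small: "\<And>w. w \<in> V - {u1, u2} \<Longrightarrow> x w \<le> 1 / 50"
    and r_upper: "r\<^sup>2 \<le> 201 / 100 * real n"
begin

definition R where "R = N u1 \<inter> N u2"
definition T where "T = V - {u1, u2} - R"

lemma R_facts: "R \<subseteq> V" "u1 \<notin> R" "u2 \<notin> R" "finite R"
  unfolding R_def using NV N_irr finN by auto

lemma T_facts: "T \<subseteq> V" "u1 \<notin> T" "u2 \<notin> T" "finite T" "R \<inter> T = {}" "V = {u1, u2} \<union> R \<union> T"
  unfolding T_def using finV R_facts(1) hub by auto

lemma R_N: "a \<in> R \<Longrightarrow> a \<in> N u1 \<and> a \<in> N u2 \<and> u1 \<in> N a \<and> u2 \<in> N a"
  unfolding R_def using N_sym by blast

lemma R_degree: "w \<in> V \<Longrightarrow> w \<noteq> u1 \<Longrightarrow> w \<noteq> u2 \<Longrightarrow> card (N w \<inter> R) \<le> 2"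
  using common_neighbours[of u1 u2 w] hub unfolding R_def by (simp add: Int_commute)

abbreviation GR where "GR \<equiv> induced G R"

lemma adj_GR: "adj GR a b \<longleftrightarrow> a \<in> R \<and> b \<in> R \<and> b \<in> N a"
  unfolding adj_def by (auto simp: arc_N)

lemma GR_sym: "adj GR a b \<Longrightarrow> adj GR b a" unfolding adj_GR using N_sym by blast

lemma GR_degree: "degree_le_two (adj GR)"
  unfolding degree_le_two_def
proof (intro allI impI, rule ccontr)
  fix a b c d assume a: "adj GR a b" "adj GR a c" "adj GR a d" and n: "\<not> (b = c \<or> b = d \<or> c = d)"
  have "{b, c, d} \<subseteq> N a \<inter> R" using a unfolding adj_GR by auto
  then have "card {b, c, d} \<le> card (N a \<inter> R)" using finN by (intro card_mono) auto
  also have "\<dots> \<le> 2" using a R_facts unfolding adj_GR by (intro R_degree) auto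
  finally show False using n by simp
qed

text \<open>
  Two adjacent hubs joined to the \<open>k\<close> vertices of a graph of minimum degree two make at least
  \<open>3 k + 1\<close> edges on \<open>k + 2\<close> vertices, one more than planarity permits. A further common neighbour \<open>d\<close> of the
  hubs serves as well as the edge between them.
\<close>

lemma double_wheel_nonplanar:
  assumes C: "C \<subseteq> R" "C \<noteq> {}" "\<And>a. a \<in> C \<Longrightarrow> \<exists>b\<in>C. \<exists>c\<in>C. b \<noteq> c \<and> adj GR a b \<and> adj GR a c"
    and u12: "u2 \<in> N u1 \<or> (\<exists>d. d \<in> R \<and> d \<notin> C)"
  shows False
proof -
  let ?B = "{(v, w) \<in> parcs G. v \<in> C \<and> w \<in> C}"
  define K where "K = \<lparr> pverts = {u1, u2} \<union> C,
    parcs = {(u1, u2), (u2, u1)} \<union> {u1, u2} \<times> C \<union> C \<times> {u1, u2} \<union> ?B \<rparr>"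
  have fC: "finite C" using C(1) R_facts(4) finite_subset by blast
  have nC: "u1 \<notin> C" "u2 \<notin> C" using C(1) R_facts by auto
  have PK: "pair_graph K"
    using fC nC hub(3) N_sym N_irr by (intro pair_graphI) (auto simp: K_def arc_N)
  have cG: "{u1, u2} \<times> C \<union> C \<times> {u1, u2} \<union> ?B \<subseteq> parcs G"
    using C(1) R_N by (auto simp: arc_N)
  have "planar K"
    using u12
  proof
    assume "u2 \<in> N u1"
    then have "(u1, u2) \<in> parcs G" "(u2, u1) \<in> parcs G" using N_sym by (auto simp: arc_N)
    then show ?thesis using cG C(1) R_facts(1) hub
      by (intro planar_subgraph[OF planarG PK]) (auto simp: K_def)
  next
    assume "\<exists>d. d \<in> R \<and> d \<notin> C"
    then obtain d where d: "d \<in> R" "d \<notin> C" by blast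
    then have "d \<noteq> u1" "d \<noteq> u2" "(u1, d) \<in> parcs G" "(d, u2) \<in> parcs G" using R_facts R_N by (auto simp: arc_N)
    then show ?thesis using cG C(1) R_facts(1) hub d
      by (intro planar_suppress[OF G planarG PK _ _ _ _ hub(3), of d]) (auto simp: K_def)
  qed
  have cB: "card ?B \<ge> 2 * card C"
  proof -
    have "2 \<le> card (N a \<inter> C)" if a: "a \<in> C" for a
    proof -
      obtain b c where "b \<in> C" "c \<in> C" "b \<noteq> c" "adj GR a b" "adj GR a c" using C(3)[OF a] by blast
      then have "{b, c} \<subseteq> N a \<inter> C" "card {b, c} = 2" unfolding adj_GR by auto
      then show ?thesis using card_mono[of "N a \<inter> C" "{b, c}"] finN by auto
    qed
    then have "(\<Sum>a\<in>C. 2) \<le> (\<Sum>a\<in>C. card (N a \<inter> C))" by (rule sum_mono)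
    then show ?thesis using card_arcs_between[OF G fC, of C] by simp
  qed
  have finB: "finite ?B" using pair_graph_facts(2)[OF G] by (rule rev_finite_subset) auto
  let ?E1 = "{(u1, u2), (u2, u1)}" and ?E2 = "{u1, u2} \<times> C" and ?E3 = "C \<times> {u1, u2}"
  have "card (?E1 \<union> ?E2) = card ?E1 + card ?E2"
    by (rule card_Un_disjoint) (use fC nC in auto)
  moreover have "card (?E1 \<union> ?E2 \<union> ?E3) = card (?E1 \<union> ?E2) + card ?E3"
    by (rule card_Un_disjoint) (use fC nC in auto)
  moreover have "card (?E1 \<union> ?E2 \<union> ?E3 \<union> ?B) = card (?E1 \<union> ?E2 \<union> ?E3) + card ?B"
    by (rule card_Un_disjoint) (use fC nC finB in auto)
  ultimately have "card (parcs K) = card ?E1 + card ?E2 + card ?E3 + card ?B" unfolding K_def by simp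
  also have "\<dots> = 2 + 4 * card C + card ?B" using hub(3) fC by (simp add: card_cartesian_product)
  finally have "card (parcs K) \<ge> 2 + 6 * card C" using cB by linarith
  moreover have "card (pverts K) = card C + 2" unfolding K_def using nC hub(3) fC by simp
  moreover have "card C \<ge> 1" using C(2) fC by (simp add: Suc_le_eq card_gt_0_iff)
  ultimately show False using planar_arc_bounds(1)[OF PK \<open>planar K\<close>] by linarith
qed

lemma GR_cycle:
  assumes zs: "cycle_list (adj GR) zs"
  shows "u2 \<notin> N u1" "set zs = R"
proof -
  have two: "\<exists>b\<in>set zs. \<exists>c\<in>set zs. b \<noteq> c \<and> adj GR a b \<and> adj GR a c" if "a \<in> set zs" for a
    using cycle_list_two_neighbours[OF GR_sym zs that] .
  then have sub: "set zs \<subseteq> R" unfolding adj_GR by blast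
  have ne: "set zs \<noteq> {}" using zs unfolding cycle_list_def by auto
  show "u2 \<notin> N u1" using double_wheel_nonplanar[OF sub ne two] by blast
  show "set zs = R" using double_wheel_nonplanar[OF sub ne two] sub by blast
qed

definition rewired :: "('a \<times> 'a) set \<Rightarrow> 'a set \<Rightarrow> 'a pair_pre_digraph" where
  "rewired D U = \<lparr> pverts = V,
     parcs = ({(v, w) \<in> parcs G. v \<notin> T \<and> w \<notin> T} - D) \<union> T \<times> U \<union> U \<times> T \<rparr>"

lemma rewired_arc: "(v, w) \<in> parcs (rewired D U) \<longleftrightarrow>
   (w \<in> N v \<and> v \<notin> T \<and> w \<notin> T \<and> (v, w) \<notin> D) \<or> (v \<in> T \<and> w \<in> U) \<or> (v \<in> U \<and> w \<in> T)"
  unfolding rewired_def by (auto simp: arc_N)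

lemma pair_graph_rewired:
  assumes "sym D" "U \<subseteq> {u1, u2}"
  shows "pair_graph (rewired D U)"
proof (rule pair_graphI)
  show "finite (pverts (rewired D U))" unfolding rewired_def using finV by simp
  fix v w assume a: "(v, w) \<in> parcs (rewired D U)"
  have "v \<in> V" using a T_facts(1) assms(2) hub NV N_sym unfolding rewired_arc by blast
  moreover have "v \<noteq> w" using a T_facts(2,3) assms(2) N_irr unfolding rewired_arc by blast
  moreover have "(w, v) \<in> parcs (rewired D U)" using a N_sym symD[OF assms(1)] unfolding rewired_arc by blast
  ultimately show "v \<in> pverts (rewired D U) \<and> v \<noteq> w \<and> (w, v) \<in> parcs (rewired D U)"
    unfolding rewired_def by simp
qed

text \<open>
  The common neighbours come first on the axis, in an order in which adjacent ones are consecutive,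
  and \<open>T\<close> follows. The outer edge is reserved for the two hubs.
\<close>

lemma planar_rewired_linear:
  assumes D: "sym D" and acyc: "\<And>zs. \<not> cycle_list (\<lambda>a b. adj GR a b \<and> (a, b) \<notin> D) zs"
  shows "planar (rewired D {u1, u2})"
proof -
  let ?E = "\<lambda>a b. adj GR a b \<and> (a, b) \<notin> D"
  have "\<exists>ys. distinct ys \<and> set ys = R \<and>
    (\<forall>i<length ys. \<forall>j<length ys. ?E (ys ! i) (ys ! j) \<longrightarrow> j = Suc i \<or> i = Suc j)"
  proof (rule linear_forest_order)
    show "?E b a" if "?E a b" for a b using that GR_sym D by (auto dest: symD)
    show "\<not> ?E a a" for a using N_irr unfolding adj_GR by blast
    show "degree_le_two ?E" using GR_degree unfolding degree_le_two_def by blast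
  qed (use acyc R_facts in \<open>auto simp: adj_GR\<close>)
  then obtain ys where ys: "distinct ys" "set ys = R"
    "\<And>i j. i < length ys \<Longrightarrow> j < length ys \<Longrightarrow> ?E (ys ! i) (ys ! j) \<Longrightarrow> j = Suc i \<or> i = Suc j" by blast
  obtain ts where ts: "distinct ts" "set ts = T" using finite_distinct_list[OF T_facts(4)] by blast
  define zs where "zs = ys @ ts"
  have zs: "distinct zs" "set zs = V - {u1, u2}" unfolding zs_def using ys ts T_facts R_facts by auto
  obtain s :: "'a \<Rightarrow> nat" where s: "\<And>i. i < length zs \<Longrightarrow> s (zs ! i) = i" using list_index[OF zs(1)] by blast
  have idx: "s v < length zs \<and> zs ! s v = v" if v: "v \<in> V - {u1, u2}" for v
  proof -
    obtain i where "i < length zs" "v = zs ! i" using v zs(2) by (metis in_set_conv_nth)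
    then show ?thesis using s by simp
  qed
  have Rs: "s v < length ys \<and> ys ! s v = v" if v: "v \<in> R" for v
  proof -
    obtain i where i: "i < length ys" "v = ys ! i" using v ys(2) by (metis in_set_conv_nth)
    then have "zs ! i = v" "i < length zs" unfolding zs_def by (auto simp: nth_append)
    then show ?thesis using s[of i] i by auto
  qed
  show ?thesis
  proof (rule planar_two_hubs[of _ u1 u2 "\<lambda>v. real (s v)" "real (length zs)" "V - {u1, u2}" u1 u2])
    show "pair_graph (rewired D {u1, u2})" using pair_graph_rewired D by simp
    show "inj_on (\<lambda>v. real (s v)) (pverts (rewired D {u1, u2}) - {u1, u2})"
    proof (rule inj_onI)
      fix v w assume vw: "v \<in> pverts (rewired D {u1, u2}) - {u1, u2}" "w \<in> pverts (rewired D {u1, u2}) - {u1, u2}"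
        and eq: "real (s v) = real (s w)"
      have "zs ! s v = v" "zs ! s w = w" using vw idx[of v] idx[of w] unfolding rewired_def by auto
      moreover have "s v = s w" using eq by simp
      ultimately show "v = w" by metis
    qed
    show "0 \<le> real (s v) \<and> real (s v) \<le> real (length zs)" if "v \<in> pverts (rewired D {u1, u2}) - {u1, u2}" for v
      using idx[of v] that unfolding rewired_def by auto
    fix v w assume a: "(v, w) \<in> parcs (rewired D {u1, u2})"
    have vw: "v \<in> V" "w \<in> V" using pair_graph_facts(5,6)[OF pair_graph_rewired[OF D] a] unfolding rewired_def by auto
    show "{v, w} = {u1, u2} \<or> (\<exists>y\<in>pverts (rewired D {u1, u2}) - {u1, u2}. {v, w} = {u1, y}) \<or>
       (\<exists>y\<in>V - {u1, u2}. {v, w} = {u2, y}) \<or>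
       v \<in> V - {u1, u2} \<and> w \<in> V - {u1, u2} \<and>
       (\<forall>y\<in>V - {u1, u2}. real (s y) \<le> min (real (s v)) (real (s w)) \<or> max (real (s v)) (real (s w)) \<le> real (s y))"
    proof (cases "v \<in> {u1, u2} \<or> w \<in> {u1, u2}")
      case True
      have "v \<noteq> w" using pair_graph_facts(4)[OF pair_graph_rewired[OF D] a] by simp
      then show ?thesis using True vw unfolding rewired_def by (auto simp: doubleton_eq_iff)
    next
      case False
      then have E: "?E v w" using a vw T_facts(6) unfolding rewired_arc adj_GR by blast
      then have "v \<in> R" "w \<in> R" unfolding adj_GR by auto
      then have "s w = Suc (s v) \<or> s v = Suc (s w)" using ys(3)[of "s v" "s w"] Rs[of v] Rs[of w] E by auto
      then have "\<forall>y. s y \<le> min (s v) (s w) \<or> max (s v) (s w) \<le> s y" by auto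
      then show ?thesis using False vw
        by (metis (no_types, opaque_lifting) Diff_iff of_nat_le_iff of_nat_max of_nat_min)
    qed
  qed (use hub in \<open>auto simp: rewired_def\<close>)
qed

text \<open>
  The cycle is opened on the axis and closed by the outer edge, which is available since the
  hubs are not adjacent. The vertices of \<open>T\<close> hang on the upper hub; their
  segments run between those to the first two vertices on the axis.
\<close>

lemma planar_rewired_cycle:
  assumes zs: "cycle_list (adj GR) zs"
  shows "planar (rewired {} {u1})"
proof -
  note nadj = GR_cycle(1)[OF zs] and all = GR_cycle(2)[OF zs]
  obtain xs where xs: "distinct xs" "set xs = R" "cyclic_adj (adj GR) xs"
    using spanning_cycle_cyclic[OF pair_graph_induced[OF G R_facts(1)] GR_degree zs] all by auto
  define k where "k = length xs"
  have k: "3 \<le> k" using xs(3) unfolding cyclic_adj_def k_def by auto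
  obtain i :: "'a \<Rightarrow> nat" where i: "\<And>j. j < k \<Longrightarrow> i (xs ! j) = j" using list_index[OF xs(1)] unfolding k_def by blast
  have idx: "i v < k" "xs ! i v = v" if v: "v \<in> R" for v
  proof -
    obtain j where "j < k" "v = xs ! j" using v xs(2) unfolding k_def by (metis in_set_conv_nth)
    then show "i v < k" "xs ! i v = v" using i by auto
  qed
  obtain t :: "'a \<Rightarrow> nat" where t: "inj_on t T" using finite_imp_inj_to_nat_seg[OF T_facts(4)] by blast
  define s where "s v = (if v \<in> R then real (i v) else 1 / (real (t v) + 2))" for v
  have sT: "0 < s v \<and> s v < 1" if "v \<in> T" for v using that T_facts(5) unfolding s_def by auto
  have W: "V - {u1, u2} = R \<union> T" using T_facts R_facts by auto
  have sR: "s v = real (i v)" if "v \<in> R" for v using that unfolding s_def by simp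
  show ?thesis
  proof (rule planar_two_hubs[of _ u1 u2 s "real (k - 1)" R "xs ! 0" "xs ! (k - 1)"])
    show "pair_graph (rewired {} {u1})" by (rule pair_graph_rewired) (auto simp: sym_def)
    show "u1 \<in> pverts (rewired {} {u1})" "u2 \<in> pverts (rewired {} {u1})" "u1 \<noteq> u2"
      using hub unfolding rewired_def by auto
    have "inj_on s (R \<union> T)"
    proof (rule inj_onI)
      fix v w assume a: "v \<in> R \<union> T" "w \<in> R \<union> T" "s v = s w"
      have mix: False if "v \<in> R" "w \<in> T" "s v = s w" for v w
        using sT[OF that(2)] sR[OF that(1)] that(3) by (cases "i v") auto
      consider "v \<in> R" "w \<in> R" | "v \<in> T" "w \<in> T" using a mix[of v w] mix[of w v] by auto
      then show "v = w"
      proof cases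
        case 1
        then have "i v = i w" using a(3) sR by simp
        then show ?thesis using idx 1 by metis
      next
        case 2
        then have "v \<notin> R" "w \<notin> R" using T_facts(5) by auto
        then have "t v = t w" using a(3) unfolding s_def by simp
        then show ?thesis using t 2 by (auto dest: inj_onD)
      qed
    qed
    then show "inj_on s (pverts (rewired {} {u1}) - {u1, u2})" unfolding rewired_def using W by simp
    show "0 \<le> s v \<and> s v \<le> real (k - 1)" if "v \<in> pverts (rewired {} {u1}) - {u1, u2}" for v
    proof -
      have "v \<in> R \<or> v \<in> T" using that W unfolding rewired_def by auto
      then show ?thesis
      proof
        assume "v \<in> R" then show ?thesis using sR idx(1)[of v] by auto
      next
        assume "v \<in> T" then show ?thesis using sT[of v] k by auto
      qed
    qed
    show "R \<subseteq> pverts (rewired {} {u1}) - {u1, u2}" unfolding rewired_def using W by auto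
    have ends: "xs ! 0 \<in> R" "xs ! (k - 1) \<in> R" unfolding xs(2)[symmetric] using k unfolding k_def by (auto intro!: nth_mem)
    show "xs ! 0 \<noteq> xs ! (k - 1)" using xs(1) k unfolding k_def by (subst nth_eq_iff_index_eq) auto
    show "xs ! 0 = u1 \<and> xs ! (k - 1) = u2 \<or> xs ! 0 \<in> R \<and> xs ! (k - 1) \<in> R \<and> s (xs ! 0) = 0 \<and> s (xs ! (k - 1)) = real (k - 1)"
      using ends sR i k by auto
    fix v w assume a: "(v, w) \<in> parcs (rewired {} {u1})"
    have vw: "v \<in> V" "w \<in> V" "v \<noteq> w"
      using pair_graph_facts(4-6)[OF pair_graph_rewired[of "{}" "{u1}"] a] unfolding rewired_def by (auto simp: sym_def)
    show "{v, w} = {xs ! 0, xs ! (k - 1)} \<or> (\<exists>y\<in>pverts (rewired {} {u1}) - {u1, u2}. {v, w} = {u1, y}) \<or>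
       (\<exists>y\<in>R. {v, w} = {u2, y}) \<or> v \<in> R \<and> w \<in> R \<and> (\<forall>y\<in>R. s y \<le> min (s v) (s w) \<or> max (s v) (s w) \<le> s y)"
    proof -
      consider "v = u1" | "w = u1" | "v = u2" "w \<noteq> u1" | "w = u2" "v \<noteq> u1" | "v \<in> R \<union> T" "w \<in> R \<union> T"
        using vw W by blast
      then show ?thesis
      proof cases
        case 1
        then have "w \<noteq> u2" using a nadj T_facts(2,3) hub(3) unfolding rewired_arc by auto
        then show ?thesis using 1 vw unfolding rewired_def by auto
      next
        case 2
        then have "v \<noteq> u2" using a nadj T_facts(2,3) hub(3) N_sym unfolding rewired_arc by auto
        then show ?thesis using 2 vw unfolding rewired_def by (auto simp: insert_commute)
      next
        case 3
        then have "w \<in> R" using a vw W hub(3) T_facts(3) unfolding rewired_arc by blast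
        then show ?thesis using 3 by auto
      next
        case 4
        then have "v \<in> R" using a vw W hub(3) T_facts(3) unfolding rewired_arc by blast
        then show ?thesis using 4 by (auto simp: insert_commute)
      next
        case 5
        then have "v \<in> R" "w \<in> R" "w \<in> N v" using a T_facts(2) R_facts(2) unfolding rewired_arc by auto
        then have E: "adj GR (xs ! i v) (xs ! i w)" using idx unfolding adj_GR by simp
        have "i w = Suc (i v) \<or> i v = Suc (i w) \<or> (i v = 0 \<and> i w = k - 1) \<or> (i w = 0 \<and> i v = k - 1)"
          using xs(3) E idx(1)[OF \<open>v \<in> R\<close>] idx(1)[OF \<open>w \<in> R\<close>] unfolding cyclic_adj_def k_def by blast
        moreover have "{v, w} = {xs ! i v, xs ! i w}" using idx(2)[OF \<open>v \<in> R\<close>] idx(2)[OF \<open>w \<in> R\<close>] by simp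
        ultimately have "(i w = Suc (i v) \<or> i v = Suc (i w)) \<or> {v, w} = {xs ! 0, xs ! (k - 1)}"
          by (elim disjE conjE) (simp_all add: insert_commute)
        then consider "i w = Suc (i v) \<or> i v = Suc (i w)" | "{v, w} = {xs ! 0, xs ! (k - 1)}" by blast
        then show ?thesis
        proof cases
          case 1
          have "s y \<le> min (s v) (s w) \<or> max (s v) (s w) \<le> s y" if "y \<in> R" for y
            using 1 sR[OF that] sR[OF \<open>v \<in> R\<close>] sR[OF \<open>w \<in> R\<close>] by auto
          then show ?thesis using \<open>v \<in> R\<close> \<open>w \<in> R\<close> by blast
        qed blast
      qed
    qed
  qed simp
qed

definition arc_weight :: "('a \<times> 'a) set \<Rightarrow> real" where
  "arc_weight A = (\<Sum>(v, w)\<in>A. x v * x w)"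

lemma quad_arc_weight:
  assumes "pair_graph H" shows "quad H x = arc_weight (parcs H)"
proof -
  have "parcs H = Sigma (pverts H) (nbhd H)" using pair_graph_facts(5,6)[OF assms] by (auto simp: nbhd_def)
  then show ?thesis unfolding quad_def arc_weight_def
    using pair_graph_facts(1)[OF assms] finite_nbhd[OF assms] by (simp add: sum.Sigma)
qed

lemma arc_weight_swap: "arc_weight (prod.swap ` A) = arc_weight A"
  unfolding arc_weight_def by (subst sum.reindex) (auto simp: case_prod_beta mult.commute intro: sum.cong)

lemma quad_G_split:
  "quad G x = arc_weight {(v, w) \<in> parcs G. v \<notin> T \<and> w \<notin> T}
     + 2 * (\<Sum>v\<in>T. x v * (\<Sum>w\<in>N v - T. x w)) + (\<Sum>v\<in>T. \<Sum>w\<in>N v \<inter> T. x v * x w)"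
proof -
  let ?A = "{(v, w) \<in> parcs G. v \<notin> T \<and> w \<notin> T}" and ?B = "Sigma T (\<lambda>v. N v - T)" and ?C = "Sigma T (\<lambda>v. N v \<inter> T)"
  have fin: "finite ?A" using pair_graph_facts(2)[OF G] by (rule rev_finite_subset) auto
  have finBC: "finite ?B" "finite ?C" using T_facts(4) finN by auto
  have un: "parcs G = ?A \<union> (?B \<union> (prod.swap ` ?B \<union> ?C))"
    using N_sym by (auto simp: arc_N image_iff)
  have "quad G x = arc_weight (?A \<union> (?B \<union> (prod.swap ` ?B \<union> ?C)))"
    using quad_arc_weight[OF G] un by simp
  also have "\<dots> = arc_weight ?A + (arc_weight ?B + (arc_weight (prod.swap ` ?B) + arc_weight ?C))"
    unfolding arc_weight_def using fin finBC
    by (subst sum.union_disjoint; (auto)?)+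
  also have "arc_weight (prod.swap ` ?B) = arc_weight ?B" by (rule arc_weight_swap)
  also have "arc_weight ?B = (\<Sum>v\<in>T. x v * (\<Sum>w\<in>N v - T. x w))"
    unfolding arc_weight_def using T_facts(4) finN by (simp add: sum.Sigma[symmetric] sum_distrib_left)
  also have "arc_weight ?C = (\<Sum>v\<in>T. \<Sum>w\<in>N v \<inter> T. x v * x w)"
    unfolding arc_weight_def using T_facts(4) finN by (simp add: sum.Sigma[symmetric])
  finally show ?thesis by simp
qed

text \<open>
  Only the deleted arcs \<open>D\<close> inside \<open>R\<close> and the new arcs between \<open>T\<close> and \<open>U\<close> distinguish the rewired
  graph from \<open>G - T\<close>.
\<close>

lemma quad_rewired:
  assumes "sym D" "D \<subseteq> R \<times> R \<inter> parcs G" "U \<subseteq> {u1, u2}"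
  shows "quad (rewired D U) x = arc_weight {(v, w) \<in> parcs G. v \<notin> T \<and> w \<notin> T} - arc_weight D
     + 2 * (\<Sum>v\<in>T. x v) * (\<Sum>w\<in>U. x w)"
proof -
  let ?A = "{(v, w) \<in> parcs G. v \<notin> T \<and> w \<notin> T}"
  have fin: "finite ?A" using pair_graph_facts(2)[OF G] by (rule rev_finite_subset) auto
  have finU: "finite U" using assms(3) finite_subset by blast
  have UT: "U \<inter> T = {}" using assms(3) T_facts by auto
  have DA: "D \<subseteq> ?A" using assms(2) T_facts(5) by auto
  have "quad (rewired D U) x = arc_weight ((?A - D) \<union> (T \<times> U \<union> U \<times> T))"
    using quad_arc_weight[OF pair_graph_rewired[OF assms(1,3)]] unfolding rewired_def by (simp add: Un_assoc)
  also have "\<dots> = arc_weight (?A - D) + (arc_weight (T \<times> U) + arc_weight (U \<times> T))"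
    unfolding arc_weight_def using fin finU T_facts(4) UT
    by (subst sum.union_disjoint; (auto)?)+
  also have "arc_weight (?A - D) = arc_weight ?A - arc_weight D"
    unfolding arc_weight_def using fin DA by (rule sum_diff)
  also have "arc_weight (T \<times> U) = (\<Sum>v\<in>T. x v) * (\<Sum>w\<in>U. x w)"
    unfolding arc_weight_def by (simp add: sum_product sum.cartesian_product)
  also have "arc_weight (U \<times> T) = (\<Sum>v\<in>T. x v) * (\<Sum>w\<in>U. x w)"
    unfolding arc_weight_def by (simp add: sum_product sum.cartesian_product[symmetric] mult.commute[of _ "sum x U"])
  finally show ?thesis by simp
qed

end

text \<open>
  The competitors are described by what makes them free of \<open>F\<close>: the vertices of \<open>T\<close> keep no
  neighbours other than hubs.
\<close>

locale extremal_hubs = two_hubs +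
  assumes extremal: "\<And>H. pair_graph H \<Longrightarrow> pverts H = V \<Longrightarrow> planar H \<Longrightarrow>
    (\<And>v w. (v, w) \<in> parcs H \<Longrightarrow> ((v, w) \<in> parcs G \<and> v \<notin> T \<and> w \<notin> T) \<or>
       (v \<in> T \<and> w \<in> {u1, u2}) \<or> (w \<in> T \<and> v \<in> {u1, u2})) \<Longrightarrow>
    quad H x \<le> quad G x"
begin

text \<open>
  A vertex of \<open>T\<close> has at most two neighbours in \<open>R\<close>, each of entry at most \<open>1 / 50\<close>, and the edges inside \<open>T\<close> are
  bounded by \<open>inner_weight\<close>; together they account for \<open>2 / 25 + 1 / 5 = 7 / 25\<close>.
\<close>

lemma rewiring_bound:
  assumes "sym D" "D \<subseteq> R \<times> R \<inter> parcs G" "U \<subseteq> {u1, u2}" and pl: "planar (rewired D U)"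
    and c: "\<And>v. v \<in> T \<Longrightarrow> (\<Sum>w\<in>N v \<inter> {u1, u2}. x w) \<le> c"
  shows "2 * (\<Sum>v\<in>T. x v) * (\<Sum>w\<in>U. x w) \<le> arc_weight D + (2 * c + 7 / 25) * (\<Sum>v\<in>T. x v)"
proof -
  have xT: "0 < x v" "x v \<le> 1 / 50" if "v \<in> T" for v using that T_facts pos small unfolding T_def by auto
  have "quad (rewired D U) x \<le> quad G x"
  proof (rule extremal[OF pair_graph_rewired[OF assms(1,3)] _ pl])
    show "pverts (rewired D U) = V" unfolding rewired_def by simp
  qed (use assms(3) in \<open>auto simp: rewired_arc arc_N\<close>)
  then have "2 * (\<Sum>v\<in>T. x v) * (\<Sum>w\<in>U. x w) \<le> arc_weight D
     + 2 * (\<Sum>v\<in>T. x v * (\<Sum>w\<in>N v - T. x w)) + (\<Sum>v\<in>T. \<Sum>w\<in>N v \<inter> T. x v * x w)"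
    unfolding quad_rewired[OF assms(1-3)] quad_G_split by simp
  also have "(\<Sum>v\<in>T. \<Sum>w\<in>N v \<inter> T. x v * x w) \<le> 10 * (1 / 50) * (\<Sum>v\<in>T. x v)"
    by (rule inner_weight) (use T_facts xT in auto)
  also have "(\<Sum>v\<in>T. x v * (\<Sum>w\<in>N v - T. x w)) \<le> (\<Sum>v\<in>T. x v * (c + 1 / 25))"
  proof (intro sum_mono mult_left_mono)
    fix v assume v: "v \<in> T"
    have vV: "v \<in> V" "v \<noteq> u1" "v \<noteq> u2" using v T_facts by auto
    have "N v - T = (N v \<inter> {u1, u2}) \<union> (N v \<inter> R)" using NV T_facts R_facts by blast
    then have "(\<Sum>w\<in>N v - T. x w) = (\<Sum>w\<in>N v \<inter> {u1, u2}. x w) + (\<Sum>w\<in>N v \<inter> R. x w)"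
      using finN R_facts by (simp only:) (rule sum.union_disjoint, auto)
    moreover have "(\<Sum>w\<in>N v \<inter> R. x w) \<le> (\<Sum>w\<in>N v \<inter> R. 1 / 50)"
      by (rule sum_mono) (use small R_facts in auto)
    moreover have "\<dots> \<le> 1 / 25" using R_degree[OF vV] by simp
    ultimately show "(\<Sum>w\<in>N v - T. x w) \<le> c + 1 / 25" using c[OF v] by linarith
    show "0 \<le> x v" using xT(1)[OF v] by simp
  qed
  also have "(\<Sum>v\<in>T. x v * (c + 1 / 25)) = (c + 1 / 25) * (\<Sum>v\<in>T. x v)"
    unfolding sum_distrib_right[symmetric] by (rule mult.commute)
  finally show ?thesis by (simp add: algebra_simps)
qed

lemma T_hub_weight: "v \<in> T \<Longrightarrow> (\<Sum>w\<in>N v \<inter> {u1, u2}. x w) \<le> 1"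
proof -
  assume v: "v \<in> T"
  have "\<not> (u1 \<in> N v \<and> u2 \<in> N v)" using v N_sym unfolding T_def R_def by blast
  then have "N v \<inter> {u1, u2} = {} \<or> N v \<inter> {u1, u2} = {u1} \<or> N v \<inter> {u1, u2} = {u2}" by blast
  then show ?thesis using x1 le1[OF hub(2)] by auto
qed

text \<open>
  Let \<open>X\<close> be the total entry of \<open>T\<close>. Joining \<open>T\<close> to both hubs yields edges of weight almost \<open>2 X\<close>. The
  edges given up for this have weight at most \<open>X\<close> at the hubs, because no vertex of \<open>T\<close> sees both of
  them, and at most \<open>7 X / 50\<close> elsewhere. Only when \<open>R\<close> carries a spanning cycle must an edge \<open>ab\<close> inside
  \<open>R\<close> be deleted as well, and then \<open>a\<close> is chosen with minimal entry. Since the entries in \<open>R\<close> sum to at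
  most \<open>r\<close>, the product \<open>r * x a\<close> is at most about \<open>2\<close>, and \<open>x b \<le> 1 / 50\<close>; a vertex of \<open>T\<close> adjacent to a
  hub makes \<open>r * X\<close> at least \<open>993 / 1000\<close>.
\<close>

theorem T_empty: "T = {}"
proof (rule ccontr)
  assume ne: "T \<noteq> {}"
  define X where "X = (\<Sum>v\<in>T. x v)"
  have xT: "0 < x v" if "v \<in> T" for v using that T_facts(1) pos by auto
  have X: "X > 0" unfolding X_def using ne T_facts(4) xT by (intro sum_pos)
  have U: "(\<Sum>w\<in>{u1, u2}. x w) \<ge> 1993 / 1000" using x1 x2 hub(3) by simp
  have XU: "2 * X * (1993 / 1000) \<le> 2 * X * (\<Sum>w\<in>{u1, u2}. x w)" using U X by (intro mult_left_mono) auto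
  show False
  proof (cases "\<exists>zs. cycle_list (adj GR) zs")
    case False
    have "planar (rewired {} {u1, u2})" by (rule planar_rewired_linear) (use False in \<open>auto simp: sym_def\<close>)
    from rewiring_bound[OF _ _ _ this T_hub_weight] have "2 * X * (\<Sum>w\<in>{u1, u2}. x w) \<le> arc_weight {} + (2 + 7 / 25) * X"
      unfolding X_def by (simp add: sym_def)
    then show False using XU X unfolding arc_weight_def by simp
  next
    case True
    then obtain zs where zs: "cycle_list (adj GR) zs" by blast
    note all = GR_cycle(2)[OF zs]
    show False
    proof (cases "\<exists>v\<in>T. N v \<inter> {u1, u2} \<noteq> {}")
      case False
      have "planar (rewired {} {u1})" by (rule planar_rewired_cycle[OF zs])
      from rewiring_bound[OF _ _ _ this, of 0] have "2 * X * (\<Sum>w\<in>{u1}. x w) \<le> arc_weight {} + (0 + 7 / 25) * X"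
        unfolding X_def using False by (simp add: sym_def)
      then show False using X x1 unfolding arc_weight_def by simp
    next
      case True
      then obtain v where v: "v \<in> T" "N v \<inter> {u1, u2} \<noteq> {}" by blast
      have Rne: "R \<noteq> {}" using R_large big unfolding R_def[symmetric] by auto
      obtain a where a: "a \<in> R" "\<And>b. b \<in> R \<Longrightarrow> x a \<le> x b"
      proof -
        have "Min (x ` R) \<in> x ` R" using Rne R_facts(4) by (intro Min_in) auto
        then obtain a where a: "a \<in> R" "x a = Min (x ` R)" by (metis imageE)
        have "x a \<le> x b" if "b \<in> R" for b unfolding a(2) using that R_facts(4) by (intro Min_le) auto
        with a(1) show ?thesis by (rule that)
      qed
      \<comment> \<open>Cutting the cycle next to a minimal entry costs least.\<close>
      obtain b where b: "b \<in> R" "adj GR a b" using cycle_list_two_neighbours[OF GR_sym zs, of a] a(1) all by auto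
      define D where "D = {(a, b), (b, a)}"
      have D: "sym D" "D \<subseteq> R \<times> R \<inter> parcs G" unfolding D_def using a b GR_sym[OF b(2)] by (auto simp: sym_def adj_GR arc_N)
      have ab: "a \<noteq> b" using b(2) N_irr unfolding adj_GR by auto
      have "planar (rewired D {u1, u2})"
      proof (rule planar_rewired_linear[OF D(1)])
        fix ys show "\<not> cycle_list (\<lambda>a b. adj GR a b \<and> (a, b) \<notin> D) ys"
        proof
          assume cy: "cycle_list (\<lambda>a b. adj GR a b \<and> (a, b) \<notin> D) ys"
          then have "cycle_list (adj GR) ys" unfolding cycle_list_def path_list_def by blast
          then have "a \<in> set ys" using GR_cycle(2) a(1) by blast
          moreover have "adj GR c a' \<and> (c, a') \<notin> D" if "adj GR a' c \<and> (a', c) \<notin> D" for a' c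
            using that GR_sym symD[OF D(1), of c a'] by auto
          ultimately obtain c d where
            "c \<noteq> d" "adj GR a c" "(a, c) \<notin> D" "adj GR a d" "(a, d) \<notin> D"
            using cycle_list_two_neighbours[OF _ cy] by blast
          moreover have "(a, b) \<in> D" unfolding D_def by simp
          ultimately show False using GR_degree b(2) unfolding degree_le_two_def by metis
        qed
      qed
      from rewiring_bound[OF D _ this T_hub_weight] have "2 * X * (\<Sum>w\<in>{u1, u2}. x w) \<le> arc_weight D + (2 + 7 / 25) * X"
        unfolding X_def by simp
      with XU have "2 * X * (1993 / 1000) \<le> arc_weight D + (2 + 7 / 25) * X" by (rule order_trans)
      then have "17 / 10 * X \<le> arc_weight D" using X by simp
      also have "arc_weight D = 2 * (x a * x b)" unfolding arc_weight_def D_def using ab by (simp add: mult.commute)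
      finally have main: "17 / 10 * X \<le> 2 * (x a * x b)" .
      have xb: "x b \<le> 1 / 50" "0 < x a" using small[of b] pos[of a] a b R_facts by auto
      have "2 * (x a * x b) \<le> 2 * (x a * (1 / 50))" using xb by (intro mult_left_mono) auto
      with main have 1: "17 / 10 * X \<le> x a / 25" by simp
      have 2: "r * X \<ge> 993 / 1000"
      proof -
        obtain u where u: "u \<in> N v" "u \<in> {u1, u2}" using v(2) by blast
        have vV: "v \<in> V" using v T_facts by auto
        have "993 / 1000 \<le> x u" using u x1 x2 by auto
        also have "x u \<le> (\<Sum>w\<in>N v. x w)" by (rule member_le_sum) (use u finN NV pos in \<open>auto intro: less_imp_le\<close>)
        also have "\<dots> = r * x v" by (rule eig[OF vV])
        also have "\<dots> \<le> r * X" unfolding X_def using r T_facts(4) xT v(1)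
          by (intro mult_left_mono member_le_sum) (auto intro: less_imp_le)
        finally show ?thesis .
      qed
      have 3: "real (card R) * x a \<le> r"
      proof -
        have "real (card R) * x a = (\<Sum>b\<in>R. x a)" by simp
        also have "\<dots> \<le> (\<Sum>b\<in>R. x b)" by (rule sum_mono) (rule a(2))
        also have "\<dots> \<le> (\<Sum>b\<in>N u1. x b)" by (rule sum_mono2) (use finN NV pos in \<open>auto simp: R_def intro: less_imp_le\<close>)
        also have "\<dots> = r" using eig[OF hub(1)] x1 by simp
        finally show ?thesis .
      qed
      have "98 / 100 * real n * x a \<le> real (card R) * x a" using R_large xb unfolding R_def by (intro mult_right_mono) auto
      then have "98 / 100 * real n * x a \<le> r" using 3 by simp
      then have "r * (98 / 100 * real n * x a) \<le> r\<^sup>2" using r(1) by (simp add: power2_eq_square)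
      then have 4: "real n * (r * x a) \<le> 201 / 98 * real n" using r_upper by (simp add: algebra_simps)
      have npos: "real n > 0" using big by simp
      have 4: "r * x a \<le> 201 / 98"
      proof -
        have "real n * (r * x a) \<le> real n * (201 / 98)" using 4 by (simp add: mult.commute)
        then show ?thesis using npos by (simp only: mult_le_cancel_left_pos)
      qed
      have "r * (17 / 10 * X) \<le> r * (x a / 25)" using 1 r(1) by (intro mult_left_mono) auto
      then have "17 / 10 * (r * X) \<le> (r * x a) / 25" by (simp add: algebra_simps)
      also have "\<dots> \<le> (201 / 98) / 25" using 4 by simp
      finally have "17 / 10 * (r * X) \<le> (201 / 98) / 25" .
      moreover have "17 / 10 * (993 / 1000) \<le> 17 / 10 * (r * X)" by (rule mult_left_mono[OF 2]) simp
      ultimately have "17 / 10 * (993 / 1000) \<le> (201 / 98) / (25 :: real)" by (rule order_trans[rotated])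
      then show False by simp
    qed
  qed
qed

end

section \<open>The extremal graph\<close>

text \<open>
  A vertex of \<open>T\<close> used by the copy sees only hubs there, so it can be replaced by any unused vertex of
  \<open>R\<close>; the bound on the order of \<open>F\<close> leaves enough of them.
\<close>

lemma contains_copy_rewired:
  assumes G: "pair_graph G" and F: "pair_graph F"
    and R: "finite R" "R \<subseteq> pverts G" "R \<inter> T = {}" and u: "u1 \<notin> T" "u2 \<notin> T"
    and hubs: "\<And>a. a \<in> R \<Longrightarrow> (a, u1) \<in> parcs G \<and> (a, u2) \<in> parcs G"
    and H: "pverts H = pverts G"
      "\<And>v w. (v, w) \<in> parcs H \<Longrightarrow> ((v, w) \<in> parcs G \<and> v \<notin> T \<and> w \<notin> T) \<or>
         (v \<in> T \<and> w \<in> {u1, u2}) \<or> (w \<in> T \<and> v \<in> {u1, u2})"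
    and card: "card (pverts F) \<le> card R"
    and copy: "contains_copy (with_proj H) (with_proj F)"
  shows "contains_copy (with_proj G) (with_proj F)"
proof -
  obtain h where h: "inj_on h (pverts F)" "h ` pverts F \<subseteq> pverts H" "\<And>a b. (a, b) \<in> parcs F \<Longrightarrow> (h a, h b) \<in> parcs H"
    using contains_copyD[OF copy] by blast
  let ?P = "h ` pverts F"
  have finF: "finite (pverts F)" by (rule pair_graph_facts[OF F])
  have finP: "finite ?P" using finF by simp
  have "card (?P \<inter> T) + card (?P \<inter> R) = card ((?P \<inter> T) \<union> (?P \<inter> R))"
    using finP R(3) by (intro card_Un_disjoint[symmetric]) auto
  also have "\<dots> \<le> card ?P" using finP by (intro card_mono) auto
  also have "\<dots> = card (pverts F)" using h(1) by (rule card_image)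
  also have "\<dots> \<le> card R" by (rule card)
  finally have "card (?P \<inter> T) \<le> card R - card (R \<inter> ?P)" by (simp add: Int_commute)
  also have "\<dots> = card (R - ?P)" using R(1) by (simp add: card_Diff_subset_Int)
  finally obtain g where g: "g ` (?P \<inter> T) \<subseteq> R - ?P" "inj_on g (?P \<inter> T)"
    using card_le_inj[of "?P \<inter> T" "R - ?P"] finP R(1) by auto
  define k where "k v = (if v \<in> T then g v else v)" for v
  have kT: "k v \<in> R - ?P" if "v \<in> ?P" "v \<in> T" for v using that g(1) unfolding k_def by auto
  have kn: "k v = v" if "v \<notin> T" for v using that unfolding k_def by simp
  have kinj: "inj_on k ?P"
  proof (rule inj_onI)
    fix v w assume a: "v \<in> ?P" "w \<in> ?P" "k v = k w"
    show "v = w"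
    proof (cases "v \<in> T"; cases "w \<in> T")
      assume "v \<in> T" "w \<in> T"
      then have "g v = g w" using a(3) unfolding k_def by simp
      then show ?thesis using inj_onD[OF g(2)] a \<open>v \<in> T\<close> \<open>w \<in> T\<close> by blast
    next
      assume "v \<in> T" "w \<notin> T"
      then show ?thesis using kT[OF a(1)] kn[of w] a by auto
    next
      assume "v \<notin> T" "w \<in> T"
      then show ?thesis using kT[OF a(2)] kn[of v] a by auto
    next
      assume "v \<notin> T" "w \<notin> T"
      then show ?thesis using kn a by simp
    qed
  qed
  note FG = pair_graph_facts[OF G] and FF = pair_graph_facts[OF F]
  show ?thesis
  proof (rule contains_copyI[OF wf_pair_graph[OF G] wf_pair_graph[OF F], of "k \<circ> h"])
    show "inj_on (k \<circ> h) (pverts F)" using h(1) kinj by (rule comp_inj_on)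
    show "(k \<circ> h) ` pverts F \<subseteq> pverts G"
    proof
      fix y assume "y \<in> (k \<circ> h) ` pverts F"
      then obtain a where a: "a \<in> pverts F" "y = k (h a)" by auto
      show "y \<in> pverts G"
      proof (cases "h a \<in> T")
        case True then show ?thesis using kT[of "h a"] a R(2) by auto
      next
        case False then show ?thesis using kn[of "h a"] a h(2) H(1) by auto
      qed
    qed
    fix a b assume ab: "(a, b) \<in> parcs F"
    have P: "h a \<in> ?P" "h b \<in> ?P" using FF(5,6)[OF ab] by auto
    from H(2)[OF h(3)[OF ab]] show "((k \<circ> h) a, (k \<circ> h) b) \<in> parcs G"
    proof (elim disjE conjE)
      assume "(h a, h b) \<in> parcs G" "h a \<notin> T" "h b \<notin> T"
      then show ?thesis using kn by simp
    next
      assume a: "h a \<in> T" "h b \<in> {u1, u2}"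
      then have "k (h b) = h b" using kn u by auto
      then show ?thesis using hubs[of "k (h a)"] kT[OF P(1) a(1)] a(2) by auto
    next
      assume a: "h b \<in> T" "h a \<in> {u1, u2}"
      then have "k (h a) = h a" using kn u by auto
      then show ?thesis using hubs[of "k (h b)"] kT[OF P(2) a(1)] a(2) FG(3) by auto
    qed
  qed
qed

text \<open>
  This is \<open>K\<^sub>2\<^sub>,\<^sub>n\<^sub>-\<^sub>2\<close> on a prescribed vertex set, with \<open>{u, v}\<close> as the side of
  size two.
\<close>

definition two_hub_graph :: "'a set \<Rightarrow> 'a \<Rightarrow> 'a \<Rightarrow> 'a pair_pre_digraph" where
  "two_hub_graph V u v = \<lparr> pverts = V, parcs = {u, v} \<times> (V - {u, v}) \<union> (V - {u, v}) \<times> {u, v} \<rparr>"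

lemma pair_graph_two_hub_graph:
  assumes "finite V" "u \<in> V" "v \<in> V" shows "pair_graph (two_hub_graph V u v)"
  using assms by (intro pair_graphI) (auto simp: two_hub_graph_def)

lemma planar_two_hub_graph:
  assumes V: "finite V" "u \<in> V" "v \<in> V" "u \<noteq> v" shows "planar (two_hub_graph V u v)"
proof -
  obtain t :: "'a \<Rightarrow> nat" and m where t: "t ` V = {i. i < m}" "inj_on t V"
    using finite_imp_inj_to_nat_seg[OF V(1)] by blast
  show ?thesis
  proof (rule planar_two_hubs[of _ u v "\<lambda>w. real (t w)" "real m" "V - {u, v}" u v])
    show "inj_on (\<lambda>w. real (t w)) (pverts (two_hub_graph V u v) - {u, v})"
      using t(2) unfolding two_hub_graph_def by (auto intro!: inj_onI dest: inj_onD)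
    show "0 \<le> real (t w) \<and> real (t w) \<le> real m" if "w \<in> pverts (two_hub_graph V u v) - {u, v}" for w
    proof -
      have "t w \<in> t ` V" using that unfolding two_hub_graph_def by auto
      then show ?thesis unfolding t(1) by simp
    qed
  qed (use V pair_graph_two_hub_graph[OF V(1-3)] in \<open>auto simp: two_hub_graph_def\<close>)
qed

lemma two_hub_graph_eigenvector:
  assumes V: "finite V" "u \<in> V" "v \<in> V" "u \<noteq> v" and n: "card V = n" "n \<ge> 3"
  shows "adj_eigenvector (two_hub_graph V u v) (\<lambda>w. if w \<in> {u, v} then 1 else 2 / sqrt (2 * real n - 4)) (sqrt (2 * real n - 4))"
proof -
  let ?K = "two_hub_graph V u v" and ?r = "sqrt (2 * real n - 4)"
  let ?y = "\<lambda>w. if w \<in> {u, v} then 1 else 2 / ?r"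
  have K: "pair_graph ?K" by (rule pair_graph_two_hub_graph[OF V(1-3)])
  have r: "?r > 0" "?r * ?r = 2 * real n - 4" using n by auto
  have cW: "real (card (V - {u, v})) = real n - 2" using V n by (simp add: card_Diff_subset of_nat_diff)
  have nb1: "nbhd ?K w = V - {u, v}" if "w \<in> {u, v}" for w using that V unfolding nbhd_def two_hub_graph_def by auto
  have nb2: "nbhd ?K w = {u, v}" if "w \<in> V - {u, v}" for w using that V unfolding nbhd_def two_hub_graph_def by auto
  have "(\<Sum>z\<in>nbhd ?K w. ?y z) = ?r * ?y w" if "w \<in> V" for w
  proof (cases "w \<in> {u, v}")
    case True
    have "(\<Sum>z\<in>V - {u, v}. ?y z) = (\<Sum>z\<in>V - {u, v}. 2 / ?r)" by (rule sum.cong) auto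
    also have "\<dots> = (real n - 2) * (2 / ?r)" using cW by simp
    also have "\<dots> = ?r * ?r / ?r" unfolding r(2) by simp
    also have "\<dots> = ?r" by (rule nonzero_mult_div_cancel_right) (use r(1) in simp)
    finally show ?thesis using True nb1[OF True] by simp
  next
    case False
    then show ?thesis using nb2[of w] that V(4) r(1) by auto
  qed
  then show ?thesis unfolding adj_eigenvector_def sum_adj_matrix[OF K]
    using V by (auto simp: two_hub_graph_def)
qed

lemma two_hub_graph_K2:
  assumes V: "finite V" "u \<in> V" "v \<in> V" "u \<noteq> v" and n: "card V = n"
  shows "K\<^bsub>2,n - 2\<^esub> (with_proj (two_hub_graph V u v))"
proof -
  have "V = {u, v} \<union> (V - {u, v}) \<and> {u, v} \<inter> (V - {u, v}) = {} \<and> card {u, v} = 2 \<and> card (V - {u, v}) = n - 2 \<and>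
      parcs (two_hub_graph V u v) = {u, v} \<times> (V - {u, v}) \<union> (V - {u, v}) \<times> {u, v}"
  proof (intro conjI)
    show "card (V - {u, v}) = n - 2" using V n by (simp add: card_Diff_subset)
    show "V = {u, v} \<union> (V - {u, v})" "card {u, v} = 2" using V by auto
  qed (auto simp: two_hub_graph_def)
  note parts = this
  have "\<exists>U W. V = U \<union> W \<and> U \<inter> W = {} \<and> card U = 2 \<and> card W = n - 2 \<and>
      parcs (two_hub_graph V u v) = U \<times> W \<union> W \<times> U"
    by (rule exI[of _ "{u, v}"], rule exI[of _ "V - {u, v}"], rule parts)
  then show ?thesis unfolding complete_bipartite_digraph_pair_def using V(1) by (simp add: two_hub_graph_def)
qed

text \<open>
  A copy of \<open>F\<close> is moved along an injection of the vertices into the natural numbers.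
\<close>

lemma two_hub_graph_free:
  fixes V :: "'a set" and F :: "'b pair_pre_digraph"
  assumes V: "finite V" "u \<in> V" "v \<in> V" "u \<noteq> v" and n: "card V = n" and F: "pair_graph F"
    and free: "\<And>K :: nat pair_pre_digraph. K\<^bsub>2,n - 2\<^esub> (with_proj K) \<Longrightarrow> \<not> contains_copy (with_proj K) (with_proj F)"
  shows "\<not> contains_copy (with_proj (two_hub_graph V u v)) (with_proj F)"
proof
  assume "contains_copy (with_proj (two_hub_graph V u v)) (with_proj F)"
  then obtain h where h: "inj_on h (pverts F)" "h ` pverts F \<subseteq> V"
    "\<And>a b. (a, b) \<in> parcs F \<Longrightarrow> (h a, h b) \<in> parcs (two_hub_graph V u v)"
    using contains_copyD[of "two_hub_graph V u v" F] unfolding two_hub_graph_def by (metis pair_pre_digraph.select_convs(1))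
  obtain t :: "'a \<Rightarrow> nat" where t: "inj_on t V" using finite_imp_inj_to_nat_seg[OF V(1)] by blast
  let ?K = "two_hub_graph (t ` V) (t u) (t v)"
  have V': "finite (t ` V)" "t u \<in> t ` V" "t v \<in> t ` V" "t u \<noteq> t v" using V t by (auto dest: inj_onD)
  have "K\<^bsub>2,n - 2\<^esub> (with_proj ?K)" using V' n t by (intro two_hub_graph_K2) (auto simp: card_image)
  from free[OF this] have "\<not> contains_copy (with_proj ?K) (with_proj F)" .
  moreover have "contains_copy (with_proj ?K) (with_proj F)"
  proof (rule contains_copyI[OF wf_pair_graph[OF pair_graph_two_hub_graph[OF V'(1-3)]] wf_pair_graph[OF F], of "t \<circ> h"])
    show "inj_on (t \<circ> h) (pverts F)" using h(1,2) t by (auto intro: comp_inj_on inj_on_subset)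
    show "(t \<circ> h) ` pverts F \<subseteq> pverts ?K" using h(2) unfolding two_hub_graph_def by auto
    fix a b assume "(a, b) \<in> parcs F"
    then have e: "(h a, h b) \<in> parcs (two_hub_graph V u v)" by (rule h(3))
    have "t w = t u \<longleftrightarrow> w = u" "t w = t v \<longleftrightarrow> w = v" if "w \<in> V" for w using t V that by (auto dest: inj_onD)
    then show "((t \<circ> h) a, (t \<circ> h) b) \<in> parcs ?K" using e V unfolding two_hub_graph_def by auto
  qed
  ultimately show False by blast
qed

lemma SPEX_spec_radius_lower:
  fixes F :: "'b pair_pre_digraph" and G :: "'a pair_pre_digraph"
  assumes F: "pair_graph F" and n: "n \<ge> 3"
    and free: "\<And>K :: nat pair_pre_digraph. K\<^bsub>2,n - 2\<^esub> (with_proj K) \<Longrightarrow> \<not> contains_copy (with_proj K) (with_proj F)"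
    and G: "G \<in> SPEX_planar n F"
  shows "sqrt (2 * real n - 4) \<le> spec_radius G"
proof -
  have PG: "pair_graph G" "card (pverts G) = n" using G unfolding SPEX_planar_def planar_free_def by auto
  have finV: "finite (pverts G)" by (rule pair_graph_facts[OF PG(1)])
  have "2 \<le> card (pverts G)" using PG n by simp
  then obtain S where "S \<subseteq> pverts G" "card S = 2" by (metis obtain_subset_with_card_n)
  then obtain u v where uv: "u \<in> pverts G" "v \<in> pverts G" "u \<noteq> v" by (auto simp: card_2_iff)
  let ?K = "two_hub_graph (pverts G) u v"
  have PK: "pair_graph ?K" by (rule pair_graph_two_hub_graph[OF finV uv(1,2)])
  have "pverts ?K = pverts G" unfolding two_hub_graph_def by simp
  then have "planar_free n F ?K"
    unfolding planar_free_def using PK PG(2) planar_two_hub_graph[OF finV uv] two_hub_graph_free[OF finV uv PG(2) F free] by auto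
  then have "spec_radius ?K \<le> spec_radius G" using G unfolding SPEX_planar_def by blast
  moreover have "sqrt (2 * real n - 4) \<le> spec_radius ?K"
    by (rule eigenvalue_le_spec_radius[OF PK two_hub_graph_eigenvector[OF finV uv PG(2) n]])
  ultimately show ?thesis by linarith
qed

text \<open>
  The two hubs have the same neighbours apart from each other, so the difference of their
  eigenvector equations is a nonzero multiple of \<open>x u1 - x u2\<close>. The claims about \<open>G[R]\<close> combine maximum degree two with
  the fact that a cycle of \<open>G[R]\<close> excludes adjacent hubs and fills \<open>R\<close>.
\<close>

lemma (in two_hubs) conclusion:
  assumes T: "T = {}"
  shows "R = V - {u1, u2}" "x u2 = 1" "card R = n - 2"
    "\<exists>S. subgraph S (with_proj G) \<and> K\<^bsub>2,n - 2\<^esub> S"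
    "disjoint_union_of_paths_and_cycles (with_proj GR)"
    "m \<ge> 3 \<Longrightarrow> contains_copy (with_proj GR) (with_proj (cycle_graph m)) \<Longrightarrow>
       digraph_iso (with_proj GR) (with_proj (cycle_graph (n - 2)))"
    "(u1, u2) \<in> parcs G \<Longrightarrow> disjoint_union_of_paths (with_proj GR)"
proof -
  have PGR: "pair_graph GR" by (rule pair_graph_induced[OF G R_facts(1)])
  show R: "R = V - {u1, u2}" using T T_facts R_facts by auto
  show cR: "card R = n - 2" unfolding R using finV hub n by (simp add: card_Diff_subset)
  show "x u2 = 1"
  proof -
    have N1: "N u1 = R \<union> (if u2 \<in> N u1 then {u2} else {})" and N2: "N u2 = R \<union> (if u2 \<in> N u1 then {u1} else {})"
      using R NV N_irr N_sym unfolding R_def by auto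
    have s1: "(\<Sum>w\<in>N u1. x w) = (\<Sum>w\<in>R. x w) + (if u2 \<in> N u1 then x u2 else 0)"
      by (subst N1) (use R_facts in auto)
    have s2: "(\<Sum>w\<in>N u2. x w) = (\<Sum>w\<in>R. x w) + (if u2 \<in> N u1 then x u1 else 0)"
      by (subst N2) (use R_facts in auto)
    have e: "r * x u1 = (\<Sum>w\<in>N u1. x w)" "r * x u2 = (\<Sum>w\<in>N u2. x w)" using eig hub by auto
    show ?thesis
    proof (cases "u2 \<in> N u1")
      case True
      then have "(r + 1) * (x u1 - x u2) = 0" using e s1 s2 by (simp add: algebra_simps)
      then show ?thesis using r(1) x1 by auto
    next
      case False
      then have "r * (x u1 - x u2) = 0" using e s1 s2 by (simp add: algebra_simps)
      then show ?thesis using r(1) x1 by auto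
    qed
  qed
  show "\<exists>S. subgraph S (with_proj G) \<and> K\<^bsub>2,n - 2\<^esub> S"
  proof (intro exI conjI)
    let ?S = "two_hub_graph V u1 u2"
    show "K\<^bsub>2,n - 2\<^esub> (with_proj ?S)" using two_hub_graph_K2[OF finV hub n] .
    have "parcs ?S \<subseteq> parcs G" using R R_N unfolding two_hub_graph_def by (auto simp: arc_N)
    then show "subgraph (with_proj ?S) (with_proj G)"
      unfolding subgraph_def using wf_pair_graph[OF G] wf_pair_graph[OF pair_graph_two_hub_graph[OF finV hub(1,2)]]
      by (auto simp: two_hub_graph_def)
  qed
  note comp = component_path_or_cycle[OF PGR GR_degree]
  show "disjoint_union_of_paths_and_cycles (with_proj GR)"
    unfolding disjoint_union_of_paths_and_cycles_def using comp by blast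
  show "disjoint_union_of_paths (with_proj GR)" if "(u1, u2) \<in> parcs G"
    unfolding disjoint_union_of_paths_def using comp GR_cycle(1) that by (auto simp: arc_N)
  show "digraph_iso (with_proj GR) (with_proj (cycle_graph (n - 2)))"
    if m: "m \<ge> 3" "contains_copy (with_proj GR) (with_proj (cycle_graph m))"
  proof -
    obtain zs where zs: "cycle_list (adj GR) zs" using cycle_copy_cycle_list[OF m(2,1)] by blast
    then have "set zs = pverts GR" using GR_cycle(2) by simp
    then obtain xs where xs: "distinct xs" "set xs = pverts GR" "cyclic_adj (adj GR) xs"
      using spanning_cycle_cyclic[OF PGR GR_degree zs] by blast
    then have "length xs = n - 2" using cR distinct_card[OF xs(1)] by simp
    then show ?thesis using iso_cycle_graph[OF PGR xs] by simp
  qed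
qed

theorem theorem1p1:
  fixes F :: "'b pair_pre_digraph" and G :: "'a pair_pre_digraph"
    and n :: nat and x :: "'a \<Rightarrow> real"
  assumes "pair_graph F" and "planar F"
    and "real n \<ge> max (2.67 * 9 ^ 17) (10 / 9 * real (card (pverts F)))"
    and "\<And>K :: nat pair_pre_digraph. K\<^bsub>2,n - 2\<^esub> (with_proj K) \<Longrightarrow> \<not> contains_copy K F"
    and "G \<in> SPEX_planar n F"
    and "Digraph_Component.connected (with_proj G)"
    and "adj_eigenvector G x (spec_radius G)"
    and "\<And>v. v \<in> pverts G \<Longrightarrow> x v > 0"
    and "Max (x ` pverts G) = 1"
  shows "\<exists>u' \<in> pverts G. \<exists>u'' \<in> pverts G. u' \<noteq> u'' \<and>
    (let R = nbhd G u' \<inter> nbhd G u''; GR = with_proj G \<restriction> R in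
      R = pverts G - {u', u''} \<and> x u' = 1 \<and> x u'' = 1 \<and>
      (\<exists>S. subgraph S (with_proj G) \<and> K\<^bsub>2,n - 2\<^esub> S) \<and>
      disjoint_union_of_paths_and_cycles GR \<and>
      ((\<exists>m \<ge> 3. contains_copy GR (cycle_graph m)) \<longrightarrow> digraph_iso GR (cycle_graph (n - 2))) \<and>
      ((u', u'') \<in> parcs G \<longrightarrow> disjoint_union_of_paths GR))"
proof -
  have spex: "pair_graph G" "planar G" "card (pverts G) = n" "\<not> contains_copy (with_proj G) (with_proj F)"
    and best: "\<And>H :: 'a pair_pre_digraph. planar_free n F H \<Longrightarrow> spec_radius H \<le> spec_radius G"
    using assms(5) unfolding SPEX_planar_def planar_free_def by auto
  have finV: "finite (pverts G)" by (rule pair_graph_facts[OF spex(1)])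
  have big: "real n \<ge> 10 ^ 16" and cF: "real (card (pverts F)) \<le> 9 / 10 * real n" using assms(3) by auto
  then have n3: "n \<ge> 3" by simp
  let ?r = "spec_radius G"
  have low: "sqrt (2 * real n - 4) \<le> ?r" by (rule SPEX_spec_radius_lower[OF assms(1) n3 assms(4,5)])
  have sp: "0 < sqrt (2 * real n - 4)" using n3 by simp
  have "(sqrt (2 * real n - 4))\<^sup>2 \<le> ?r\<^sup>2" using low sp by (intro power_mono) auto
  then have r2: "2 * real n - 4 \<le> ?r\<^sup>2" using n3 by simp
  have le1: "x v \<le> 1" if "v \<in> pverts G" for v
    using Max_ge[of "x ` pverts G" "x v"] that finV assms(9) by auto
  have ne: "pverts G \<noteq> {}" using spex(3) n3 by auto
  then have "Max (x ` pverts G) \<in> x ` pverts G" using finV by (intro Max_in) auto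
  then have one: "\<exists>u\<in>pverts G. x u = 1" unfolding assms(9) by (metis imageE)
  interpret planar_eigen G n x ?r
  proof (rule planar_eigen.intro)
    show "0 < ?r" using low sp by linarith
  qed (use spex big assms(8) le1 r2 eigen_eq[OF spex(1) assms(7)] in auto)
  obtain u1 u2 where u: "u1 \<in> pverts G" "u2 \<in> pverts G" "u1 \<noteq> u2" "x u1 = 1" "x u2 \<ge> 993 / 1000"
    "real (card (nbhd G u1 \<inter> nbhd G u2)) \<ge> 98 / 100 * real n"
    "\<forall>w\<in>pverts G - {u1, u2}. x w \<le> 1 / 50" "?r\<^sup>2 \<le> 201 / 100 * real n"
    using two_hubs_exist[OF one] by blast
  interpret th: two_hubs G n x ?r u1 u2
    by unfold_locales (use u in auto)
  have cFR: "card (pverts F) \<le> card (nbhd G u1 \<inter> nbhd G u2)"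
  proof -
    have "real (card (pverts F)) \<le> real (card (nbhd G u1 \<inter> nbhd G u2))" using cF u(6) by simp
    then show ?thesis by simp
  qed
  interpret eh: extremal_hubs G n x ?r u1 u2
  proof
    fix H assume H: "pair_graph H" "pverts H = pverts G" "planar H" and
      e: "\<And>v w. (v, w) \<in> parcs H \<Longrightarrow> ((v, w) \<in> parcs G \<and> v \<notin> th.T \<and> w \<notin> th.T) \<or>
       (v \<in> th.T \<and> w \<in> {u1, u2}) \<or> (w \<in> th.T \<and> v \<in> {u1, u2})"
    have hubs: "(a, u1) \<in> parcs G \<and> (a, u2) \<in> parcs G" if "a \<in> th.R" for a
      using th.R_N[OF that] by (simp add: arc_N)
    have "\<not> contains_copy (with_proj H) (with_proj F)"
      using contains_copy_rewired[OF spex(1) assms(1) th.R_facts(4,1) th.T_facts(5,2,3) hubs H(2) e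
        cFR[folded th.R_def]] spex(4) by blast
    then have "planar_free n F H" unfolding planar_free_def using H spex(3) by simp
    then have "spec_radius H \<le> ?r" by (rule best)
    moreover have sq: "sqnorm H x = sqnorm G x" "sqnorm G x \<ge> 0" unfolding sqnorm_def H(2) by (auto simp: sum_nonneg)
    moreover have "quad H x \<le> spec_radius H * sqnorm H x" using quad_le_spec_radius[OF H(1)] H(2) ne by simp
    ultimately have "quad H x \<le> ?r * sqnorm G x" by (metis mult_right_mono order_trans)
    then show "quad H x \<le> quad G x" using quad_eigenvector[OF spex(1) assms(7)] by simp
  qed
  note c = th.conclusion[OF eh.T_empty]
  show ?thesis
  proof (rule bexI[of _ u1], rule bexI[of _ u2], rule conjI)
    show "let R = nbhd G u1 \<inter> nbhd G u2; GR = with_proj G \<restriction> R in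
      R = pverts G - {u1, u2} \<and> x u1 = 1 \<and> x u2 = 1 \<and>
      (\<exists>S. subgraph S (with_proj G) \<and> K\<^bsub>2,n - 2\<^esub> S) \<and>
      disjoint_union_of_paths_and_cycles GR \<and>
      ((\<exists>m \<ge> 3. contains_copy GR (cycle_graph m)) \<longrightarrow> digraph_iso GR (cycle_graph (n - 2))) \<and>
      ((u1, u2) \<in> parcs G \<longrightarrow> disjoint_union_of_paths GR)"
      unfolding Let_def with_proj_induced th.R_def[symmetric] using c u(4) by blast
  qed (use u in auto)
qed

end
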